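(* Every indecomposable partition $\lambda$ is determined by the isomorphism class of the ring $R^\lambda$ as a graded $\mathbb{Z}$-algebra: if $\lambda$ and $\mu$ are different indecomposable partitions, then $R^\lambda$ and $R^\mu$ are not isomorphic as graded $\mathbb{Z}$-algebras.
   Context: Partitions are written with parts in weakly increasing order, $\lambda=(\lambda_1\le\cdots\le\lambda_n)$, and are assumed to satisfy $\lambda_i\ge i$ for all $i$. Such a $\lambda$ is indecomposable if there is no $k$ with $\lambda_k=k$, i.e. $\lambda_i>i$ for all $1\le i\le n$. For $1\le i\le n$ and $m\ge0$ let $h_m(i)=h_m(x_1,\ldots,x_i)$ be the complete homogeneous symmetric polynomial of degree $m$ in $x_1,\ldots,x_i$. Define $R^\lambda=\mathbb{Z}[x_1,\ldots,x_n]/I_\lambda$, where $I_\lambda=\langle h_{\lambda_i-i+1}(i):1\le i\le n\rangle$, graded with $\deg x_i=1$. *)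

theory Defs
  imports "HOL-Library.Poly_Mapping" "HOL-Algebra.QuotRing"
begin

section \<open>Partitions\<close>

text \<open>Lists are indexed from 0, the parts \<open>\<lambda>\<^sub>1 \<le> \<dots> \<le> \<lambda>\<^sub>n\<close> from 1.\<close>

definition part :: "nat list \<Rightarrow> nat \<Rightarrow> nat" where
  "part lam i = lam ! (i - 1)"

definition is_partition :: "nat list \<Rightarrow> bool" where
  "is_partition lam \<longleftrightarrow> sorted lam \<and> (\<forall>i\<in>{1..length lam}. part lam i \<ge> i)"

definition indecomposable :: "nat list \<Rightarrow> bool" where
  "indecomposable lam \<longleftrightarrow> is_partition lam \<and> \<not> (\<exists>k\<in>{1..length lam}. part lam k = k)"

lemma indecomposable_iff:
  "indecomposable lam \<longleftrightarrow> sorted lam \<and> (\<forall>i\<in>{1..length lam}. part lam i > i)"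
  unfolding indecomposable_def is_partition_def by (auto simp: less_le)


section \<open>The polynomial rings \<open>\<int>[x\<^sub>1,\<dots>,x\<^sub>n]\<close>\<close>

text \<open>A monomial is its finitely supported exponent vector, and a polynomial maps monomials
  to coefficients; the product on the outer \<open>\<Rightarrow>\<^sub>0\<close> is convolution. The polynomials in
  \<open>x\<^sub>1,\<dots>,x\<^sub>n\<close> are those whose monomials involve only indices in \<open>{1..n}\<close>.\<close>

type_synonym monomial = "nat \<Rightarrow>\<^sub>0 nat"
type_synonym int_mpoly = "monomial \<Rightarrow>\<^sub>0 int"

definition mdeg :: "monomial \<Rightarrow> nat" where
  "mdeg e = (\<Sum>i\<in>Poly_Mapping.keys e. Poly_Mapping.lookup e i)"

definition poly_ring :: "nat \<Rightarrow> int_mpoly ring" where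
  "poly_ring n =
     \<lparr>carrier = {p. \<forall>e\<in>Poly_Mapping.keys p. Poly_Mapping.keys e \<subseteq> {1..n}},
      monoid.mult = (*), one = 1, zero = 0, add = (+)\<rparr>"

definition homogeneous :: "nat \<Rightarrow> nat \<Rightarrow> int_mpoly set" where
  "homogeneous n d = {p \<in> carrier (poly_ring n). \<forall>e\<in>Poly_Mapping.keys p. mdeg e = d}"

text \<open>\<open>complete_hom m i\<close> is \<open>h\<^sub>m(x\<^sub>1,\<dots>,x\<^sub>i)\<close>, the sum of all monomials of degree \<open>m\<close>
  in \<open>x\<^sub>1,\<dots>,x\<^sub>i\<close>.\<close>

definition complete_hom :: "nat \<Rightarrow> nat \<Rightarrow> int_mpoly" where
  "complete_hom m i =
     (\<Sum>e | Poly_Mapping.keys e \<subseteq> {1..i} \<and> mdeg e = m. Poly_Mapping.single e 1)"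


section \<open>The graded rings \<open>R\<^sup>\<lambda>\<close>\<close>

definition part_ideal :: "nat list \<Rightarrow> int_mpoly set" where
  "part_ideal lam =
     Idl\<^bsub>poly_ring (length lam)\<^esub> {complete_hom (part lam i - i + 1) i |i. i \<in> {1..length lam}}"

definition part_ring :: "nat list \<Rightarrow> int_mpoly set ring" where
  "part_ring lam = poly_ring (length lam) Quot part_ideal lam"

definition part_ring_grade :: "nat list \<Rightarrow> nat \<Rightarrow> int_mpoly set set" where
  "part_ring_grade lam d =
     (\<lambda>p. part_ideal lam +>\<^bsub>poly_ring (length lam)\<^esub> p) ` homogeneous (length lam) d"

text \<open>Ring homomorphisms preserve \<open>\<one>\<close> and are therefore \<open>\<int>\<close>-linear, so a ring isomorphism
  is the same as a \<open>\<int>\<close>-algebra isomorphism. A graded one is required to map the degree-\<open>d\<close>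
  component onto the degree-\<open>d\<close> component for every \<open>d\<close>, without regrading.\<close>

definition graded_ring_iso ::
  "('a, 'm) ring_scheme \<Rightarrow> (nat \<Rightarrow> 'a set) \<Rightarrow> ('b, 'k) ring_scheme \<Rightarrow> (nat \<Rightarrow> 'b set) \<Rightarrow> ('a \<Rightarrow> 'b) set"
  where "graded_ring_iso A GA B GB = {f \<in> ring_iso A B. \<forall>d. f ` GA d = GB d}"

definition graded_isomorphic ::
  "('a, 'm) ring_scheme \<Rightarrow> (nat \<Rightarrow> 'a set) \<Rightarrow> ('b, 'k) ring_scheme \<Rightarrow> (nat \<Rightarrow> 'b set) \<Rightarrow> bool"
  where "graded_isomorphic A GA B GB \<longleftrightarrow> graded_ring_iso A GA B GB \<noteq> {}"


section \<open>Well-definedness\<close>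

lemma finite_monomials: "finite {e. Poly_Mapping.keys e \<subseteq> {1..i} \<and> mdeg e = m}"
proof -
  let ?S = "{e. Poly_Mapping.keys e \<subseteq> {1..i} \<and> mdeg e = m}"
  let ?r = "\<lambda>e :: monomial. \<lambda>j\<in>{1..i}. Poly_Mapping.lookup e j"
  have "Poly_Mapping.lookup e j \<le> mdeg e" for e :: monomial and j
    by (cases "j \<in> Poly_Mapping.keys e")
      (auto simp: mdeg_def in_keys_iff intro: member_le_sum)
  then have "?r ` ?S \<subseteq> {1..i} \<rightarrow>\<^sub>E {..m}" by force
  then have fin: "finite (?r ` ?S)"
    by (rule finite_subset) (auto intro: finite_PiE)
  have "inj_on ?r ?S"
  proof (rule inj_onI, rule poly_mapping_eqI)
    fix e e' :: monomial and j assume e: "e \<in> ?S" "e' \<in> ?S" and eq: "?r e = ?r e'"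
    show "Poly_Mapping.lookup e j = Poly_Mapping.lookup e' j"
    proof (cases "j \<in> {1..i}")
      case True then show ?thesis using fun_cong[OF eq, of j] by simp
    next
      case False
      then have "j \<notin> Poly_Mapping.keys e" "j \<notin> Poly_Mapping.keys e'" using e by blast+
      then show ?thesis by (simp add: in_keys_iff)
    qed
  qed
  then show ?thesis using fin by (rule finite_imageD[rotated])
qed

lemma lookup_complete_hom:
  "Poly_Mapping.lookup (complete_hom m i) e =
     (if Poly_Mapping.keys e \<subseteq> {1..i} \<and> mdeg e = m then 1 else 0)"
proof -
  have "Poly_Mapping.lookup (complete_hom m i) e =
      (\<Sum>e' | Poly_Mapping.keys e' \<subseteq> {1..i} \<and> mdeg e' = m. if e' = e then 1 else 0)"
    unfolding complete_hom_def
    by (subst lookup_sum) (auto simp: lookup_single when_def intro: sum.cong)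
  also have "\<dots> = (if Poly_Mapping.keys e \<subseteq> {1..i} \<and> mdeg e = m then 1 else 0)"
    by (subst sum.delta[OF finite_monomials]) simp
  finally show ?thesis .
qed

lemma cring_poly_ring: "cring (poly_ring n)"
proof (rule cringI)
  show "abelian_group (poly_ring n)"
  proof (rule abelian_groupI)
    fix p q assume "p \<in> carrier (poly_ring n)" "q \<in> carrier (poly_ring n)"
    then show "p \<oplus>\<^bsub>poly_ring n\<^esub> q \<in> carrier (poly_ring n)"
      unfolding poly_ring_def using keys_add[of p q] by auto
  next
    fix p assume "p \<in> carrier (poly_ring n)"
    then show "\<exists>q\<in>carrier (poly_ring n). q \<oplus>\<^bsub>poly_ring n\<^esub> p = \<zero>\<^bsub>poly_ring n\<^esub>"
      unfolding poly_ring_def by (intro bexI[of _ "- p"]) (auto simp: in_keys_iff)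
  qed (auto simp: poly_ring_def add_ac)
  show "Group.comm_monoid (poly_ring n)"
  proof (rule comm_monoidI)
    fix p q assume pq: "p \<in> carrier (poly_ring n)" "q \<in> carrier (poly_ring n)"
    show "p \<otimes>\<^bsub>poly_ring n\<^esub> q \<in> carrier (poly_ring n)"
      unfolding poly_ring_def
    proof (simp, rule ballI)
      fix e assume "e \<in> Poly_Mapping.keys (p * q)"
      then obtain a b where "e = a + b" "a \<in> Poly_Mapping.keys p" "b \<in> Poly_Mapping.keys q"
        using keys_mult[of p q] by blast
      then show "Poly_Mapping.keys e \<subseteq> {Suc 0..n}"
        using pq keys_add[of a b] unfolding poly_ring_def by fastforce
    qed
  qed (auto simp: poly_ring_def mult_ac)
qed (auto simp: poly_ring_def algebra_simps)

lemma complete_hom_homogeneous: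
  assumes "i \<le> n" shows "complete_hom m i \<in> homogeneous n m"
proof -
  have "Poly_Mapping.keys e \<subseteq> {1..i} \<and> mdeg e = m"
    if "e \<in> Poly_Mapping.keys (complete_hom m i)" for e
    using that unfolding in_keys_iff lookup_complete_hom by (simp split: if_splits)
  then show ?thesis using assms unfolding homogeneous_def poly_ring_def by fastforce
qed

lemma ideal_part_ideal: "ideal (part_ideal lam) (poly_ring (length lam))"
  unfolding part_ideal_def
  by (rule ring.genideal_ideal[OF cring.axioms(1)[OF cring_poly_ring]])
    (use complete_hom_homogeneous in \<open>auto simp: homogeneous_def\<close>)

lemma cring_part_ring: "cring (part_ring lam)"
  unfolding part_ring_def by (rule ideal.quotient_is_cring[OF ideal_part_ideal cring_poly_ring])

end

theory Submission
  imports Defs "HOL-Computational_Algebra.Polynomial"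
begin

text \<open>
  A graded isomorphism is induced by an invertible integral substitution of linear forms that
  carries \<open>I\<^sub>\<lambda>\<close> into \<open>I\<^sub>\<mu>\<close>, so it preserves the nilpotence orders of linear forms. Let \<open>N = \<lambda>\<^sub>1\<close>.
  No nonzero linear form of \<open>R\<^sup>\<lambda>\<close> has order less than \<open>N\<close>, and those with \<open>f\<^sup>N = 0\<close> span the same
  rational space as the \<open>x\<^sub>j\<close> with \<open>\<lambda>\<^sub>j = N\<close>, except that \<open>x\<^sub>N\<close> joins in when \<open>N\<close> is even and \<open>\<lambda>\<close>
  begins with \<open>N - 1\<close> parts \<open>N\<close> followed by \<open>N + 1\<close>; then \<open>(2x\<^sub>N + x\<^sub>1 + \<dots> + x\<^bsub>N-1\<^esub>)\<^sup>N = 0\<close>. Hence \<open>N\<close> and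
  the dimension of this space determine an initial segment of \<open>\<lambda>\<close>, and dividing by the corresponding
  variables leaves the ring of a shorter indecomposable partition.

  To see that powers of other forms do not vanish, \<open>I\<^sub>\<lambda>\<close> is replaced by the ideal of all \<open>p\<close> whose product
  with the Vandermonde product lies in the monomial ideal \<open>(x\<^sub>1\<^bsup>\<lambda>\<^sub>1\<^esup>, \<dots>, x\<^sub>n\<^bsup>\<lambda>\<^sub>n\<^esup>)\<close>. It contains \<open>I\<^sub>\<lambda>\<close>, and
  membership can be tested on coefficients. If all parts equal \<open>N = n\<close>, letting polynomials act by
  differentiation shows that \<open>f\<^sup>M = 0\<close> forces \<open>\<Prod>\<^bsub>i<j\<^esub> (y\<^sub>i - y\<^sub>j)\<close> to have degree below \<open>M\<close> along the line in
  direction \<open>c\<close>, where \<open>f = \<Sum>\<^sub>j c\<^sub>j x\<^sub>j\<close>; this degree is the number of pairs \<open>i < j\<close> with \<open>c\<^sub>i \<noteq> c\<^sub>j\<close>.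
\<close>

section \<open>Linear extension and substitution\<close>

text \<open>The Vandermonde product enters through the ratio of alternants: up to sign
  \<open>h m T * vdm X T\<close> is the alternant with exponents
  \<open>0, ..., card T - 2, m + card T - 1\<close>, so each of its monomials has an exponent
  \<open>m + card T - 1\<close>. For the generator with \<open>m = \<lambda>\<^sub>i - i + 1\<close>
  and \<open>T = {1..i}\<close> this exponent is \<open>\<lambda>\<^sub>i\<close>, which is where
  the monomial ideal comes from.

  The obstacle is that forms of order \<open>N\<close> do not always see the block of equal parts
  alone. The sum \<open>W\<close> of \<open>N - 1\<close> variables is minus the missing root of the
  coinvariant algebra in \<open>N\<close> variables, so \<open>W ^ N\<close> vanishes; if
  \<open>h 2\<close> of \<open>N\<close> variables vanishes too, then \<open>2 * X N + W\<close> has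
  the same square as \<open>W\<close>. This does no harm in the end: an ordinary block is shorter
  than \<open>N\<close>, because its last part exceeds its index, so dimension \<open>N\<close>
  betrays the exceptional case.

  All computations stay over the integers: the quotient by \<open>K\<close> is torsion-free, and
  dimensions are compared by reducing matrices modulo \<open>2\<close>.\<close>

abbreviation lk :: "('a \<Rightarrow>\<^sub>0 'b::zero) \<Rightarrow> 'a \<Rightarrow> 'b" where "lk \<equiv> Poly_Mapping.lookup"
abbreviation ks :: "('a \<Rightarrow>\<^sub>0 'b::zero) \<Rightarrow> 'a set" where "ks \<equiv> Poly_Mapping.keys"
abbreviation sgl :: "'a \<Rightarrow> 'b \<Rightarrow> 'a \<Rightarrow>\<^sub>0 'b::zero" where "sgl \<equiv> Poly_Mapping.single"

definition lin_ext :: "(monomial \<Rightarrow> 'a::comm_ring_1) \<Rightarrow> int_mpoly \<Rightarrow> 'a" where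
  "lin_ext g p = (\<Sum>e\<in>ks p. of_int (lk p e) * g e)"

lemma lin_ext_superset:
  assumes "finite A" "ks p \<subseteq> A"
  shows "lin_ext g p = (\<Sum>e\<in>A. of_int (lk p e) * g e)"
  unfolding lin_ext_def
  by (rule sum.mono_neutral_left) (use assms in \<open>auto simp: in_keys_iff\<close>)

lemma lin_ext_add: "lin_ext g (p + q) = lin_ext g p + lin_ext g q"
proof -
  have "lin_ext g (p + q) = (\<Sum>e\<in>ks p \<union> ks q. of_int (lk (p + q) e) * g e)"
    by (rule lin_ext_superset) (use keys_add[of p q] in auto)
  also have "\<dots> = (\<Sum>e\<in>ks p \<union> ks q. of_int (lk p e) * g e) + (\<Sum>e\<in>ks p \<union> ks q. of_int (lk q e) * g e)"
    by (simp add: lookup_add algebra_simps sum.distrib)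
  also have "\<dots> = lin_ext g p + lin_ext g q"
    by (simp add: lin_ext_superset[of "ks p \<union> ks q"])
  finally show ?thesis .
qed

lemma lin_ext_0 [simp]: "lin_ext g 0 = 0"
  by (simp add: lin_ext_def)

lemma lin_ext_uminus: "lin_ext g (- p) = - lin_ext g p"
  using lin_ext_add[of g p "- p"] by (simp add: minus_unique)

lemma lin_ext_diff: "lin_ext g (p - q) = lin_ext g p - lin_ext g q"
  using lin_ext_add[of g p "- q"] by (simp add: lin_ext_uminus)

lemma lin_ext_sum: "lin_ext g (\<Sum>i\<in>A. p i) = (\<Sum>i\<in>A. lin_ext g (p i))"
  by (induction A rule: infinite_finite_induct) (simp_all add: lin_ext_add)

lemma lin_ext_single [simp]: "lin_ext g (sgl e c) = of_int c * g e"
  by (cases "c = 0") (simp_all add: lin_ext_def)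

lemma sum_singles: "(\<Sum>e\<in>ks p. sgl e (lk p e)) = p"
  by (rule poly_mapping_eqI)
    (auto simp: lookup_sum lookup_single when_def in_keys_iff sum.delta)

lemma of_int_eq_single: "(of_int c :: int_mpoly) = sgl 0 c"
  by (rule poly_mapping_eqI) (auto simp: lookup_of_int lookup_single when_def)

lemma lin_ext_cong: "(\<And>e. e \<in> ks p \<Longrightarrow> g e = g' e) \<Longrightarrow> lin_ext g p = lin_ext g' p"
  by (simp add: lin_ext_def)

lemma lin_ext_mult:
  assumes "\<And>e e'. g (e + e') = g e * g e'"
  shows "lin_ext g (p * q) = lin_ext g p * lin_ext g q"
proof -
  have "p * q = (\<Sum>e\<in>ks p. \<Sum>e'\<in>ks q. sgl (e + e') (lk p e * lk q e'))"
    by (subst (1) sum_singles[of p, symmetric], subst (1) sum_singles[of q, symmetric])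
      (simp add: sum_product mult_single)
  then have "lin_ext g (p * q) = (\<Sum>e\<in>ks p. \<Sum>e'\<in>ks q. (of_int (lk p e) * g e) * (of_int (lk q e') * g e'))"
    by (simp add: lin_ext_sum assms algebra_simps)
  then show ?thesis by (simp add: lin_ext_def sum_product)
qed

definition mon :: "(nat \<Rightarrow> 'a::comm_ring_1) \<Rightarrow> monomial \<Rightarrow> 'a" where
  "mon u e = (\<Prod>j\<in>ks e. u j ^ lk e j)"

lemma mon_superset: "finite A \<Longrightarrow> ks e \<subseteq> A \<Longrightarrow> mon u e = (\<Prod>j\<in>A. u j ^ lk e j)"
  unfolding mon_def by (rule prod.mono_neutral_left) (auto simp: in_keys_iff)

lemma mon_add: "mon u (e + e') = mon u e * mon u e'"
proof -
  have "mon u (e + e') = (\<Prod>j\<in>ks e \<union> ks e'. u j ^ lk (e + e') j)"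
    by (rule mon_superset) (use keys_add[of e e'] in auto)
  also have "\<dots> = mon u e * mon u e'"
    by (simp add: lookup_add power_add prod.distrib mon_superset[of "ks e \<union> ks e'"])
  finally show ?thesis .
qed

lemma mon_0 [simp]: "mon u 0 = 1"
  by (simp add: mon_def)

lemma mon_single [simp]: "mon u (sgl j k) = u j ^ k"
  by (cases "k = 0") (simp_all add: mon_def)

definition subst :: "(nat \<Rightarrow> 'a::comm_ring_1) \<Rightarrow> int_mpoly \<Rightarrow> 'a" where
  "subst u = lin_ext (mon u)"

definition X :: "nat \<Rightarrow> int_mpoly" where "X j = sgl (sgl j 1) 1"

lemma subst_0 [simp]: "subst u 0 = 0"
  and subst_1 [simp]: "subst u 1 = 1"
  and subst_add [simp]: "subst u (p + q) = subst u p + subst u q"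
  and subst_uminus [simp]: "subst u (- p) = - subst u p"
  and subst_diff [simp]: "subst u (p - q) = subst u p - subst u q"
  and subst_mult [simp]: "subst u (p * q) = subst u p * subst u q"
  and subst_sum: "subst u (\<Sum>i\<in>A. P i) = (\<Sum>i\<in>A. subst u (P i))"
  and subst_X [simp]: "subst u (X j) = u j"
  using lin_ext_single[of "mon u" 0 1]
  by (simp_all add: subst_def lin_ext_add lin_ext_uminus lin_ext_diff lin_ext_mult mon_add
      lin_ext_sum X_def del: lin_ext_single) simp

lemma subst_prod: "subst u (\<Prod>i\<in>A. P i) = (\<Prod>i\<in>A. subst u (P i))"
  by (induction A rule: infinite_finite_induct) simp_all

lemma subst_power [simp]: "subst u (p ^ k) = subst u p ^ k"
  by (induction k) simp_all

lemma subst_of_int [simp]: "subst u (of_int c) = of_int c"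
  by (simp add: subst_def of_int_eq_single)

lemma hom_subst:
  fixes \<phi> :: "'a::comm_ring_1 \<Rightarrow> 'b::comm_ring_1"
  assumes add: "\<And>x y. \<phi> (x + y) = \<phi> x + \<phi> y" and mult: "\<And>x y. \<phi> (x * y) = \<phi> x * \<phi> y"
    and one: "\<phi> 1 = 1"
  shows "\<phi> (subst u p) = subst (\<lambda>j. \<phi> (u j)) p"
proof -
  have zero: "\<phi> 0 = 0" using add[of 0 0] by simp
  have neg: "\<phi> (- x) = - \<phi> x" for x
    using add[of x "- x"] zero by (simp add: minus_unique)
  have ofnat: "\<phi> (of_nat n) = of_nat n" for n by (induction n) (simp_all add: zero add one)
  have ofint: "\<phi> (of_int c) = of_int c" for c
    by (cases c rule: int_cases2) (simp_all add: neg ofnat)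
  have pow: "\<phi> (x ^ k) = \<phi> x ^ k" for x k by (induction k) (simp_all add: one mult)
  have sum: "\<phi> (\<Sum>i\<in>A. P i) = (\<Sum>i\<in>A. \<phi> (P i))" for P and A :: "monomial set"
    by (induction A rule: infinite_finite_induct) (simp_all add: zero add)
  have prod: "\<phi> (\<Prod>i\<in>A. P i) = (\<Prod>i\<in>A. \<phi> (P i))" for P and A :: "nat set"
    by (induction A rule: infinite_finite_induct) (simp_all add: one mult)
  show ?thesis by (simp add: subst_def lin_ext_def mon_def sum prod mult pow ofint)
qed

lemma mon_X: "mon X e = sgl e 1"
proof -
  have pow: "X j ^ k = sgl (sgl j k) 1" for j k
    by (induction k) (simp_all add: X_def mult_single single_add[symmetric])
  have "(\<Prod>j\<in>A. sgl (E j) 1 :: int_mpoly) = sgl (\<Sum>j\<in>A. E j) 1" for E :: "nat \<Rightarrow> monomial" and A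
    by (induction A rule: infinite_finite_induct) (simp_all add: mult_single)
  then have "mon X e = sgl (\<Sum>j\<in>ks e. sgl j (lk e j)) 1"
    by (simp add: mon_def pow)
  moreover have "(\<Sum>j\<in>ks e. sgl j (lk e j)) = e"
    by (rule poly_mapping_eqI)
      (auto simp: lookup_sum lookup_single when_def in_keys_iff sum.delta)
  ultimately show ?thesis by simp
qed

lemma X_power: "X j ^ k = sgl (sgl j k) 1"
  using mon_X[of "sgl j k"] by simp

lemma subst_X_id: "subst X p = p"
proof -
  have "subst X p = (\<Sum>e\<in>ks p. of_int (lk p e) * sgl e 1)"
    by (simp add: subst_def lin_ext_def mon_X)
  also have "\<dots> = (\<Sum>e\<in>ks p. sgl e (lk p e))"
  proof (rule sum.cong)
    fix e
    show "of_int (lk p e) * sgl e 1 = sgl e (lk p e)"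
      by (simp add: of_int_eq_single mult_single)
  qed simp
  finally show ?thesis by (simp add: sum_singles)
qed

lemma subst_cong: "(\<And>e j. e \<in> ks p \<Longrightarrow> j \<in> ks e \<Longrightarrow> u j = u' j) \<Longrightarrow> subst u p = subst u' p"
  unfolding subst_def by (rule lin_ext_cong) (simp add: mon_def)

lemma subst_subst: "subst u (subst v p) = subst (\<lambda>j. subst u (v j)) p"
  by (rule hom_subst) simp_all

section \<open>Multiplication by monomials\<close>

lemma lookup_single_mult: "lk (sgl d 1 * p) (d + e) = lk p (e :: monomial)" for p :: int_mpoly
proof -
  have "sgl d 1 * p = (\<Sum>e'\<in>ks p. sgl (d + e') (lk p e'))"
    by (subst sum_singles[of p, symmetric]) (simp add: sum_distrib_left mult_single)
  then show ?thesis
    by (simp add: lookup_sum lookup_single when_def sum.delta' in_keys_iff)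
qed

lemma keys_single_mult: "e \<in> ks (sgl d 1 * p) \<Longrightarrow> \<exists>e'\<in>ks p. e = d + (e' :: monomial)" for p :: int_mpoly
  using keys_mult[of "sgl d 1" p] by auto

lemma monomial_split:
  fixes e :: monomial assumes "k \<le> lk e a" shows "e = sgl a k + (e - sgl a k)"
  using assms by (intro poly_mapping_eqI) (auto simp: lookup_add lookup_minus lookup_single when_def)

lemma lookup_X_power_mult:
  "lk (X a ^ k * p) e = (if k \<le> lk e a then lk p (e - sgl a k) else 0)"
proof (cases "k \<le> lk e a")
  case True
  then show ?thesis using lookup_single_mult[of "sgl a k" p "e - sgl a k"] monomial_split[OF True]
    by (simp add: X_power)
next
  case False
  have "e \<notin> ks (X a ^ k * p)"
  proof
    assume "e \<in> ks (X a ^ k * p)"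
    then obtain e' where "e = sgl a k + e'" using keys_single_mult unfolding X_power by blast
    then show False using False by (simp add: lookup_add)
  qed
  then show ?thesis using False by (simp add: in_keys_iff)
qed

section \<open>Complete homogeneous polynomials on a set of variables\<close>

lemma mdeg_superset: "finite A \<Longrightarrow> ks e \<subseteq> A \<Longrightarrow> mdeg e = (\<Sum>i\<in>A. lk e i)"
  unfolding mdeg_def by (rule sum.mono_neutral_left) (auto simp: in_keys_iff)

lemma mdeg_add: "mdeg (e + e') = mdeg e + mdeg e'"
proof -
  have "mdeg (e + e') = (\<Sum>i\<in>ks e \<union> ks e'. lk (e + e') i)"
    by (rule mdeg_superset) (use keys_add[of e e'] in auto)
  also have "\<dots> = mdeg e + mdeg e'"
    by (simp add: lookup_add sum.distrib mdeg_superset[of "ks e \<union> ks e'"])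
  finally show ?thesis .
qed

lemma mdeg_single [simp]: "mdeg (sgl a k) = k"
  by (cases "k = 0") (simp_all add: mdeg_def)

lemma mdeg_0 [simp]: "mdeg 0 = 0"
  by (simp add: mdeg_def)

lemma mdeg_eq_0_iff: "mdeg e = 0 \<longleftrightarrow> e = 0"
  by (auto simp: mdeg_def in_keys_iff intro!: poly_mapping_eqI)

lemma lookup_le_mdeg: "lk e j \<le> mdeg e"
  by (cases "j \<in> ks e") (auto simp: mdeg_def in_keys_iff intro: member_le_sum)

lemma finite_monomials_on:
  assumes "finite T" shows "finite {e. ks e \<subseteq> T \<and> mdeg e = m}"
proof -
  let ?S = "{e. ks e \<subseteq> T \<and> mdeg e = m}"
  have "lk ` ?S \<subseteq> {f. \<forall>x. (x \<in> T \<longrightarrow> f x \<in> {..m}) \<and> (x \<notin> T \<longrightarrow> f x = 0)}"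
    using lookup_le_mdeg by (auto simp: in_keys_iff)
  then have "finite (lk ` ?S)"
    by (rule finite_subset) (rule finite_set_of_finite_funs[OF assms], simp)
  then show ?thesis by (rule finite_imageD) (simp add: inj_on_def lookup_inject)
qed

definition h :: "nat \<Rightarrow> nat set \<Rightarrow> int_mpoly" where
  "h m T = (\<Sum>e | ks e \<subseteq> T \<and> mdeg e = m. sgl e 1)"

lemma complete_hom_eq: "complete_hom m i = h m {1..i}"
  by (simp add: complete_hom_def h_def)

lemma lookup_h:
  assumes "finite T" shows "lk (h m T) e = (if ks e \<subseteq> T \<and> mdeg e = m then 1 else 0)"
proof -
  have "lk (h m T) e = (\<Sum>e' | ks e' \<subseteq> T \<and> mdeg e' = m. if e' = e then 1 else 0)"
    unfolding h_def by (subst lookup_sum) (auto simp: lookup_single when_def intro: sum.cong)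
  also have "\<dots> = (if ks e \<subseteq> T \<and> mdeg e = m then 1 else 0)"
    by (subst sum.delta[OF finite_monomials_on[OF assms]]) simp
  finally show ?thesis .
qed

text \<open>Monomials not containing \<open>a\<close> make up the first summand, the others are
  divisible by \<open>X a\<close>. All relations between the polynomials \<open>h m T\<close> below
  come from this recursion.\<close>

lemma h_insert:
  assumes "finite T" "a \<notin> T"
  shows "h (Suc m) (insert a T) = h (Suc m) T + X a * h m (insert a T)"
proof (rule poly_mapping_eqI)
  fix e
  have L: "lk (X a * h m (insert a T)) e
      = (if 1 \<le> lk e a then lk (h m (insert a T)) (e - sgl a 1) else 0)"
    using lookup_X_power_mult[of a 1] by simp
  show "lk (h (Suc m) (insert a T)) e = lk (h (Suc m) T + X a * h m (insert a T)) e"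
  proof (cases "1 \<le> lk e a")
    case True
    obtain e' where e': "e = sgl a 1 + e'" using monomial_split[OF True] by blast
    have "ks e = insert a (ks e')" by (auto simp: e' in_keys_iff lookup_add lookup_single when_def split: if_splits)
    moreover have "lk (X a * h m (insert a T)) e = lk (h m (insert a T)) e'"
      using L True by (simp add: e')
    moreover have "mdeg e = Suc (mdeg e')" by (simp add: e' mdeg_add)
    ultimately show ?thesis using assms by (auto simp: lookup_add lookup_h)
  next
    case False
    then have "a \<notin> ks e" by (simp add: in_keys_iff)
    then show ?thesis using assms False by (auto simp: lookup_add L lookup_h)
  qed
qed

lemma h_0 [simp]: "finite T \<Longrightarrow> h 0 T = 1"
  by (rule poly_mapping_eqI) (auto simp: lookup_h lookup_one when_def mdeg_eq_0_iff)

lemma h_empty [simp]: "h (Suc m) {} = 0"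
  by (rule poly_mapping_eqI) (auto simp: lookup_h)

lemma h_singleton: "h m {a} = X a ^ m"
  by (induction m) (simp_all add: h_insert)

lemma h_1: "finite T \<Longrightarrow> h (Suc 0) T = (\<Sum>a\<in>T. X a)"
  by (induction T rule: finite_induct) (simp_all add: h_insert)

lemma h_exchange:
  assumes "finite T" "i \<in> T" "j \<in> T" "i \<noteq> j"
  shows "(X i - X j) * h m T = h (Suc m) (T - {j}) - h (Suc m) (T - {i})"
proof -
  have "h (Suc m) T = h (Suc m) (T - {k}) + X k * h m T" if "k \<in> T" for k
    using h_insert[of "T - {k}" k m] assms(1) that by (simp add: insert_absorb)
  from this[OF assms(2)] this[OF assms(3)] show ?thesis by (simp add: algebra_simps)
qed

section \<open>Ideals\<close>

text \<open>An ideal of a whole type, hence with infinitely many variables available: the ideals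
  \<open>K S L\<close> for all sets \<open>S\<close> live in one ring, and variables can be added at
  will.\<close>

definition is_ideal :: "'a::comm_ring_1 set \<Rightarrow> bool" where
  "is_ideal Q \<longleftrightarrow> 0 \<in> Q \<and> (\<forall>p\<in>Q. \<forall>q\<in>Q. p + q \<in> Q) \<and> (\<forall>p\<in>Q. \<forall>r. r * p \<in> Q)"

lemma ideal_0: "is_ideal Q \<Longrightarrow> 0 \<in> Q"
  and ideal_add: "is_ideal Q \<Longrightarrow> p \<in> Q \<Longrightarrow> q \<in> Q \<Longrightarrow> p + q \<in> Q"
  and ideal_mult: "is_ideal Q \<Longrightarrow> p \<in> Q \<Longrightarrow> r * p \<in> Q"
  by (simp_all add: is_ideal_def)

lemma ideal_mult': "is_ideal Q \<Longrightarrow> p \<in> Q \<Longrightarrow> p * r \<in> Q"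
  using ideal_mult[of Q p r] by (simp add: mult.commute)

lemma ideal_uminus: "is_ideal Q \<Longrightarrow> p \<in> Q \<Longrightarrow> - p \<in> Q"
  using ideal_mult[of Q p "- 1"] by simp

lemma ideal_diff: "is_ideal Q \<Longrightarrow> p \<in> Q \<Longrightarrow> q \<in> Q \<Longrightarrow> p - q \<in> Q"
  using ideal_add[of Q p "- q"] ideal_uminus[of Q q] by simp

lemma ideal_cong: "is_ideal Q \<Longrightarrow> p - q \<in> Q \<Longrightarrow> p \<in> Q \<longleftrightarrow> q \<in> Q"
  using ideal_add[of Q "p - q" q] ideal_diff[of Q p "p - q"] by auto

text \<open>The elements killed by \<open>r\<close> modulo \<open>Q\<close> form an ideal, so a
  congruence modulo that ideal passes to powers. This serves to replace one linear form by another
  in the presence of a factor \<open>r\<close>.\<close>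

lemma ideal_power_cong:
  assumes "is_ideal Q" "r * (p - q) \<in> Q" shows "r * (p ^ n - q ^ n) \<in> Q"
proof -
  have "p ^ n - q ^ n = (p - q) * (\<Sum>i<n. q ^ (n - Suc i) * p ^ i)"
    by (rule power_diff_sumr2)
  then have "r * (p ^ n - q ^ n) = (\<Sum>i<n. q ^ (n - Suc i) * p ^ i) * (r * (p - q))"
    by (simp only: mult_ac)
  then show ?thesis using ideal_mult[OF assms] by simp
qed

section \<open>Vandermonde products\<close>

definition vdm :: "(nat \<Rightarrow> 'a::comm_ring_1) \<Rightarrow> nat set \<Rightarrow> 'a" where
  "vdm u S = (\<Prod>b\<in>S. \<Prod>a\<in>{a\<in>S. a < b}. (u b - u a))"

lemma subst_vdm: "subst u (vdm v S) = vdm (\<lambda>j. subst u (v j)) S"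
  by (simp add: vdm_def subst_prod)

lemma vdm_singleton [simp]: "vdm u {i} = 1"
proof -
  have e: "{a \<in> {i}. a < i} = {}" by auto
  have "vdm u {i} = (\<Prod>a\<in>{a \<in> {i}. a < i}. u i - u a)"
    unfolding vdm_def by (subst prod.insert) (simp_all only: finite.emptyI empty_iff prod.empty not_False_eq_True mult_1_right)
  then show ?thesis by (simp only: e prod.empty)
qed

text \<open>The sign counts the factors with \<open>b > i\<close>, in which \<open>u i\<close>
  stands second.\<close>

lemma vdm_insert:
  assumes "finite T" "i \<notin> T"
  shows "vdm u (insert i T) = (- 1) ^ card {a\<in>T. i < a} * vdm u T * (\<Prod>a\<in>T. u i - u a)"
proof -
  let ?lo = "{a\<in>T. a < i}" and ?hi = "{a\<in>T. i < a}"
  have "{a \<in> insert i T. a < i} = ?lo" by auto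
  then have "vdm u (insert i T) = (\<Prod>a\<in>?lo. u i - u a) *
      (\<Prod>b\<in>T. \<Prod>a\<in>{a \<in> insert i T. a < b}. (u b - u a))"
    using assms by (simp add: vdm_def)
  also have "(\<Prod>b\<in>T. \<Prod>a\<in>{a \<in> insert i T. a < b}. (u b - u a)) =
      (\<Prod>b\<in>T. (if i < b then u b - u i else 1) * (\<Prod>a\<in>{a \<in> T. a < b}. (u b - u a)))"
  proof (rule prod.cong)
    fix b assume "b \<in> T"
    have "{a \<in> insert i T. a < b} = (if i < b then insert i {a \<in> T. a < b} else {a \<in> T. a < b})"
      by auto
    then show "(\<Prod>a\<in>{a \<in> insert i T. a < b}. (u b - u a)) =
        (if i < b then u b - u i else 1) * (\<Prod>a\<in>{a \<in> T. a < b}. (u b - u a))"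
      using assms by simp
  qed simp
  also have "\<dots> = (\<Prod>b\<in>T. if i < b then u b - u i else 1) * vdm u T"
    by (simp add: prod.distrib vdm_def)
  also have "(\<Prod>b\<in>T. if i < b then u b - u i else 1) = (\<Prod>b\<in>?hi. u b - u i)"
    using assms(1) by (simp add: prod.inter_filter)
  also have "\<dots> = (\<Prod>b\<in>?hi. (- 1) * (u i - u b))" by simp
  also have "\<dots> = (- 1) ^ card ?hi * (\<Prod>b\<in>?hi. u i - u b)"
    by (subst prod.distrib) simp
  finally have *: "vdm u (insert i T) = (- 1) ^ card ?hi * vdm u T *
      ((\<Prod>a\<in>?lo. u i - u a) * (\<Prod>b\<in>?hi. u i - u b))"
    by (simp add: algebra_simps)
  have "T = ?lo \<union> ?hi" using assms(2) by auto (metis nat_neq_iff)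
  then have "(\<Prod>a\<in>T. u i - u a) = (\<Prod>a\<in>?lo. u i - u a) * (\<Prod>b\<in>?hi. u i - u b)"
    using assms(1) by (metis (no_types, lifting) disjoint_iff finite_Un mem_Collect_eq order_less_asym prod.union_disjoint)
  then show ?thesis using * by simp
qed

text \<open>The sign is left open, since membership in the ideals \<open>J\<close> and
  \<open>K\<close> does not depend on it.\<close>

lemma vdm_remove:
  assumes "finite S" "i \<in> S"
  obtains n where "vdm u S = (- 1) ^ n * vdm u (S - {i}) * (\<Prod>a\<in>S - {i}. u i - u a)"
  using vdm_insert[of "S - {i}" i u] assms by (auto simp: insert_absorb)

lemma vdm_dvd:
  assumes "finite S" "T \<subseteq> S" shows "vdm u T dvd vdm u S"
proof -
  have "finite (S - T)" using assms(1) by simp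
  then have "vdm u T dvd vdm u (T \<union> (S - T))"
  proof (induction rule: finite_induct)
    case (insert i A)
    show ?case
    proof (cases "i \<in> T")
      case True
      then show ?thesis using insert by (simp add: insert_absorb)
    next
      case False
      then obtain n where "vdm u (insert i (T \<union> A)) =
          (- 1) ^ n * vdm u (T \<union> A) * (\<Prod>a\<in>T \<union> A. u i - u a)"
        using vdm_insert[of "T \<union> A" i u] insert finite_subset[OF assms(2,1)] by auto
      then show ?thesis using insert.IH by (simp add: dvd_mult2 dvd_mult)
    qed
  qed simp
  then show ?thesis using assms(2) by (simp add: Un_absorb1)
qed

section \<open>Degree in one variable\<close>

text \<open>A strict bound also covers the polynomial \<open>0\<close>, and
  \<open>deg_less i 1 p\<close> says that \<open>X i\<close> does not occur in
  \<open>p\<close>.\<close>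

definition deg_less :: "nat \<Rightarrow> nat \<Rightarrow> int_mpoly \<Rightarrow> bool" where
  "deg_less i m p \<longleftrightarrow> (\<forall>e\<in>ks p. lk e i < m)"

lemma deg_less_0 [simp]: "deg_less i m 0"
  by (simp add: deg_less_def)

lemma deg_less_mono: "deg_less i m p \<Longrightarrow> m \<le> n \<Longrightarrow> deg_less i n p"
  unfolding deg_less_def by force

lemma deg_less_add: "deg_less i m p \<Longrightarrow> deg_less i m q \<Longrightarrow> deg_less i m (p + q)"
  unfolding deg_less_def using keys_add[of p q] by blast

lemma deg_less_uminus: "deg_less i m p \<Longrightarrow> deg_less i m (- p)"
  unfolding deg_less_def by simp

lemma deg_less_diff: "deg_less i m p \<Longrightarrow> deg_less i m q \<Longrightarrow> deg_less i m (p - q)"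
  using deg_less_add[of i m p "- q"] deg_less_uminus[of i m q] by simp

lemma deg_less_sum: "(\<And>x. x \<in> A \<Longrightarrow> deg_less i m (P x)) \<Longrightarrow> deg_less i m (\<Sum>x\<in>A. P x)"
  by (induction A rule: infinite_finite_induct) (simp_all add: deg_less_add)

lemma deg_less_mult: "deg_less i m p \<Longrightarrow> deg_less i (Suc n) q \<Longrightarrow> deg_less i (m + n) (p * q)"
  unfolding deg_less_def using keys_mult[of p q] by (fastforce simp: lookup_add)

lemma deg_less_mult1: "deg_less i 1 p \<Longrightarrow> deg_less i m q \<Longrightarrow> deg_less i m (p * q)"
  using deg_less_mult[of i m q 0 p] by (simp add: mult.commute)

lemma deg_less_1 [simp]: "deg_less i (Suc m) 1"
  by (simp add: deg_less_def)

lemma deg_less_of_int [simp]: "deg_less i (Suc m) (of_int c)"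
  by (simp add: deg_less_def of_int_eq_single)

lemma deg_less_X [simp]: "i \<noteq> j \<Longrightarrow> deg_less i (Suc m) (X j)"
  by (simp add: deg_less_def X_def lookup_single)

lemma deg_less_X1: "i \<noteq> j \<Longrightarrow> deg_less i 1 (X j)"
  by simp

lemma deg_less_X_power: "deg_less i (Suc m) (X i ^ m)"
  by (simp add: deg_less_def X_power)

lemma deg_less_power1: "deg_less i 1 p \<Longrightarrow> deg_less i 1 (p ^ k)"
  by (induction k) (simp_all add: deg_less_mult1 del: One_nat_def, simp)

lemma deg_less_prod1: "(\<And>x. x \<in> A \<Longrightarrow> deg_less i 1 (P x)) \<Longrightarrow> deg_less i 1 (\<Prod>x\<in>A. P x)"
  by (induction A rule: infinite_finite_induct) (auto simp: deg_less_mult1)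

lemma deg_less_h1:
  assumes "finite T" "i \<notin> T" shows "deg_less i 1 (h m T)"
  unfolding deg_less_def
proof
  fix e assume "e \<in> ks (h m T)"
  then have "ks e \<subseteq> T"
    unfolding in_keys_iff lookup_h[OF assms(1)] by (simp split: if_splits)
  then have "i \<notin> ks e" using assms(2) by blast
  then show "lk e i < 1" by (simp add: in_keys_iff)
qed

lemma deg_less_vdm1: "i \<notin> S \<Longrightarrow> deg_less i 1 (vdm X S)"
  unfolding vdm_def One_nat_def
  by (intro deg_less_prod1[unfolded One_nat_def] deg_less_diff deg_less_X) auto

lemma prod_linear_expand:
  assumes "finite T" "i \<notin> T"
  shows "\<exists>r. (\<Prod>a\<in>T. X i - X a) = X i ^ card T + r \<and> deg_less i (card T) r"
  using assms
proof (induction T rule: finite_induct)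
  case empty
  show ?case by (intro exI[of _ 0]) simp
next
  case (insert b T)
  then obtain r where r: "(\<Prod>a\<in>T. X i - X a) = X i ^ card T + r" "deg_less i (card T) r" by auto
  have b: "deg_less i 1 (X b)" using insert.prems by simp
  have "deg_less i (Suc 1) (X i)" using deg_less_X_power[of i 1] by simp
  then have "deg_less i (card T + 1) (r * X i)" by (intro deg_less_mult r(2)) auto
  moreover have "deg_less i (card T + 1) (X b * X i ^ card T)"
    using deg_less_mult1[OF b deg_less_X_power[of i "card T"]] by simp
  moreover have "deg_less i (card T + 1) (X b * r)"
    using deg_less_mult1[OF b r(2)] by (rule deg_less_mono) simp
  ultimately have "deg_less i (card T + 1) (r * X i - X b * X i ^ card T - X b * r)"
    by (intro deg_less_diff)
  moreover have "(\<Prod>a\<in>insert b T. X i - X a) =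
      X i ^ card (insert b T) + (r * X i - X b * X i ^ card T - X b * r)"
    using insert.hyps by (simp add: r algebra_simps)
  ultimately show ?case using insert.hyps by auto
qed

section \<open>A monomial ideal and its colon by the Vandermonde product\<close>

text \<open>The ideal generated by the powers \<open>X k ^ L k\<close> with \<open>k\<close> in
  \<open>S\<close>, described by supports so that membership is decided one monomial at a
  time.\<close>

definition J :: "nat set \<Rightarrow> (nat \<Rightarrow> nat) \<Rightarrow> int_mpoly set" where
  "J S L = {p. \<forall>e\<in>ks p. \<exists>k\<in>S. L k \<le> lk e k}"

definition K :: "nat set \<Rightarrow> (nat \<Rightarrow> nat) \<Rightarrow> int_mpoly set" where
  "K S L = {p. p * vdm X S \<in> J S L}"

lemma ideal_J: "is_ideal (J S L)"
  unfolding is_ideal_def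
proof (intro conjI ballI allI)
  fix p q assume "p \<in> J S L" "q \<in> J S L"
  then show "p + q \<in> J S L" unfolding J_def using keys_add[of p q] by blast
next
  fix p r assume p: "p \<in> J S L"
  show "r * p \<in> J S L" unfolding J_def
  proof (simp, rule ballI)
    fix e assume "e \<in> ks (r * p)"
    then obtain a b where "e = a + b" "b \<in> ks p" using keys_mult[of r p] by blast
    then show "\<exists>k\<in>S. L k \<le> lk e k" using p unfolding J_def by (force simp: lookup_add)
  qed
qed (simp add: J_def)

lemma J_mono: "S \<subseteq> S' \<Longrightarrow> (\<And>k. k \<in> S \<Longrightarrow> L' k \<le> L k) \<Longrightarrow> J S L \<subseteq> J S' L'"
  unfolding J_def by (clarsimp, meson in_mono le_trans)

lemma ideal_K: "is_ideal (K S L)"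
  unfolding is_ideal_def K_def using ideal_J[of S L]
  by (auto simp: distrib_right mult.assoc intro: ideal_0 ideal_add ideal_mult)

text \<open>Enlarging \<open>S\<close> multiplies the Vandermonde product by a further factor, and
  lowering exponents enlarges the monomial ideal.\<close>

lemma K_mono:
  assumes "finite S'" "S \<subseteq> S'" "\<And>k. k \<in> S \<Longrightarrow> L' k \<le> L k"
  shows "K S L \<subseteq> K S' L'"
proof
  fix p assume "p \<in> K S L"
  then have "p * vdm X S \<in> J S' L'" using J_mono[of S S' L' L] assms unfolding K_def by auto
  moreover obtain r where "vdm X S' = vdm X S * r" using vdm_dvd[OF assms(1,2)] by (meson dvdE)
  ultimately show "p \<in> K S' L'"
    using ideal_mult'[OF ideal_J, of "p * vdm X S" S' L' r] by (simp add: K_def mult_ac)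
qed

lemma lookup_of_int_mult: "lk (of_int c * p) e = c * lk p e" for p :: int_mpoly
proof -
  have nat: "lk (of_nat n * p) e = int n * lk p e" for n
    by (induction n) (simp_all add: lookup_add algebra_simps)
  show ?thesis by (cases c rule: int_cases2) (simp_all add: nat)
qed

text \<open>A nonzero integer factor does not change the support. So the quotient by
  \<open>K S L\<close> is torsion-free, and rational arguments can be carried out over the
  integers.\<close>

lemma K_cancel_int: "of_int c * p \<in> K S L \<Longrightarrow> c \<noteq> 0 \<Longrightarrow> p \<in> K S L"
  by (auto simp: K_def J_def mult.assoc in_keys_iff lookup_of_int_mult)

text \<open>Splitting off the factor \<open>X i - X j\<close> from the product trades \<open>h m T\<close> for \<open>h (m + 1)\<close> of the two
  sets with one variable less.\<close>

lemma h_mult_vdm_in_J: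
  assumes "finite T" "T \<noteq> {}"
  shows "h m T * vdm X T \<in> J T (\<lambda>_. m + card T - 1)"
  using assms
proof (induction "card T" arbitrary: T m rule: less_induct)
  case less
  let ?J = "J T (\<lambda>_. m + card T - 1)"
  obtain i where i: "i \<in> T" using less.prems by auto
  show ?case
  proof (cases "T = {i}")
    case True
    then show ?thesis by (simp add: h_singleton J_def X_power)
  next
    case False
    then obtain j where j: "j \<in> T" "j \<noteq> i" using i by auto
    let ?V = "vdm X :: nat set \<Rightarrow> int_mpoly"
    define A where "A = (\<Prod>a\<in>T - {i} - {j}. X i - X a)"
    define B where "B = (\<Prod>a\<in>T - {i} - {j}. X j - X a)"
    obtain n1 where "?V T = (- 1) ^ n1 * ?V (T - {i}) * (\<Prod>a\<in>T - {i}. X i - X a)"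
      using vdm_remove[OF less.prems(1) i] .
    moreover have "(\<Prod>a\<in>T - {i}. X i - X a) = (X i - X j) * A"
      unfolding A_def using less.prems(1) j by (subst prod.remove[of _ j]) auto
    ultimately have V: "?V T = (- 1) ^ n1 * ?V (T - {i}) * ((X i - X j) * A)" by simp
    obtain n2 where Vi: "?V (T - {i}) = (- 1) ^ n2 * ?V (T - {i} - {j}) * B"
      using vdm_remove[of "T - {i}" j X] less.prems(1) j unfolding B_def by auto
    obtain n3 where "?V (T - {j}) = (- 1) ^ n3 * ?V (T - {j} - {i}) * (\<Prod>a\<in>T - {j} - {i}. X i - X a)"
      using vdm_remove[of "T - {j}" i X] less.prems(1) i j by auto
    moreover have eq: "T - {j} - {i} = T - {i} - {j}" by auto
    ultimately have Vj: "?V (T - {j}) = (- 1) ^ n3 * ?V (T - {i} - {j}) * A"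
      by (simp add: A_def)
    have "(- 1) ^ n3 * (- 1) ^ n3 = (1 :: int_mpoly)"
      by (simp add: power_mult_distrib[symmetric])
    then have Vj': "?V (T - {i} - {j}) * A = (- 1) ^ n3 * ?V (T - {j})"
      unfolding Vj by (simp add: mult.assoc[symmetric])
    have in_J: "h (Suc m) (T - {k}) * ?V (T - {k}) \<in> ?J" if "k \<in> T" "T - {k} \<noteq> {}" for k
    proof -
      \<comment> \<open>The degree rises by one while the set loses one element, so the exponent
        \<open>m + card T - 1\<close> stays the same.\<close>
      have c: "card T = Suc (card (T - {k}))" using card.remove[OF less.prems(1) that(1)] .
      then have "h (Suc m) (T - {k}) * ?V (T - {k}) \<in> J (T - {k}) (\<lambda>_. Suc m + card (T - {k}) - 1)"
        using less.hyps[of "T - {k}" "Suc m"] less.prems that by auto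
      then show ?thesis using J_mono[of "T - {k}" T] c by auto
    qed
    have "h m T * ?V T = (- 1) ^ n1 * ?V (T - {i}) * A * ((X i - X j) * h m T)"
      by (simp add: V algebra_simps)
    also have "\<dots> = (- 1) ^ n1 * ?V (T - {i}) * A * (h (Suc m) (T - {j}) - h (Suc m) (T - {i}))"
      by (simp only: h_exchange[OF less.prems(1) i j(1) j(2)[symmetric]])
    also have "\<dots> = (- 1) ^ n1 * (- 1) ^ n2 * B * (?V (T - {i} - {j}) * A) * h (Suc m) (T - {j})
        - (- 1) ^ n1 * A * (h (Suc m) (T - {i}) * ?V (T - {i}))"
      by (simp add: Vi algebra_simps)
    also have "\<dots> = (- 1) ^ n1 * (- 1) ^ n2 * B * (- 1) ^ n3 * (h (Suc m) (T - {j}) * ?V (T - {j}))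
        - (- 1) ^ n1 * A * (h (Suc m) (T - {i}) * ?V (T - {i}))"
      unfolding Vj' by (simp add: mult_ac)
    finally have eq: "h m T * ?V T =
        (- 1) ^ n1 * (- 1) ^ n2 * B * (- 1) ^ n3 * (h (Suc m) (T - {j}) * ?V (T - {j}))
        - (- 1) ^ n1 * A * (h (Suc m) (T - {i}) * ?V (T - {i}))" .
    have in_ij: "h (Suc m) (T - {j}) * ?V (T - {j}) \<in> ?J" "h (Suc m) (T - {i}) * ?V (T - {i}) \<in> ?J"
      using in_J[of i] in_J[of j] i j by auto
    show ?thesis unfolding eq
      by (rule ideal_diff[OF ideal_J ideal_mult[OF ideal_J in_ij(1)] ideal_mult[OF ideal_J in_ij(2)]])
  qed
qed

text \<open>With \<open>T = {1..i}\<close> and \<open>m = L i - i + 1\<close> the condition reads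
  \<open>L k \<le> L i\<close>, which monotonicity provides; hence the generators lie in
  \<open>K\<close>.\<close>

lemma h_in_K:
  assumes "finite S" "T \<subseteq> S" "T \<noteq> {}" "\<And>k. k \<in> T \<Longrightarrow> L k < m + card T"
  shows "h m T \<in> K S L"
proof -
  have fin: "finite T" using assms finite_subset by blast
  have "h m T \<in> K T (\<lambda>_. m + card T - 1)"
    using h_mult_vdm_in_J[OF fin assms(3)] by (simp add: K_def)
  also have "\<dots> \<subseteq> K S L"
    by (rule K_mono[OF assms(1,2)]) (use assms(4) in fastforce)
  finally show ?thesis .
qed

text \<open>Up to sign \<open>vdm X S\<close> is \<open>vdm X (S - {i})\<close> times a monic
  polynomial of degree \<open>card S - 1\<close> in \<open>X i\<close>. In the product with the
  given polynomial the coefficient of \<open>X i ^ (m + card S - 1)\<close> is therefore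
  \<open>p * vdm X (S - {i})\<close> up to sign, and this exponent is too small for the generator
  \<open>X i ^ L i\<close>.\<close>

lemma K_cut:
  assumes S: "finite S" "i \<in> S" and q: "X i ^ m * p + q \<in> K S L"
    and p: "deg_less i 1 p" and q_less: "deg_less i m q" and L: "m + card S \<le> L i"
  shows "p \<in> K (S - {i}) L"
proof -
  let ?T = "S - {i}"
  have c: "card S = Suc (card ?T)" using card.remove[OF S] .
  have finT: "finite ?T" and iT: "i \<notin> ?T" using S by auto
  obtain r where r: "(\<Prod>a\<in>?T. X i - X a) = X i ^ card ?T + r" "deg_less i (card ?T) r"
    using prod_linear_expand[OF finT iT] by auto
  obtain n where V: "vdm X S = (- 1) ^ n * vdm X ?T * (\<Prod>a\<in>?T. X i - X a)"
    using vdm_remove[OF S] .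
  define w where "w = p * vdm X ?T"
  define R where "R = w * (X i ^ m * r) + vdm X ?T * (q * (X i ^ card ?T + r))"
  have w: "deg_less i 1 w" unfolding w_def by (intro deg_less_mult1 p deg_less_vdm1) simp
  have "deg_less i (card ?T + m) (X i ^ m * r)"
    using deg_less_mult[OF r(2) deg_less_X_power[of i m]] by (simp add: mult.commute)
  moreover have "deg_less i (m + card ?T) (q * (X i ^ card ?T + r))"
    by (intro deg_less_mult q_less deg_less_add deg_less_X_power deg_less_mono[OF r(2)]) simp
  ultimately have R: "deg_less i (m + card ?T) R" unfolding R_def
    by (intro deg_less_add deg_less_mult1[OF w] deg_less_mult1[OF deg_less_vdm1])
      (simp_all add: add.commute)
  have eq: "(X i ^ m * p + q) * vdm X S = (- 1) ^ n * (X i ^ (m + card ?T) * w + R)"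
    by (simp add: V r(1) R_def w_def power_add algebra_simps)
  have "(X i ^ m * p + q) * vdm X S \<in> J S L" using q by (simp add: K_def)
  then have "(- 1) ^ n * ((X i ^ m * p + q) * vdm X S) \<in> J S L" by (rule ideal_mult[OF ideal_J])
  moreover have "(- 1) ^ n * (- 1) ^ n = (1 :: int_mpoly)"
    by (simp add: power_mult_distrib[symmetric])
  ultimately have in_J: "X i ^ (m + card ?T) * w + R \<in> J S L"
    unfolding eq by (simp add: mult.assoc[symmetric])
  have "w \<in> J ?T L" unfolding J_def
  proof (simp, rule ballI)
    fix e0 assume e0: "e0 \<in> ks w"
    then have i0: "lk e0 i = 0" using w by (auto simp: deg_less_def)
    \<comment> \<open>A monomial of \<open>w\<close> times the top power of \<open>X i\<close>;
      \<open>R\<close> has smaller degree in \<open>X i\<close> and cannot cancel it.\<close>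
    let ?e = "sgl i (m + card ?T) + e0"
    have "lk (X i ^ (m + card ?T) * w) ?e = lk w e0"
      by (simp add: lookup_single_mult X_power)
    moreover have "?e \<notin> ks R"
      using R i0 unfolding deg_less_def by (force simp: lookup_add)
    then have "lk R ?e = 0" by (simp add: in_keys_iff)
    ultimately have "?e \<in> ks (X i ^ (m + card ?T) * w + R)"
      using e0 by (simp add: in_keys_iff lookup_add)
    then obtain k where k: "k \<in> S" "L k \<le> lk ?e k" using in_J unfolding J_def by auto
    have "k \<noteq> i" using k(2) L c i0 by (auto simp: lookup_add)
    then show "\<exists>k\<in>S - {i}. L k \<le> lk e0 k"
      using k by (intro bexI[of _ k]) (auto simp: lookup_add lookup_single)
  qed
  then show ?thesis by (simp add: K_def w_def)
qed

lemma K_cut0: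
  assumes "finite S" "i \<in> S" "p \<in> K S L" "deg_less i 1 p" "card S \<le> L i"
  shows "p \<in> K (S - {i}) L"
  using K_cut[of S i 0 p 0 L] assms by simp

section \<open>Powers of linear forms in the coinvariant case\<close>

definition linform :: "(nat \<Rightarrow> int) \<Rightarrow> nat set \<Rightarrow> int_mpoly" where
  "linform c S = (\<Sum>j\<in>S. of_int (c j) * X j)"

lemma deg_less_vdm:
  assumes "finite S" "j \<in> S" shows "deg_less j (card S) (vdm X S)"
proof -
  obtain n where n: "vdm X S = (- 1) ^ n * vdm X (S - {j}) * (\<Prod>a\<in>S - {j}. X j - X a)"
    using vdm_remove[OF assms] .
  obtain r where r: "(\<Prod>a\<in>S - {j}. X j - X a) = X j ^ card (S - {j}) + r" "deg_less j (card (S - {j})) r"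
    using prod_linear_expand[of "S - {j}" j] assms by auto
  have a: "deg_less j (Suc (card (S - {j}))) (X j ^ card (S - {j}) + r)"
    by (intro deg_less_add deg_less_X_power deg_less_mono[OF r(2)]) simp
  have "deg_less j 1 (- 1)" using deg_less_of_int[of j 0 "- 1"] by simp
  then have "deg_less j 1 ((- 1) ^ n * vdm X (S - {j}))"
    by (intro deg_less_mult1[OF deg_less_power1] deg_less_vdm1) auto
  then have "deg_less j (Suc (card (S - {j}))) (vdm X S)"
    unfolding n r(1) using a by (rule deg_less_mult1)
  then show ?thesis using card.remove[OF assms] by simp
qed

section \<open>The Vandermonde product as an alternating polynomial\<close>

definition swap :: "nat \<Rightarrow> nat \<Rightarrow> nat \<Rightarrow> nat" where
  "swap a b j = (if j = a then b else if j = b then a else j)"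

text \<open>Only the factor \<open>X a - X b\<close> changes sign. The factors joining a third index
  to \<open>a\<close> and to \<open>b\<close> trade places, and the remaining ones are
  untouched.\<close>

lemma subst_swap_vdm:
  assumes "finite S" "a \<in> S" "b \<in> S" "a \<noteq> b"
  shows "subst (\<lambda>j. X (swap a b j)) (vdm X S) = - vdm X S"
proof -
  let ?S = "S - {a} - {b}"
  obtain n1 where V1: "vdm X S = (- 1) ^ n1 * vdm X (S - {a}) * (\<Prod>c\<in>S - {a}. X a - X c)"
    using vdm_remove[OF assms(1,2)] .
  obtain n2 where V2: "vdm X (S - {a}) = (- 1) ^ n2 * vdm X ?S * (\<Prod>c\<in>?S. X b - X c)"
    using vdm_remove[of "S - {a}" b X] assms by auto
  have "(\<Prod>c\<in>S - {a}. X a - X c) = (X a - X b) * (\<Prod>c\<in>?S. X a - X c)"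
    using assms by (subst prod.remove[of _ b]) auto
  then have V: "vdm X S = (- 1) ^ n1 * (- 1) ^ n2 * vdm X ?S * (X a - X b) *
      ((\<Prod>c\<in>?S. X b - X c) * (\<Prod>c\<in>?S. X a - X c))"
    by (simp add: V1 V2 mult_ac)
  have "vdm (\<lambda>j. X (swap a b j)) ?S = vdm X ?S"
    unfolding vdm_def by (intro prod.cong refl) (simp add: swap_def)
  then have "subst (\<lambda>j. X (swap a b j)) (vdm X ?S) = vdm X ?S" by (simp add: subst_vdm)
  moreover have "(\<Prod>c\<in>?S. X (swap a b x) - X (swap a b c)) = (\<Prod>c\<in>?S. X (swap a b x) - X c)" for x
    by (intro prod.cong refl) (auto simp: swap_def)
  ultimately show ?thesis
    by (simp add: V subst_prod) (simp add: swap_def algebra_simps)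
qed

lemma mon_X_comp: "mon (\<lambda>j. X (f j)) e = sgl (\<Sum>j\<in>ks e. sgl (f j) (lk e j)) 1"
proof -
  have "(\<Prod>j\<in>A. sgl (E j) 1 :: int_mpoly) = sgl (\<Sum>j\<in>A. E j) 1"
    for E :: "nat \<Rightarrow> monomial" and A
    by (induction A rule: infinite_finite_induct) (simp_all add: mult_single)
  then show ?thesis by (simp add: mon_def X_power)
qed

text \<open>The substitution permutes the monomials, and a monomial with equal exponents at
  \<open>a\<close> and \<open>b\<close> is fixed.\<close>

lemma lookup_subst_swap:
  assumes "lk e a = lk e b" shows "lk (subst (\<lambda>j. X (swap a b j)) p) e = lk p e"
proof -
  have swap_iff: "swap a b j = i \<longleftrightarrow> j = swap a b i" for i j by (auto simp: swap_def)
  let ?\<sigma> = "\<lambda>e' :: monomial. \<Sum>j\<in>ks e'. sgl (swap a b j) (lk e' j)"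
  have \<sigma>: "lk (?\<sigma> e') i = lk e' (swap a b i)" for e' i
    by (simp add: lookup_sum lookup_single when_def swap_iff sum.delta in_keys_iff)
  have e: "lk e (swap a b i) = lk e i" for i using assms by (simp add: swap_def)
  have \<sigma>_iff: "e = ?\<sigma> e' \<longleftrightarrow> e = e'" for e'
  proof
    assume "e = ?\<sigma> e'"
    then have "lk e' (swap a b (swap a b i)) = lk e i" for i using \<sigma>[of e' "swap a b i"] e[of i] by metis
    moreover have "swap a b (swap a b i) = i" for i using swap_iff by blast
    ultimately show "e = e'" by (intro poly_mapping_eqI) simp
  next
    assume "e = e'"
    then show "e = ?\<sigma> e'" by (intro poly_mapping_eqI) (metis \<sigma> e)
  qed
  have "subst (\<lambda>j. X (swap a b j)) p = (\<Sum>e'\<in>ks p. of_int (lk p e') * sgl (?\<sigma> e') 1)"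
    by (simp add: subst_def lin_ext_def mon_X_comp)
  then have "lk (subst (\<lambda>j. X (swap a b j)) p) e = (\<Sum>e'\<in>ks p. lk p e' * (if e = ?\<sigma> e' then 1 else 0))"
    by (simp add: lookup_sum lookup_of_int_mult lookup_single when_def eq_commute)
  also have "\<dots> = (\<Sum>e'\<in>ks p. if e = e' then lk p e' else 0)"
    unfolding \<sigma>_iff by (rule sum.cong) simp_all
  also have "\<dots> = lk p e" by (simp add: sum.delta in_keys_iff)
  finally show ?thesis .
qed

text \<open>If two exponents agreed, exchanging the two variables would preserve the coefficient,
  but it also negates the polynomial; so the coefficient would be zero.\<close>

lemma keys_vdm_inj:
  assumes "finite S" "e \<in> ks (vdm X S)" shows "inj_on (lk e) S"
proof (rule inj_onI, rule ccontr)
  fix a b assume ab: "a \<in> S" "b \<in> S" "lk e a = lk e b" "a \<noteq> b"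
  have "lk (- vdm X S) e = lk (vdm X S) e"
    using lookup_subst_swap[OF ab(3), of "vdm X S"]
    unfolding subst_swap_vdm[OF assms(1) ab(1,2,4)] .
  then show False using assms(2) unfolding in_keys_iff by simp
qed

text \<open>Distinct exponents below \<open>card S\<close> take every value once. This knowledge of
  the exponents stands in for the expansion of the determinant.\<close>

lemma keys_vdm_image:
  assumes "finite S" "e \<in> ks (vdm X S)" shows "lk e ` S = {..<card S}"
proof (rule card_seteq)
  show "lk e ` S \<subseteq> {..<card S}"
  proof
    fix k assume "k \<in> lk e ` S"
    then obtain j where "j \<in> S" "k = lk e j" by blast
    then show "k \<in> {..<card S}"
      using deg_less_vdm[OF assms(1), of j] assms(2) unfolding deg_less_def by simp
  qed
  show "card {..<card S} \<le> card (lk e ` S)"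
    unfolding card_image[OF keys_vdm_inj[OF assms]] by simp
qed simp

text \<open>The contraction \<open>Psi\<close> lets a monomial act on \<open>\<Prod>\<^sub>j Y\<^sub>j\<^bsup>N-1\<^esup>/(N-1)!\<close> by differentiation.
  Along the line \<open>Y\<^sub>j = y\<^sub>j + c\<^sub>j t\<close> the derivative in \<open>t\<close> is the action of the linear form with
  coefficients \<open>c\<close>.\<close>

definition divpow :: "nat \<Rightarrow> nat \<Rightarrow> real poly \<Rightarrow> real poly" where
  "divpow N k Y = (if k < N then smult (1 / fact (N - 1 - k)) (Y ^ (N - 1 - k)) else 0)"

definition Psi :: "nat \<Rightarrow> nat set \<Rightarrow> (nat \<Rightarrow> real poly) \<Rightarrow> int_mpoly \<Rightarrow> real poly" where
  "Psi N S Y = lin_ext (\<lambda>e. \<Prod>j\<in>S. divpow N (lk e j) (Y j))"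

text \<open>Dividing by the factorial makes differentiation a shift of \<open>k\<close> with no
  numerical factor beyond \<open>c\<close>. At \<open>Suc k = N\<close> a constant is differentiated
  and both sides are \<open>0\<close>.\<close>

lemma pderiv_divpow: "pderiv (divpow N k [:y, c:]) = smult c (divpow N (Suc k) [:y, c:])"
proof (cases "Suc k < N")
  case True
  then obtain n where n: "N = Suc (Suc (k + n))" by (auto simp: less_iff_Suc_add)
  have d: "divpow N k [:y, c:] = smult (1 / fact (Suc n)) ([:y, c:] ^ Suc n)"
    "divpow N (Suc k) [:y, c:] = smult (1 / fact n) ([:y, c:] ^ n)"
    by (simp_all add: divpow_def n del: power_Suc fact_Suc)
  have "pderiv [:y, c:] = [:c:]" by (simp add: pderiv_pCons)
  then have p: "pderiv ([:y, c:] ^ Suc n) = smult (real (Suc n)) ([:y, c:] ^ n) * [:c:]"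
    by (simp only: pderiv_power_Suc)
  have r: "1 / fact (Suc n) * real (Suc n) = 1 / fact n" by (simp add: divide_simps)
  have "smult (1 / fact (Suc n)) (smult (real (Suc n)) ([:y, c:] ^ n) * [:c:]) =
      smult ((1 / fact (Suc n) * real (Suc n)) * c) ([:y, c:] ^ n)"
    by (simp add: mult_ac del: fact_Suc of_nat_Suc)
  then show ?thesis unfolding d pderiv_smult p r by (simp add: mult.commute)
next
  case False
  then consider "N = Suc k" | "N \<le> k" by linarith
  then show ?thesis by cases (simp_all add: divpow_def)
qed

lemma pderiv_sum: "pderiv (\<Sum>i\<in>A. f i) = (\<Sum>i\<in>A. pderiv (f i))"
  by (induction A rule: infinite_finite_induct) (simp_all add: pderiv_add)

lemma pderiv_Psi:
  assumes S: "finite S"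
  shows "pderiv (Psi N S (\<lambda>j. [:y j, of_int (c j):]) p) =
    Psi N S (\<lambda>j. [:y j, of_int (c j):]) (linform c S * p)"
proof -
  let ?Y = "\<lambda>j. [:y j, of_int (c j) :: real:]"
  let ?g = "\<lambda>e. \<Prod>j\<in>S. divpow N (lk e j) (?Y j)"
  have mono: "pderiv (?g e) = (\<Sum>j\<in>S. of_int (c j) * ?g (sgl j 1 + e))" for e
  proof -
    have "pderiv (?g e) = (\<Sum>j\<in>S. (\<Prod>i\<in>S - {j}. divpow N (lk e i) (?Y i)) * pderiv (divpow N (lk e j) (?Y j)))"
      by (rule pderiv_prod)
    also have "\<dots> = (\<Sum>j\<in>S. of_int (c j) * ?g (sgl j 1 + e))"
    proof (rule sum.cong)
      fix j assume j: "j \<in> S"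
      have "?g (sgl j 1 + e) = divpow N (Suc (lk e j)) (?Y j) * (\<Prod>i\<in>S - {j}. divpow N (lk e i) (?Y i))"
        using j S by (subst prod.remove[of _ j]) (simp_all add: lookup_add lookup_single when_def)
      then show "(\<Prod>i\<in>S - {j}. divpow N (lk e i) (?Y i)) * pderiv (divpow N (lk e j) (?Y j)) =
          of_int (c j) * ?g (sgl j 1 + e)"
        by (simp add: pderiv_divpow of_int_poly mult_ac)
    qed simp
    finally show ?thesis .
  qed
  have "linform c S * p = (\<Sum>j\<in>S. \<Sum>e\<in>ks p. (of_int (c j) * X j) * sgl e (lk p e))"
    by (subst (1) sum_singles[of p, symmetric]) (simp only: linform_def sum_product)
  also have "\<dots> = (\<Sum>e\<in>ks p. \<Sum>j\<in>S. (of_int (c j) * X j) * sgl e (lk p e))"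
    by (rule sum.swap)
  also have "\<dots> = (\<Sum>e\<in>ks p. \<Sum>j\<in>S. sgl (sgl j 1 + e) (c j * lk p e))"
    by (simp add: X_def of_int_eq_single mult_single)
  finally have "linform c S * p = (\<Sum>e\<in>ks p. \<Sum>j\<in>S. sgl (sgl j 1 + e) (c j * lk p e))" .
  then have "Psi N S ?Y (linform c S * p) =
      (\<Sum>e\<in>ks p. of_int (lk p e) * (\<Sum>j\<in>S. of_int (c j) * ?g (sgl j 1 + e)))"
    by (simp add: Psi_def lin_ext_sum sum_distrib_left mult_ac)
  also have "\<dots> = (\<Sum>e\<in>ks p. of_int (lk p e) * pderiv (?g e))" by (simp only: mono)
  also have "\<dots> = pderiv (Psi N S ?Y p)"
    by (simp add: Psi_def lin_ext_def pderiv_sum of_int_poly pderiv_smult)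
  finally show ?thesis by simp
qed

text \<open>Differentiating \<open>N\<close> times kills a power with exponent \<open>N - 1\<close>;
  this is the default value \<open>0\<close> in \<open>divpow\<close>.\<close>

lemma Psi_J:
  assumes "finite S" "p \<in> J S (\<lambda>_. N)" shows "Psi N S Y p = 0"
  unfolding Psi_def lin_ext_def
proof (rule sum.neutral, rule ballI)
  fix e assume "e \<in> ks p"
  then obtain k where "k \<in> S" "N \<le> lk e k" using assms(2) unfolding J_def by auto
  then have "(\<Prod>j\<in>S. divpow N (lk e j) (Y j)) = 0"
    using assms(1) by (intro prod_zero bexI[of _ k]) (simp_all add: divpow_def)
  then show "of_int (lk p e) * (\<Prod>j\<in>S. divpow N (lk e j) (Y j)) = 0" by simp
qed

text \<open>Each difference of inverses becomes a difference of negatives after multiplication by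
  \<open>z a * z b\<close>, and each index lies in \<open>card S - 1\<close> pairs.\<close>

lemma vdm_inverse:
  fixes z :: "nat \<Rightarrow> 'a::field"
  assumes "finite S" "\<And>j. j \<in> S \<Longrightarrow> z j \<noteq> 0"
  shows "vdm (\<lambda>j. inverse (z j)) S * (\<Prod>j\<in>S. z j ^ (card S - 1)) = vdm (\<lambda>j. - z j) S"
  using assms
proof (induction S rule: finite_induct)
  case empty
  show ?case by (simp add: vdm_def)
next
  case (insert i T)
  have IH: "vdm (\<lambda>j. inverse (z j)) T * (\<Prod>j\<in>T. z j ^ (card T - 1)) = vdm (\<lambda>j. - z j) T"
    using insert by simp
  have m1: "(\<Prod>j\<in>insert i T. z j ^ (card (insert i T) - 1)) = (\<Prod>j\<in>T. z j ^ (card T - 1)) * (\<Prod>j\<in>T. z j * z i)"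
  proof (cases "T = {}")
    case False
    then have "card T = Suc (card T - 1)" using insert.hyps(1) by (simp add: card_gt_0_iff)
    then have "z j ^ card T = z j ^ (card T - 1) * z j" for j by (metis power_Suc2)
    then show ?thesis using insert.hyps by (simp add: prod.distrib)
  qed simp
  have m2: "(\<Prod>j\<in>T. inverse (z i) - inverse (z j)) * (\<Prod>j\<in>T. z j * z i) = (\<Prod>j\<in>T. - z i - - z j)"
    unfolding prod.distrib[symmetric]
    by (rule prod.cong) (use insert.prems in \<open>auto simp: field_simps\<close>)
  show ?case
    unfolding vdm_insert[OF insert.hyps] IH[symmetric] m1 m2[symmetric] by (simp only: mult_ac)
qed

text \<open>The exponents in a monomial of \<open>vdm X S\<close> are
  \<open>0, ..., card S - 1\<close> in some order, so all monomials get the same factorial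
  denominator. What is left is the product of the powers \<open>Y j ^ (card S - 1)\<close> times the
  Vandermonde product of the inverses, to which \<open>vdm_inverse\<close> applies. Inverses of
  polynomials are avoided by evaluating where no \<open>Y j\<close> vanishes, that is, outside a
  finite set.\<close>

lemma Psi_vdm:
  assumes S: "finite S" and Y: "\<And>j. j \<in> S \<Longrightarrow> Y j \<noteq> 0"
  shows "Psi (card S) S Y (vdm X S) =
    smult (1 / (\<Prod>k<card S. fact (card S - 1 - k))) (vdm (\<lambda>j. - Y j) S)"
proof (rule ccontr)
  let ?N = "card S" and ?C = "\<Prod>k<card S. fact (card S - 1 - k) :: real"
  let ?p = "Psi ?N S Y (vdm X S)" and ?q = "smult (1 / ?C) (vdm (\<lambda>j. - Y j) S)"
  have eq: "poly ?p t = poly ?q t" if t: "\<And>j. j \<in> S \<Longrightarrow> poly (Y j) t \<noteq> 0" for t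
  proof -
    define z where "z j = poly (Y j) t" for j
    have z: "z j \<noteq> 0" if "j \<in> S" for j using t that by (simp add: z_def)
    have mono: "poly (\<Prod>j\<in>S. divpow ?N (lk e j) (Y j)) t =
        1 / ?C * ((\<Prod>j\<in>S. z j ^ (?N - 1)) * mon (\<lambda>j. inverse (z j)) e)"
      if e: "e \<in> ks (vdm X S)" for e
    proof -
      have "ks e \<subseteq> S"
      proof
        fix i assume "i \<in> ks e"
        then have "\<not> lk e i < 1" by (simp add: in_keys_iff)
        then show "i \<in> S" using deg_less_vdm1[of i S] e unfolding deg_less_def by blast
      qed
      then have mon: "mon (\<lambda>j. inverse (z j)) e = (\<Prod>j\<in>S. inverse (z j) ^ lk e j)"
        by (rule mon_superset[OF S])
      have "?C = (\<Prod>k\<in>lk e ` S. fact (?N - 1 - k))" by (simp add: keys_vdm_image[OF S e])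
      also have "\<dots> = (\<Prod>j\<in>S. fact (?N - 1 - lk e j))"
        using keys_vdm_inj[OF S e] by (simp add: prod.reindex)
      finally have C: "1 / ?C = (\<Prod>j\<in>S. 1 / fact (?N - 1 - lk e j))" by (simp add: prod_dividef)
      have "poly (\<Prod>j\<in>S. divpow ?N (lk e j) (Y j)) t =
          (\<Prod>j\<in>S. 1 / fact (?N - 1 - lk e j) * (z j ^ (?N - 1) * inverse (z j) ^ lk e j))"
        unfolding poly_prod
      proof (rule prod.cong)
        fix j assume j: "j \<in> S"
        have less: "lk e j < ?N" using keys_vdm_image[OF S e] j by blast
        have "z j ^ (?N - 1) = z j ^ (?N - 1 - lk e j) * z j ^ lk e j"
          using less by (simp add: power_add[symmetric])
        then have "z j ^ (?N - 1) * inverse (z j) ^ lk e j = z j ^ (?N - 1 - lk e j)"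
          using z[OF j] by (simp add: power_inverse)
        then show "poly (divpow ?N (lk e j) (Y j)) t =
            1 / fact (?N - 1 - lk e j) * (z j ^ (?N - 1) * inverse (z j) ^ lk e j)"
          using less by (simp add: divpow_def z_def)
      qed simp
      then show ?thesis by (simp only: prod.distrib mon C)
    qed
    have "poly ?p t = (\<Sum>e\<in>ks (vdm X S). of_int (lk (vdm X S) e) *
        poly (\<Prod>j\<in>S. divpow ?N (lk e j) (Y j)) t)"
      by (simp add: Psi_def lin_ext_def poly_sum)
    also have "\<dots> = 1 / ?C * ((\<Prod>j\<in>S. z j ^ (?N - 1)) * subst (\<lambda>j. inverse (z j)) (vdm X S))"
      unfolding subst_def lin_ext_def sum_distrib_left
      by (rule sum.cong) (simp_all only: mono mult_ac)
    also have "\<dots> = 1 / ?C * vdm (\<lambda>j. - z j) S"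
      using vdm_inverse[OF S, of z] z by (simp add: subst_vdm mult_ac)
    also have "\<dots> = poly ?q t"
      by (simp add: vdm_def poly_prod z_def)
    finally show ?thesis .
  qed
  assume "?p \<noteq> ?q"
  then have "finite {t. poly (?p - ?q) t = 0}" by (intro poly_roots_finite) simp
  moreover have "finite (\<Union>j\<in>S. {t. poly (Y j) t = 0})"
    using S Y by (intro finite_UN_I poly_roots_finite) auto
  moreover have "UNIV = {t. poly (?p - ?q) t = 0} \<union> (\<Union>j\<in>S. {t. poly (Y j) t = 0})"
    using eq by auto
  ultimately have "finite (UNIV :: real set)" by (metis finite_Un)
  then show False by (simp add: infinite_UNIV_char_0)
qed

lemma degree_less_if_pderiv_funpow_eq_0:
  fixes p :: "real poly"
  shows "p \<noteq> 0 \<Longrightarrow> (pderiv ^^ M) p = 0 \<Longrightarrow> degree p < M"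
proof (induction M arbitrary: p)
  case (Suc M)
  show ?case
  proof (cases "pderiv p = 0")
    case True
    then show ?thesis by (simp add: pderiv_eq_0_iff)
  next
    case False
    moreover have "(pderiv ^^ M) (pderiv p) = 0" using Suc.prems(2) by (simp add: funpow_swap1)
    ultimately show ?thesis using Suc.IH[of "pderiv p"] by (simp add: degree_pderiv)
  qed
qed simp

lemma card_pairs_less:
  assumes S: "finite S" and K: "linform c S ^ M \<in> K S (\<lambda>_. card S)"
  shows "card {(a, b) \<in> S \<times> S. c a \<noteq> c b} < 2 * M"
proof -
  \<comment> \<open>Any pairwise distinct nonzero base points would do: distinct ones keep the
    factors with \<open>c a = c b\<close> nonzero, nonzero ones satisfy the assumption of
    \<open>Psi_vdm\<close> even if \<open>c j = 0\<close>.\<close>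
  let ?Y = "\<lambda>j. [:real (Suc j), of_int (c j):]"
  let ?P = "Psi (card S) S ?Y" and ?W = "vdm (\<lambda>j. - ?Y j) S"
  have funpow: "(pderiv ^^ m) (?P (vdm X S)) = ?P (linform c S ^ m * vdm X S)" for m
    by (induction m) (simp_all add: pderiv_Psi[OF S] mult.assoc)
  have C: "1 / (\<Prod>k<card S. fact (card S - 1 - k)) \<noteq> (0 :: real)" by simp
  have Psi: "?P (vdm X S) = smult (1 / (\<Prod>k<card S. fact (card S - 1 - k))) ?W"
    by (rule Psi_vdm[OF S]) simp
  have "?W \<noteq> 0" using S by (auto simp: vdm_def)
  then have nonzero: "?P (vdm X S) \<noteq> 0" unfolding Psi smult_eq_0_iff using C by blast
  have "linform c S ^ M * vdm X S \<in> J S (\<lambda>_. card S)" using K by (simp add: K_def)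
  then have "(pderiv ^^ M) (?P (vdm X S)) = 0" unfolding funpow by (rule Psi_J[OF S])
  with nonzero have "degree (?P (vdm X S)) < M" by (rule degree_less_if_pderiv_funpow_eq_0)
  then have W_less: "degree ?W < M" unfolding Psi degree_smult_eq using C by (simp only: if_False)
  have "degree ?W = (\<Sum>b\<in>S. degree (\<Prod>a\<in>{a \<in> S. a < b}. (- ?Y b - - ?Y a)))"
    unfolding vdm_def using S by (intro degree_prod_sum_eq) auto
  also have "\<dots> = (\<Sum>b\<in>S. \<Sum>a\<in>{a \<in> S. a < b}. if c a \<noteq> c b then 1 else 0)"
    using S by (intro sum.cong refl, subst degree_prod_sum_eq) (auto intro!: sum.cong)
  also have "\<dots> = (\<Sum>b\<in>S. card {a \<in> S. a < b \<and> c a \<noteq> c b})"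
    using S by (intro sum.cong refl) (simp add: sum.If_cases Int_def conj_ac)
  also have "\<dots> = card (SIGMA b:S. {a \<in> S. a < b \<and> c a \<noteq> c b})"
    using S by simp
  finally have W_card: "degree ?W = card (SIGMA b:S. {a \<in> S. a < b \<and> c a \<noteq> c b})" .
  let ?D = "SIGMA b:S. {a \<in> S. a < b \<and> c a \<noteq> c b}"
  \<comment> \<open>The degree counts pairs with \<open>a < b\<close>, the statement counts ordered
    pairs, whence the factor \<open>2\<close>.\<close>
  have "{(a, b) \<in> S \<times> S. c a \<noteq> c b} \<subseteq> ?D \<union> prod.swap ` ?D"
  proof
    fix x assume "x \<in> {(a, b) \<in> S \<times> S. c a \<noteq> c b}"
    then obtain a b where ab: "x = (a, b)" "a \<in> S" "b \<in> S" "c a \<noteq> c b" by auto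
    then consider "a < b" | "b < a" by (metis nat_neq_iff)
    then show "x \<in> ?D \<union> prod.swap ` ?D"
    proof cases
      case 1
      then have "(b, a) \<in> ?D" using ab by auto
      then have "prod.swap (b, a) \<in> prod.swap ` ?D" by (rule imageI)
      then show ?thesis using ab by simp
    next
      case 2
      then show ?thesis using ab by auto
    qed
  qed
  then have "card {(a, b) \<in> S \<times> S. c a \<noteq> c b} \<le> card (?D \<union> prod.swap ` ?D)"
    using S by (intro card_mono) auto
  also have "\<dots> \<le> card ?D + card (prod.swap ` ?D)" by (rule card_Un_le)
  also have "\<dots> \<le> 2 * card ?D" using card_image_le[of ?D prod.swap] S by simp
  finally show ?thesis using W_less W_card by simp
qed

section \<open>Coefficient vectors with few unequal pairs\<close>

lemma card_pairs_eq:
  assumes "finite S"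
  shows "card {(a, b) \<in> S \<times> S. c a \<noteq> c b} = (\<Sum>a\<in>S. card {b\<in>S. c b \<noteq> c a})"
proof -
  have "{(a, b) \<in> S \<times> S. c a \<noteq> c b} = (SIGMA a:S. {b\<in>S. c b \<noteq> c a})" by auto
  then show ?thesis using assms by simp
qed

text \<open>By averaging, some \<open>a\<close> has fewer than two indices with a different
  coefficient; \<open>v\<close> is the coefficient of such an \<open>a\<close>.\<close>

lemma almost_constant_if_few_pairs:
  assumes S: "finite S" "S \<noteq> {}" and less: "card {(a, b) \<in> S \<times> S. c a \<noteq> c b} < 2 * card S"
  obtains v where "v \<in> c ` S" "card {j\<in>S. c j \<noteq> v} \<le> 1"
proof -
  let ?m = "\<lambda>a. card {b\<in>S. c b \<noteq> c a}"
  obtain a where a: "a \<in> S" "\<And>b. b \<in> S \<Longrightarrow> ?m a \<le> ?m b"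
    using ex_is_arg_min_if_finite[OF S, of ?m] unfolding is_arg_min_linorder by blast
  have "card S * ?m a \<le> (\<Sum>a\<in>S. ?m a)" using sum_bounded_below[of S "?m a" ?m] a(2) by simp
  also have "\<dots> < card S * 2" using less unfolding card_pairs_eq[OF S(1), of c] by (simp only: mult.commute)
  finally have "card S * ?m a < card S * 2" .
  then have "?m a < 2" by simp
  then show ?thesis using a(1) by (intro that[of "c a"]) auto
qed

text \<open>A single deviating index already produces \<open>2 * (card S - 1)\<close> ordered
  pairs.\<close>

lemma constant_if_few_pairs:
  assumes S: "finite S" and less: "card {(a, b) \<in> S \<times> S. c a \<noteq> c b} < 2 * (card S - 1)"
    and ij: "i \<in> S" "j \<in> S"
  shows "c i = c j"
proof -
  obtain v where v: "v \<in> c ` S" "card {j\<in>S. c j \<noteq> v} \<le> 1"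
    by (rule almost_constant_if_few_pairs[OF S, of c]) (use less ij in auto)
  have "{j\<in>S. c j \<noteq> v} = {}"
  proof (rule ccontr)
    assume "{j\<in>S. c j \<noteq> v} \<noteq> {}"
    then obtain k where k: "k \<in> S" "c k \<noteq> v" by auto
    then have "card {j\<in>S. c j \<noteq> v} \<noteq> 0" using S by auto
    then have "card {j\<in>S. c j \<noteq> v} = 1" using v(2) by linarith
    then obtain x where x: "{j\<in>S. c j \<noteq> v} = {x}" by (rule card_1_singletonE)
    have "k \<in> {j\<in>S. c j \<noteq> v}" using k by simp
    then have "k = x" unfolding x by (rule singletonD)
    then have B: "{j\<in>S. c j \<noteq> v} = {k}" using x by (simp only:)
    have "(S - {k}) \<times> {k} \<union> {k} \<times> (S - {k}) \<subseteq> {(a, b) \<in> S \<times> S. c a \<noteq> c b}"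
    proof -
      have "c j = v" if "j \<in> S - {k}" for j using B that by blast
      then show ?thesis using k by auto
    qed
    then have "card ((S - {k}) \<times> {k} \<union> {k} \<times> (S - {k})) \<le> card {(a, b) \<in> S \<times> S. c a \<noteq> c b}"
      using S by (intro card_mono finite_subset[of "{(a, b) \<in> S \<times> S. c a \<noteq> c b}" "S \<times> S"]) auto
    moreover have "card ((S - {k}) \<times> {k} \<union> {k} \<times> (S - {k})) = 2 * (card S - 1)"
      using S k by (subst card_Un_disjoint) (auto simp: card_cartesian_product)
    ultimately show False using less by simp
  qed
  then show ?thesis using ij by auto
qed

section \<open>Nilpotent linear forms\<close>

lemma deg_less_linform: "i \<notin> S \<Longrightarrow> deg_less i 1 (linform c S)"
  unfolding linform_def by (intro deg_less_sum deg_less_mult1[OF _ deg_less_X1]) auto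

lemma linform_cong: "(\<And>j. j \<in> S \<Longrightarrow> c j = d j) \<Longrightarrow> linform c S = linform d S"
  by (simp add: linform_def)

lemma linform_superset:
  assumes "finite S" "T \<subseteq> S" "\<And>j. j \<in> S - T \<Longrightarrow> c j = 0"
  shows "linform c S = linform c T"
  unfolding linform_def by (rule sum.mono_neutral_right) (use assms in auto)

lemma linform_remove: "finite S \<Longrightarrow> a \<in> S \<Longrightarrow> linform c S = of_int (c a) * X a + linform c (S - {a})"
  by (simp add: linform_def sum.remove)

lemma linform_const: "linform (\<lambda>_. v) S = of_int v * linform (\<lambda>_. 1) S"
  by (simp add: linform_def sum_distrib_left)

lemma h_1_linform: "finite T \<Longrightarrow> h (Suc 0) T = linform (\<lambda>_. 1) T"
  by (simp add: h_1 linform_def)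

text \<open>The form is padded with zero coefficients to exactly \<open>N\<close> variables, where
  the count of pairs applies. The padding also carries information later on, because its coefficient
  is known to be \<open>0\<close>.\<close>

lemma coinvariant_extend:
  assumes T: "finite T" "card T \<le> N"
  shows "\<exists>S d. finite S \<and> T \<subseteq> S \<and> card S = N \<and> (\<forall>j\<in>T. d j = c j) \<and> (\<forall>j\<in>S - T. d j = 0) \<and>
    (\<forall>M. linform c T ^ M \<in> K T (\<lambda>_. N) \<longrightarrow> card {(a, b) \<in> S \<times> S. d a \<noteq> d b} < 2 * M)"
proof -
  have "infinite (- T)" using T(1) by (simp add: finite_compl)
  then obtain B where B: "finite B" "card B = N - card T" "B \<subseteq> - T"
    using infinite_arbitrarily_large by blast
  define d where "d j = (if j \<in> T then c j else 0)" for j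
  have disj: "T \<inter> B = {}" using B(3) by blast
  then have c: "card (T \<union> B) = N" using T B(1,2) by (simp add: card_Un_disjoint)
  have fin: "finite (T \<union> B)" using T(1) B(1) by simp
  have lf: "linform d (T \<union> B) = linform c T"
    using linform_superset[OF fin, of T d] linform_cong[of T d c] by (auto simp: d_def)
  have "card {(a, b) \<in> (T \<union> B) \<times> (T \<union> B). d a \<noteq> d b} < 2 * M"
    if "linform c T ^ M \<in> K T (\<lambda>_. N)" for M
  proof -
    have "linform d (T \<union> B) ^ M \<in> K (T \<union> B) (\<lambda>_. card (T \<union> B))"
      using K_mono[OF fin, of T "\<lambda>_. N" "\<lambda>_. N"] that by (auto simp: lf c)
    then show ?thesis by (rule card_pairs_less[OF fin])
  qed
  then show ?thesis
    by (intro exI[of _ "T \<union> B"] exI[of _ d]) (auto simp only: fin c d_def if_True if_False)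
qed

text \<open>All but at most one of the \<open>N\<close> padded coefficients equal some
  \<open>v\<close>. If \<open>v = 0\<close>, at most one variable remains. Otherwise the padding is
  the exception, so it has one element and \<open>c\<close> is constant on \<open>T\<close>: the
  form is a multiple of the sum over \<open>T\<close>.\<close>

lemma coinvariant_power:
  assumes T: "finite T" "card T < N" and K: "linform c T ^ N \<in> K T (\<lambda>_. N)"
  shows "(\<exists>j. \<forall>i\<in>T - {j}. c i = 0) \<or> (Suc (card T) = N \<and> (\<exists>v. v \<noteq> 0 \<and> (\<forall>i\<in>T. c i = v)))"
proof -
  obtain S d where S: "finite S" "T \<subseteq> S" "card S = N" and d: "\<And>j. j \<in> T \<Longrightarrow> d j = c j"
    "\<And>j. j \<in> S - T \<Longrightarrow> d j = 0" and less: "card {(a, b) \<in> S \<times> S. d a \<noteq> d b} < 2 * N"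
    using coinvariant_extend[OF T(1) less_imp_le[OF T(2)], of c] K by blast
  have "S \<noteq> {}" using S(3) T(2) by auto
  then obtain v where v: "card {j\<in>S. d j \<noteq> v} \<le> 1"
    using almost_constant_if_few_pairs[OF S(1), of d] less S(3) by blast
  have eq: "x = y" if "x \<in> S" "y \<in> S" "d x \<noteq> v" "d y \<noteq> v" for x y
    using v that S(1) card_le_Suc0_iff_eq[of "{j\<in>S. d j \<noteq> v}"] by auto
  show ?thesis
  proof (cases "v = 0")
    case True
    show ?thesis
    proof (cases "\<exists>j\<in>T. c j \<noteq> 0")
      case ex: True
      then obtain j where j: "j \<in> T" "c j \<noteq> 0" by blast
      have "c i = 0" if "i \<in> T - {j}" for i
      proof (rule ccontr)
        assume "c i \<noteq> 0"
        then have "i = j"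
          using eq[of i j] that j d(1)[of i] d(1)[OF j(1)] S(2) True by auto
        then show False using that by blast
      qed
      then show ?thesis by blast
    qed blast
  next
    case False
    have "card (S - T) = N - card T" using S T by (simp add: card_Diff_subset)
    then have "S - T \<noteq> {}" using T(2) by (metis card.empty diff_is_0_eq leD)
    then obtain z where z: "z \<in> S - T" by blast
    have "y = z" if "y \<in> S - T" for y
      using eq[of y z] that z d(2)[of y] d(2)[of z] False by blast
    then have "S - T = {z}" using z by blast
    then have "Suc (card T) = N" using \<open>card (S - T) = N - card T\<close> by simp
    moreover have "c i = v" if "i \<in> T" for i
    proof (rule ccontr)
      assume "c i \<noteq> v"
      then have "z = i" using eq[of z i] z that d(1)[OF that] d(2)[OF z] S(2) False by auto
      then show False using z that by blast
    qed
    ultimately show ?thesis using False by blast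
  qed
qed

text \<open>With exponent \<open>N - 1\<close> the count of pairs leaves no exception, and the
  padding forces the constant to be \<open>0\<close>.\<close>

lemma coinvariant_power_pred:
  assumes T: "finite T" "card T < N" and K: "linform c T ^ (N - 1) \<in> K T (\<lambda>_. N)" and i: "i \<in> T"
  shows "c i = 0"
proof -
  obtain S d where S: "finite S" "T \<subseteq> S" "card S = N" and d: "\<And>j. j \<in> T \<Longrightarrow> d j = c j"
    "\<And>j. j \<in> S - T \<Longrightarrow> d j = 0" and less: "card {(a, b) \<in> S \<times> S. d a \<noteq> d b} < 2 * (N - 1)"
    using coinvariant_extend[OF T(1) less_imp_le[OF T(2)], of c] K by blast
  have "T \<noteq> S" using S(3) T(2) by auto
  then obtain z where z: "z \<in> S - T" using S(2) by blast
  then have "d i = d z"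
    using constant_if_few_pairs[OF S(1), of d i z] S less i by auto
  then show ?thesis using d(1)[OF i] d(2)[OF z] by simp
qed

text \<open>The variables outside \<open>U\<close> are removed by \<open>K_cut0\<close>, the largest
  first. When the turn of \<open>k\<close> comes, the remaining set is contained in the set counted
  in the last assumption.\<close>

lemma K_drop:
  assumes "finite S" "U \<subseteq> S" "p \<in> K S L"
    and "\<And>k. k \<in> S - U \<Longrightarrow> deg_less k 1 p"
    and "\<And>k. k \<in> S - U \<Longrightarrow> card {j\<in>S. j \<le> k \<or> j \<in> U} \<le> L k"
  shows "p \<in> K U L"
  using assms
proof (induction "card (S - U)" arbitrary: S)
  case 0
  then have "S = U" by auto
  then show ?case using "0.prems" by simp
next
  case (Suc n)
  have fin: "finite (S - U)" using Suc.prems(1) by simp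
  have ne: "S - U \<noteq> {}" using Suc.hyps(2) by (metis card.empty nat.distinct(1))
  define k where "k = Max (S - U)"
  have k: "k \<in> S - U" unfolding k_def by (rule Max_in[OF fin ne])
  have le: "j \<le> k" if "j \<in> S - U" for j unfolding k_def by (rule Max_ge[OF fin that])
  have "{j\<in>S. j \<le> k \<or> j \<in> U} = S" using le by blast
  then have "p \<in> K (S - {k}) L"
    using K_cut0[of S k p L] Suc.prems k by fastforce
  moreover have eq: "S - {k} - U = (S - U) - {k}" by auto
  moreover have "n = card (S - {k} - U)" unfolding eq using Suc.hyps(2) fin k by simp
  moreover have "card {j \<in> S - {k}. j \<le> k' \<or> j \<in> U} \<le> L k'" if "k' \<in> S - {k} - U" for k'
  proof -
    have "card {j \<in> S - {k}. j \<le> k' \<or> j \<in> U} \<le> card {j \<in> S. j \<le> k' \<or> j \<in> U}"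
      using Suc.prems(1) by (intro card_mono) auto
    then show ?thesis using Suc.prems(5)[of k'] that by auto
  qed
  ultimately show ?case using Suc.hyps(1)[of "S - {k}"] Suc.prems k by auto
qed

lemma h_expand:
  assumes "finite T" "a \<notin> T"
  shows "\<exists>r. h m (insert a T) = X a ^ m + r \<and> deg_less a m r"
proof (induction m)
  case 0
  show ?case using assms(1) by (intro exI[of _ 0]) simp
next
  case (Suc m)
  then obtain r where r: "h m (insert a T) = X a ^ m + r" "deg_less a m r" by blast
  have "deg_less a (m + 1) (r * X a)"
    using deg_less_mult[OF r(2), of 1] deg_less_X_power[of a 1] by simp
  moreover have "deg_less a (m + 1) (h (Suc m) T)"
    using deg_less_h1[OF assms] by (rule deg_less_mono) simp
  ultimately have "deg_less a (Suc m) (h (Suc m) T + X a * r)"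
    using deg_less_add by (simp add: mult.commute)
  then show ?case using h_insert[OF assms, of m] r(1)
    by (intro exI[of _ "h (Suc m) T + X a * r"]) (simp add: algebra_simps)
qed

text \<open>\<open>h m S\<close> annihilates \<open>X a\<close> modulo the two given elements, so multiplying by it sets \<open>X a\<close> to zero.\<close>

lemma K_kill:
  assumes S: "finite S" "a \<in> S"
    and h: "h (Suc m) S \<in> K S L" "h (Suc m) (S - {a}) \<in> K S L"
    and L: "m + card S \<le> L a" and f: "linform c S ^ n \<in> K S L"
  shows "linform c (S - {a}) ^ n \<in> K (S - {a}) L"
proof -
  let ?f = "linform c S" and ?g = "linform c (S - {a})"
  have ins: "insert a (S - {a}) = S" using S(2) by blast
  have "X a * h m S \<in> K S L"
    using ideal_diff[OF ideal_K h] h_insert[of "S - {a}" a m, unfolded ins] S(1) by simp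
  then have "of_int (c a) * (X a * h m S) \<in> K S L" by (rule ideal_mult[OF ideal_K])
  then have "h m S * (?f - ?g) \<in> K S L" by (simp add: linform_remove[OF S] mult_ac)
  then have "h m S * (?f ^ n - ?g ^ n) \<in> K S L" by (rule ideal_power_cong[OF ideal_K])
  then have "h m S * ?g ^ n \<in> K S L"
    using ideal_diff[OF ideal_K ideal_mult[OF ideal_K f, of "h m S"]] by (fastforce simp: algebra_simps)
  \<comment> \<open>\<open>h m S\<close> is monic of degree \<open>m\<close> in \<open>X a\<close>,
    while the power of the shortened form is free of \<open>X a\<close>; so \<open>K_cut\<close>
    extracts that power.\<close>
  moreover obtain r where r: "h m S = X a ^ m + r" "deg_less a m r"
    using h_expand[of "S - {a}" a m, unfolded ins] S(1) by auto
  ultimately have "X a ^ m * ?g ^ n + r * ?g ^ n \<in> K S L" by (simp add: distrib_right)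
  moreover have g: "deg_less a 1 (?g ^ n)" by (intro deg_less_power1 deg_less_linform) simp
  moreover have "deg_less a m (r * ?g ^ n)" using deg_less_mult1[OF g r(2)] by (simp add: mult.commute)
  ultimately show ?thesis using K_cut[OF S] L by blast
qed

section \<open>Forms involving a variable with a larger exponent\<close>

lemma power_expand2:
  fixes A B :: "'a::comm_ring_1"
  shows "\<exists>q. (A + B) ^ n = A ^ n + of_nat n * A ^ (n - 1) * B + B\<^sup>2 * q"
proof (induction n)
  case 0
  show ?case by (intro exI[of _ 0]) simp
next
  case (Suc n)
  then obtain q where q: "(A + B) ^ n = A ^ n + of_nat n * A ^ (n - 1) * B + B\<^sup>2 * q" by blast
  have "of_nat n * A ^ (n - 1) * A = of_nat n * A ^ n" by (cases n) simp_all
  then have "(A + B) ^ Suc n = A ^ Suc n + of_nat (Suc n) * A ^ n * B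
      + B\<^sup>2 * (of_nat n * A ^ (n - 1) + (A + B) * q)"
    by (simp add: q algebra_simps power2_eq_square)
  then show ?case by auto
qed

lemma lookup_binomial:
  assumes "a \<noteq> j"
  shows "lk ((of_int x * X a + of_int y * X j) ^ n) (sgl a p + sgl j q) =
    (if p + q = n then of_nat (n choose p) * x ^ p * y ^ q else 0)"
proof -
  have iff: "sgl a k + sgl j (n - k) = sgl a p + sgl j q \<longleftrightarrow> k = p \<and> n - k = q" for k
  proof
    assume "sgl a k + sgl j (n - k) = sgl a p + sgl j q"
    then have "lk (sgl a k + sgl j (n - k)) i = lk (sgl a p + sgl j q) i" for i by simp
    from this[of a] this[of j] show "k = p \<and> n - k = q"
      using assms by (simp add: lookup_add lookup_single when_def)
  qed auto
  have "(of_int x * X a + of_int y * X j) ^ n =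
      (\<Sum>k\<le>n. of_int (of_nat (n choose k) * x ^ k * y ^ (n - k)) * sgl (sgl a k + sgl j (n - k)) 1)"
    unfolding binomial_ring
    by (rule sum.cong) (simp_all add: power_mult_distrib X_power mult_single mult_ac)
  then have "lk ((of_int x * X a + of_int y * X j) ^ n) (sgl a p + sgl j q) =
      (\<Sum>k\<le>n. (of_nat (n choose k) * x ^ k * y ^ (n - k)) * (if k = p \<and> n - k = q then 1 else 0))"
    by (simp only: lookup_sum lookup_of_int_mult lookup_single when_def iff)
  also have "\<dots> = (\<Sum>k\<le>n. if p = k then (if p + q = n then of_nat (n choose p) * x ^ p * y ^ q else 0) else 0)"
    by (rule sum.cong) auto
  finally show ?thesis by (auto simp: sum.delta)
qed

text \<open>After multiplication by \<open>X a - X j\<close> the monomials with exponents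
  \<open>p + 1\<close> at \<open>a\<close> and \<open>q + 1 < N\<close> at \<open>j\<close> lie
  outside the monomial ideal, so their coefficients vanish; this fixes the ratios of consecutive
  coefficients of the power. The case \<open>q = 0\<close> gives \<open>x = N * y\<close>. For
  \<open>N > 2\<close> the case \<open>q = 1\<close> would give \<open>N choose 2 = N * N\<close>,
  which is impossible.\<close>

lemma two_variable_power:
  assumes aj: "a \<noteq> j" and N: "2 \<le> N" and x: "x \<noteq> 0" and y: "y \<noteq> 0"
    and K: "(of_int x * X a + of_int y * X j) ^ N \<in> K {a, j} (\<lambda>k. if k = a then Suc N else N)"
  shows "N = 2 \<and> x = 2 * y"
proof -
  let ?L = "\<lambda>k. if k = a then Suc N else N" and ?F = "(of_int x * X a + of_int y * X j) ^ N"
  obtain n where "vdm X {a, j} = (- 1) ^ n * vdm X ({a, j} - {a}) * (\<Prod>i\<in>{a, j} - {a}. X a - X i)"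
    by (rule vdm_remove[of "{a, j}" a X]) auto
  moreover have "{a, j} - {a} = {j}" using aj by auto
  ultimately have V: "vdm X {a, j} = (- 1) ^ n * (X a - X j)" by simp
  have "?F * vdm X {a, j} \<in> J {a, j} ?L" using K by (simp only: K_def mem_Collect_eq)
  then have "(- 1) ^ n * (?F * ((- 1) ^ n * (X a - X j))) \<in> J {a, j} ?L"
    unfolding V by (rule ideal_mult[OF ideal_J])
  moreover have "(- 1) ^ n * (?F * ((- 1) ^ n * (X a - X j))) = X a ^ 1 * ?F - X j ^ 1 * ?F"
  proof -
    have "(- 1) ^ n * (- 1) ^ n = (1 :: int_mpoly)" by (simp add: power_mult_distrib[symmetric])
    moreover have "(- 1) ^ n * (?F * ((- 1) ^ n * (X a - X j))) =
        ((- 1) ^ n * (- 1) ^ n) * (?F * (X a - X j))"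
      by (simp only: mult_ac)
    ultimately have "(- 1) ^ n * (?F * ((- 1) ^ n * (X a - X j))) = ?F * (X a - X j)"
      by (simp only: mult_1)
    then show ?thesis by (simp only: right_diff_distrib power_one_right mult.commute[of ?F])
  qed
  ultimately have in_J: "X a ^ 1 * ?F - X j ^ 1 * ?F \<in> J {a, j} ?L" by simp
  have coeff: "of_nat (N choose p) * x ^ p * y ^ Suc q = of_nat (N choose Suc p) * x ^ Suc p * y ^ q"
    if pq: "Suc (p + q) = N" "Suc q < N" for p q
  proof -
    let ?e = "sgl a (Suc p) + sgl j (Suc q)"
    have "?e \<notin> ks (X a ^ 1 * ?F - X j ^ 1 * ?F)"
      using in_J pq aj unfolding J_def by (auto simp: lookup_add lookup_single when_def)
    then have "lk (X a ^ 1 * ?F) ?e = lk (X j ^ 1 * ?F) ?e" by (simp only: in_keys_iff lookup_minus not_not right_minus_eq)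
    moreover have "?e - sgl a 1 = sgl a p + sgl j (Suc q)" "?e - sgl j 1 = sgl a (Suc p) + sgl j q"
      using aj by (auto intro!: poly_mapping_eqI simp: lookup_minus lookup_add lookup_single when_def)
    moreover have "1 \<le> lk ?e a" "1 \<le> lk ?e j" using aj by (simp_all add: lookup_add lookup_single)
    ultimately show ?thesis
      using pq(1) by (simp only: lookup_X_power_mult if_True lookup_binomial[OF aj]) simp
  qed
  obtain M where M: "N = Suc (Suc M)" using N by (metis add_2_eq_Suc le_Suc_ex)
  have "of_nat (N choose Suc M) * x ^ Suc M * y = x ^ Suc (Suc M)"
    using coeff[of "Suc M" 0] M by simp
  then have "x ^ Suc M * (of_nat (N choose Suc M) * y) = x ^ Suc M * x" by (simp add: mult_ac)
  moreover have "N choose Suc M = N" using binomial_symmetric[of 1 N] M by simp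
  ultimately have 1: "int N * y = x" using x by simp
  show ?thesis
  proof (cases M)
    case 0
    then show ?thesis using 1 M by simp
  next
    case (Suc M')
    then have "of_nat (N choose M) * x ^ M * y\<^sup>2 = of_nat (N choose Suc M) * x ^ Suc M * y"
      using coeff[of M 1] M by (simp add: power2_eq_square)
    then have "(x ^ M * y) * (int (N choose M) * y) = (x ^ M * y) * (int (N choose Suc M) * x)"
      by (simp add: power2_eq_square mult_ac)
    then have "int (N choose M) * y = int N * x" using x y \<open>N choose Suc M = N\<close> by simp
    then have "int (N choose M) * y = int N * int N * y" using 1 by simp
    then have "int (N choose M) = int N * int N" using y by simp
    moreover have "N choose M = N choose 2" using binomial_symmetric[of 2 N] M by (simp add: numeral_2_eq_2)
    ultimately have "int (N choose 2) = int (N * N)" by simp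
    then have "N choose 2 = N * N" by (simp only: of_nat_eq_iff)
    moreover have "N choose 2 = N * (N - 1) div 2" by (rule choose_two)
    moreover have "N * (N - 1) div 2 < N * N" using N
      by (intro div_less_dividend[THEN less_le_trans] mult_le_mono) simp_all
    ultimately show ?thesis by simp
  qed
qed

lemma h_Suc_in_K:
  assumes "finite S" "T \<subseteq> S" "\<And>k. k \<in> T \<Longrightarrow> L k \<le> m + card T"
  shows "h (Suc m) T \<in> K S L"
proof (cases "T = {}")
  case True
  then show ?thesis using ideal_0[OF ideal_K] by simp
next
  case False
  then show ?thesis using assms by (intro h_in_K) (auto simp: less_Suc_eq_le)
qed

text \<open>With \<open>card T = N - 1\<close>, the form \<open>W = \<Sum>T\<close> is minus the last root of the coinvariant algebra.\<close>

lemma sum_power_notin_K: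
  assumes "finite T" "Suc (card T) = N" "2 \<le> N"
  shows "linform (\<lambda>_. 1) T ^ (N - 1) \<notin> K T (\<lambda>_. N)"
proof
  assume "linform (\<lambda>_. 1) T ^ (N - 1) \<in> K T (\<lambda>_. N)"
  moreover obtain i where "i \<in> T" using assms by fastforce
  ultimately show False using coinvariant_power_pred[of T N "\<lambda>_. 1" i] assms by simp
qed

text \<open>After lowering the exponents to \<open>N + 1\<close> at \<open>a\<close> and
  \<open>N\<close> elsewhere, the choice \<open>m = N - card (S - {a})\<close> fits the conditions
  of \<open>K_kill\<close> exactly.\<close>

lemma K_kill_large:
  assumes S: "finite S" "card S \<le> N" "a \<in> S"
    and L: "\<And>k. k \<in> S - {a} \<Longrightarrow> N \<le> L k" "Suc N \<le> L a"
    and f: "linform c S ^ n \<in> K S L"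
  shows "linform c (S - {a}) ^ n \<in> K (S - {a}) (\<lambda>_. N)"
proof -
  let ?L = "\<lambda>k. if k = a then Suc N else N"
  have c: "Suc (card (S - {a})) = card S" using card.remove[OF S(1,3)] by (rule sym)
  have "K S L \<subseteq> K S ?L" by (rule K_mono[OF S(1)]) (use L in auto)
  then have f': "linform c S ^ n \<in> K S ?L" using f by blast
  have "linform c (S - {a}) ^ n \<in> K (S - {a}) ?L"
  proof (rule K_kill[OF S(1,3) _ _ _ f'])
    show "h (Suc (N - card (S - {a}))) S \<in> K S ?L"
    proof (rule h_Suc_in_K[OF S(1) subset_refl])
      show "?L k \<le> N - card (S - {a}) + card S" for k using S(2) c by presburger
    qed
    show "h (Suc (N - card (S - {a}))) (S - {a}) \<in> K S ?L"
    proof (rule h_Suc_in_K[OF S(1)])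
      show "?L k \<le> N - card (S - {a}) + card (S - {a})" if "k \<in> S - {a}" for k
        using S(2) c that by simp
    qed blast
    show "N - card (S - {a}) + card S \<le> ?L a" using S(2) c by presburger
  qed
  then show ?thesis using K_mono[of "S - {a}" "S - {a}" "\<lambda>_. N" ?L] S(1) by auto
qed

text \<open>Dropping all other variables leaves one variable, whose Vandermonde product is
  \<open>1\<close>, and \<open>X a ^ N\<close> is not divisible by \<open>X a ^ L a\<close>.\<close>

lemma single_power_notin_K:
  assumes "finite S" "a \<in> S" "\<And>k. k \<in> S - {a} \<Longrightarrow> card {j\<in>S. j \<le> k \<or> j = a} \<le> L k" "N < L a" "v \<noteq> 0"
  shows "(of_int v * X a) ^ N \<notin> K S L"
proof
  assume "(of_int v * X a) ^ N \<in> K S L"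
  then have "of_int (v ^ N) * X a ^ N \<in> K S L" by (simp add: power_mult_distrib)
  then have "X a ^ N \<in> K S L" by (rule K_cancel_int) (simp add: assms(5))
  then have "X a ^ N \<in> K {a} L"
  proof (rule K_drop[OF assms(1), rotated])
    show "deg_less k 1 (X a ^ N)" if "k \<in> S - {a}" for k
      using that by (intro deg_less_power1 deg_less_X1) auto
  qed (use assms(2,3) in auto)
  then show False using assms(4) by (simp add: K_def J_def X_power)
qed

text \<open>The difference of powers contains the factor \<open>f - g'\<close>, a multiple of
  \<open>x\<close>; against \<open>x\<close> the remaining powers of \<open>f\<close> turn into
  powers of \<open>g\<close>.\<close>

lemma power_diff_cong:
  assumes Q: "is_ideal Q" and x: "x * (f - g) \<in> Q" and f: "f - g' = of_int c * x"
  shows "f ^ n - g' ^ n - of_int c * x * (\<Sum>i<n. g' ^ (n - Suc i) * g ^ i) \<in> Q"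
proof -
  have "f ^ n - g' ^ n - of_int c * x * (\<Sum>i<n. g' ^ (n - Suc i) * g ^ i) =
      (\<Sum>i<n. (of_int c * g' ^ (n - Suc i)) * (x * (f ^ i - g ^ i)))"
    unfolding power_diff_sumr2[of f n g'] f by (simp add: sum_distrib_left sum_subtractf algebra_simps)
  moreover have "x * (f ^ i - g ^ i) \<in> Q" for i by (rule ideal_power_cong[OF Q x])
  then have "(\<Sum>i\<in>A. (of_int c * g' ^ (n - Suc i)) * (x * (f ^ i - g ^ i))) \<in> Q" for A
    by (induction A rule: infinite_finite_induct) (auto intro: ideal_0[OF Q] ideal_add[OF Q] ideal_mult[OF Q])
  ultimately show ?thesis by simp
qed

text \<open>Let \<open>x = c a\<close> and let \<open>W\<close> be the sum over
  \<open>S - {a}\<close>. Next to a factor \<open>X a\<close> the variable \<open>X a\<close> acts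
  as \<open>- W\<close>, so the power reduces to
  \<open>(v ^ N - (v - x) ^ N) * X a * W ^ (N - 1)\<close>. Since \<open>X a * W ^ (N - 1)\<close>
  is not in the ideal, \<open>v ^ N = (v - x) ^ N\<close> follows, that is, \<open>x = 2 * v\<close>
  with \<open>N\<close> even.\<close>

lemma linform_power_const_tail:
  assumes S: "finite S" "card S = N" "2 \<le> N" "a \<in> S" and v: "v \<noteq> 0" "\<And>j. j \<in> S - {a} \<Longrightarrow> c j = v"
    and x: "c a \<noteq> 0" and f: "linform c S ^ N \<in> K S (\<lambda>k. if k = a then Suc N else N)"
  shows "even N \<and> c a = 2 * v"
proof -
  let ?L = "\<lambda>k. if k = a then Suc N else N" and ?T = "S - {a}"
  let ?W = "linform (\<lambda>_. 1) ?T" and ?f = "linform c S" and ?x = "c a"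
  have T: "finite ?T" "Suc (card ?T) = N"
    using S(1,2) card.remove[OF S(1,4)] by (simp, linarith)
  have g: "linform c ?T = of_int v * ?W"
    using linform_cong[of ?T c "\<lambda>_. v"] v(2) linform_const[of v ?T] by simp
  have "linform c ?T ^ N \<in> K ?T (\<lambda>_. N)"
    by (rule K_kill_large[OF S(1) _ S(4) _ _ f]) (use S in auto)
  moreover have "K ?T (\<lambda>_. N) \<subseteq> K S ?L" by (rule K_mono[OF S(1)]) auto
  ultimately have gN: "(of_int v * ?W) ^ N \<in> K S ?L" unfolding g by blast
  have "h 2 S \<in> K S ?L" "h 2 ?T \<in> K S ?L"
    using S(1,2) T by (auto simp: numeral_2_eq_2 simp del: card_Diff_insert intro!: h_Suc_in_K split: if_splits)
  moreover have "h 2 S - h 2 ?T = X a * (X a + ?W)"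
    using h_insert[OF T(1), of a 1] h_insert[OF T(1), of a 0] S T(1)
    by (simp add: insert_absorb numeral_2_eq_2 h_1_linform)
  ultimately have rel: "X a * (X a + ?W) \<in> K S ?L" using ideal_diff[OF ideal_K] by metis
  let ?g = "of_int (v - ?x) * ?W"
  have fx: "?f = of_int ?x * X a + of_int v * ?W" using linform_remove[OF S(1,4), of c] g by simp
  have "?f - ?g = of_int ?x * (X a + ?W)" by (simp add: fx algebra_simps)
  then have "X a * (?f - ?g) \<in> K S ?L" using ideal_mult[OF ideal_K rel, of "of_int ?x"] by (simp add: mult_ac)
  then have "?f ^ N - (of_int v * ?W) ^ N - of_int ?x * X a *
      (\<Sum>i<N. (of_int v * ?W) ^ (N - Suc i) * ?g ^ i) \<in> K S ?L"
    by (rule power_diff_cong[OF ideal_K]) (simp add: fx)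
  then have "of_int ?x * X a * (\<Sum>i<N. (of_int v * ?W) ^ (N - Suc i) * ?g ^ i) \<in> K S ?L"
    using ideal_cong[OF ideal_K] ideal_diff[OF ideal_K f gN] by blast
  moreover have "(\<Sum>i<N. (of_int v * ?W) ^ (N - Suc i) * ?g ^ i) =
      of_int (\<Sum>i<N. v ^ (N - Suc i) * (v - ?x) ^ i) * ?W ^ (N - 1)"
    unfolding of_int_sum sum_distrib_right
  proof (rule sum.cong)
    fix i assume "i \<in> {..<N}"
    then have "N - 1 = (N - Suc i) + i" by simp
    then have "?W ^ (N - 1) = ?W ^ (N - Suc i) * ?W ^ i" by (metis power_add)
    then show "(of_int v * ?W) ^ (N - Suc i) * ?g ^ i = of_int (v ^ (N - Suc i) * (v - ?x) ^ i) * ?W ^ (N - 1)"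
      by (simp add: power_mult_distrib mult_ac)
  qed simp
  moreover have \<kappa>: "?x * (\<Sum>i<N. v ^ (N - Suc i) * (v - ?x) ^ i) = v ^ N - (v - ?x) ^ N"
    using power_diff_sumr2[of "v - ?x" N v] by simp
  ultimately have in_K: "of_int (v ^ N - (v - ?x) ^ N) * (X a * ?W ^ (N - 1)) \<in> K S ?L"
    unfolding \<kappa>[symmetric] of_int_mult by (simp only: mult_ac)
  have eq: "v ^ N = (v - ?x) ^ N"
  proof (rule ccontr)
    assume "v ^ N \<noteq> (v - ?x) ^ N"
    then have "X a ^ 1 * ?W ^ (N - 1) + 0 \<in> K S ?L"
      using K_cancel_int[OF in_K] by simp
    then have "?W ^ (N - 1) \<in> K ?T ?L"
    proof (rule K_cut[OF S(1,4)])
      show "deg_less a 1 (?W ^ (N - 1))" by (intro deg_less_power1 deg_less_linform) simp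
    qed (use S in simp_all)
    also have "K ?T ?L \<subseteq> K ?T (\<lambda>_. N)" by (rule K_mono[OF T(1)]) auto
    finally show False using sum_power_notin_K[OF T S(3)] by blast
  qed
  then have "\<bar>v\<bar> ^ N = \<bar>v - ?x\<bar> ^ N" by (metis power_abs)
  then have "\<bar>v\<bar> = \<bar>v - ?x\<bar>" using S(3) by (metis abs_ge_zero not_numeral_le_zero not_gr_zero power_eq_imp_eq_base)
  then have x2: "?x = 2 * v" using x by linarith
  have "even N"
  proof (rule ccontr)
    assume "odd N"
    then have "v ^ N = - (v ^ N)" using eq x2 by simp
    then show False using v(1) by simp
  qed
  then show ?thesis using x2 by simp
qed

text \<open>Setting \<open>X a\<close> to zero leaves a form in fewer than \<open>N\<close>
  variables, for which \<open>coinvariant_power\<close> allows at most a single variable or a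
  constant form in \<open>N - 1\<close> variables. Comparing coefficients settles the first case,
  with \<open>N = 2\<close>, and \<open>linform_power_const_tail\<close> the second.\<close>

lemma linform_power_one_large:
  assumes S: "finite S" "card S \<le> N" "2 \<le> N" "a \<in> S"
    and L: "\<And>k. k \<in> S - {a} \<Longrightarrow> N \<le> L k" "Suc N \<le> L a"
    and x: "c a \<noteq> 0" and f: "linform c S ^ N \<in> K S L"
  shows "card S = N \<and> even N \<and> (\<forall>j\<in>S - {a}. c a = 2 * c j)"
proof -
  let ?L = "\<lambda>k. if k = a then Suc N else N" and ?T = "S - {a}"
  have "K S L \<subseteq> K S ?L" by (rule K_mono[OF S(1)]) (use L in auto)
  then have f': "linform c S ^ N \<in> K S ?L" using f by blast
  have T: "finite ?T" "card ?T < N" "card S = Suc (card ?T)"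
    using S(1,2) card.remove[OF S(1,4)] by (simp, linarith, linarith)
  have drop: "card {j \<in> S. j \<le> k \<or> P j} \<le> ?L k" for k P
    using card_mono[OF S(1), of "{j \<in> S. j \<le> k \<or> P j}"] S(2) by force
  have "linform c ?T ^ N \<in> K ?T (\<lambda>_. N)"
    by (rule K_kill_large[OF S(1,2,4) L f])
  then consider j where "\<forall>i\<in>?T - {j}. c i = 0" | v where "Suc (card ?T) = N" "v \<noteq> 0" "\<forall>i\<in>?T. c i = v"
    using coinvariant_power[OF T(1,2)] by blast
  then show ?thesis
  proof cases
    case (1 j)
    have j: "j \<in> ?T \<and> c j \<noteq> 0"
    proof (rule ccontr)
      assume "\<not> (j \<in> ?T \<and> c j \<noteq> 0)"
      then have "c i = 0" if "i \<in> ?T" for i using 1 that by (cases "i = j") auto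
      then have "linform c S = of_int (c a) * X a"
        using linform_remove[OF S(1,4), of c] linform_superset[OF T(1), of "{}" c]
        by (simp add: linform_def)
      then have "(of_int (c a) * X a) ^ N \<in> K S ?L" using f' by simp
      then show False using single_power_notin_K[OF S(1,4) _ _ x, of ?L N] drop by simp
    qed
    have "linform c S = of_int (c a) * X a + of_int (c j) * X j"
      using linform_remove[OF S(1,4), of c] linform_superset[OF T(1), of "{j}" c] 1 j
      by (auto simp: linform_def)
    then have "(of_int (c a) * X a + of_int (c j) * X j) ^ N \<in> K S ?L" using f' by simp
    then have "(of_int (c a) * X a + of_int (c j) * X j) ^ N \<in> K {a, j} ?L"
    proof (rule K_drop[OF S(1), rotated])
      show "deg_less k 1 ((of_int (c a) * X a + of_int (c j) * X j) ^ N)" if k: "k \<in> S - {a, j}" for k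
      proof -
        have "deg_less k 1 (of_int (c i) * X i)" if "i \<noteq> k" for i
          by (rule deg_less_mult1) (use that in \<open>simp_all\<close>)
        then show ?thesis using k by (intro deg_less_power1 deg_less_add) auto
      qed
      show "{a, j} \<subseteq> S" using j S(4) by blast
    qed (rule drop)
    then have N: "N = 2" "c a = 2 * c j"
      using two_variable_power[of a j N "c a" "c j"] S j x by auto
    then have "card ?T \<le> 1" using T by simp
    then have "?T = {j}" using j T(1) card_le_Suc0_iff_eq[of ?T] by auto
    then show ?thesis using N T(3) by simp
  next
    case (2 v)
    then show ?thesis
      using linform_power_const_tail[OF S(1) _ S(3,4) 2(2) _ x f'] T(3) by auto
  qed
qed

text \<open>Let \<open>W\<close> be the sum over \<open>S - {a}\<close>. Here
  \<open>X a ^ 2 * (X a + W)\<close> is the relation at hand, so the power is multiplied by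
  \<open>X a + W\<close>. In its expansion in powers of \<open>X a\<close> the terms with
  \<open>W ^ N\<close> and with \<open>X a ^ 2 * (X a + W)\<close> drop out, leaving a nonzero
  multiple of \<open>X a ^ 2 * W ^ (N - 1)\<close>, which is outside the ideal.\<close>

lemma linform_power_two_large:
  assumes S: "finite S" "card S = N" "2 \<le> N" "a \<in> S"
    and L: "\<And>k. k \<in> S - {a} \<Longrightarrow> N \<le> L k" "N + 2 \<le> L a"
    and v: "v \<noteq> 0" "\<And>j. j \<in> S - {a} \<Longrightarrow> c j = v" and x: "c a \<noteq> 0"
  shows "linform c S ^ N \<notin> K S L"
proof
  assume f: "linform c S ^ N \<in> K S L"
  let ?L = "\<lambda>k. if k = a then N + 2 else N" and ?T = "S - {a}"
  let ?W = "linform (\<lambda>_. 1) ?T" and ?f = "linform c S" and ?x = "c a"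
  have T: "finite ?T" "Suc (card ?T) = N"
    using S(1,2) card.remove[OF S(1,4)] by (simp, linarith)
  have "K S L \<subseteq> K S ?L" by (rule K_mono[OF S(1)]) (use L in auto)
  then have f': "?f ^ N \<in> K S ?L" using f by blast
  have g: "linform c ?T = of_int v * ?W"
    using linform_cong[of ?T c "\<lambda>_. v"] v(2) linform_const[of v ?T] by simp
  have "linform c ?T ^ N \<in> K ?T (\<lambda>_. N)"
    by (rule K_kill_large[OF S(1) _ S(4) _ _ f]) (use S L in auto)
  then have "of_int (v ^ N) * ?W ^ N \<in> K ?T (\<lambda>_. N)" unfolding g by (simp add: power_mult_distrib)
  then have "?W ^ N \<in> K ?T (\<lambda>_. N)" by (rule K_cancel_int) (simp add: v(1))
  moreover have "K ?T (\<lambda>_. N) \<subseteq> K S ?L" by (rule K_mono[OF S(1)]) auto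
  ultimately have WN: "?W ^ N \<in> K S ?L" by blast
  have "h (Suc 2) S \<in> K S ?L" "h (Suc 2) ?T \<in> K S ?L" "h (Suc 1) ?T \<in> K S ?L"
    using S(1,2,4) T
    by (auto simp: numeral_2_eq_2 simp del: card_Diff_insert intro!: h_Suc_in_K split: if_splits)
  \<comment> \<open>Two steps of the recursion: \<open>h 3 S - h 3 ?T\<close> is
    \<open>X a * h 2 S\<close>, and \<open>h 2 S - h 2 ?T\<close> is
    \<open>X a * h 1 S\<close>.\<close>
  moreover have "h (Suc 2) S - h (Suc 2) ?T - X a * h (Suc 1) ?T = X a ^ 2 * (X a + ?W)"
    using h_insert[OF T(1), of a 2] h_insert[OF T(1), of a 1] h_insert[OF T(1), of a 0] S T(1)
    by (simp add: insert_absorb numeral_2_eq_2 h_1_linform algebra_simps)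
  ultimately have rel: "X a ^ 2 * (X a + ?W) \<in> K S ?L"
    using ideal_diff[OF ideal_K ideal_diff[OF ideal_K] ideal_mult[OF ideal_K]] by metis
  have fx: "?f = of_int v * ?W + of_int ?x * X a" using linform_remove[OF S(1,4), of c] g by simp
  obtain q where q: "?f ^ N = (of_int v * ?W) ^ N + of_nat N * (of_int v * ?W) ^ (N - 1) * (of_int ?x * X a)
      + (of_int ?x * X a)\<^sup>2 * q"
    using power_expand2[of "of_int v * ?W" "of_int ?x * X a" N] fx by auto
  let ?m = "int N * v ^ (N - 1) * ?x"
  have Npow: "?W ^ N = ?W ^ (N - 1) * ?W" using power_minus_mult[of N ?W] S(3) by simp
  have ring: "(A + W) * (vN * (P * W) + n * (v' * P) * (x * A) + (x * A)\<^sup>2 * q) =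
      (n * v' * x) * (A\<^sup>2 * P) + ((vN * (A + W) + n * v' * x * A) * (P * W) + (x\<^sup>2 * q) * (A\<^sup>2 * (A + W)))"
    for A W P n vN v' x q :: int_mpoly by (simp only: distrib_left distrib_right power2_eq_square mult_ac add_ac)
  have "(X a + ?W) * ?f ^ N = of_int ?m * (X a ^ 2 * ?W ^ (N - 1))
      + ((of_int (v ^ N) * (X a + ?W) + of_int ?m * X a) * ?W ^ N
        + (of_int (?x ^ 2) * q) * (X a ^ 2 * (X a + ?W)))"
    unfolding q power_mult_distrib[of "of_int v"] Npow of_int_mult of_int_power of_int_of_nat_eq by (rule ring)
  then have eq: "of_int ?m * (X a ^ 2 * ?W ^ (N - 1)) = (X a + ?W) * ?f ^ N
      - ((of_int (v ^ N) * (X a + ?W) + of_int ?m * X a) * ?W ^ N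
        + (of_int (?x ^ 2) * q) * (X a ^ 2 * (X a + ?W)))"
    by (simp only: add_diff_cancel_right')
  have "of_int ?m * (X a ^ 2 * ?W ^ (N - 1)) \<in> K S ?L"
    unfolding eq by (rule ideal_diff[OF ideal_K ideal_mult[OF ideal_K f']
      ideal_add[OF ideal_K ideal_mult[OF ideal_K WN] ideal_mult[OF ideal_K rel]]])
  then have "X a ^ 2 * ?W ^ (N - 1) + 0 \<in> K S ?L"
    using K_cancel_int[of ?m] v(1) x S(3) by simp
  then have "?W ^ (N - 1) \<in> K ?T ?L"
  proof (rule K_cut[OF S(1,4)])
    show "deg_less a 1 (?W ^ (N - 1))" by (intro deg_less_power1 deg_less_linform) simp
  qed (use S in simp_all)
  also have "K ?T ?L \<subseteq> K ?T (\<lambda>_. N)" by (rule K_mono[OF T(1)]) auto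
  finally show False using sum_power_notin_K[OF T S(3)] by blast
qed

text \<open>Multiplication by \<open>X b\<close> replaces \<open>X b\<close> by \<open>- W\<close>, where \<open>W = \<Sum>T\<close>, and \<open>X i\<^sup>2\<close> by \<open>0\<close>.\<close>

lemma linform_power_two_tail:
  assumes T: "finite T" "Suc (card T) = N" "2 \<le> N" and bi: "b \<notin> T" "i \<notin> T" "b \<noteq> i"
    and L: "\<And>k. k \<in> T \<Longrightarrow> N \<le> L k" "Suc N \<le> L b" "N + 2 \<le> L i"
    and x: "c i \<noteq> 0" and f: "linform c (insert i (insert b T)) ^ N \<in> K (insert i (insert b T)) L"
    and j: "j \<in> T"
  shows "c j = c b"
proof -
  let ?U = "insert b T" and ?S = "insert i (insert b T)"
  let ?L = "\<lambda>k. if k = i then N + 2 else if k = b then Suc N else N"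
  let ?W = "linform (\<lambda>_. 1) T" and ?f = "linform c ?S" and ?x = "c i"
  have S: "finite ?S" "card ?S = N + 1" "finite ?U" "card ?U = N" using T bi by auto
  have "K ?S L \<subseteq> K ?S ?L" by (rule K_mono[OF S(1)]) (use L in auto)
  then have f': "?f ^ N \<in> K ?S ?L" using f by blast
  have h: "h (Suc 1) ?S \<in> K ?S ?L" "h (Suc 1) ?U \<in> K ?S ?L" "h (Suc 1) T \<in> K ?S ?L"
    using S T bi by (auto intro!: h_Suc_in_K)
  have "h (Suc 1) ?U - h (Suc 1) T = X b * (X b + ?W)"
    using h_insert[OF T(1) bi(1), of 1] h_insert[OF T(1) bi(1), of 0] T(1)
    by (simp add: h_1_linform)
  then have relb: "X b * (X b + ?W) \<in> K ?S ?L" using ideal_diff[OF ideal_K h(2,3)] by simp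
  have "h (Suc 1) ?S - h (Suc 1) ?U = X i * (X i + (X b + ?W))"
    using h_insert[OF S(3), of i 1] h_insert[OF S(3), of i 0] h_insert[OF T(1) bi(1), of 0] bi T(1) S
    by (simp add: h_1_linform)
  then have reli: "X i * (X i + (X b + ?W)) \<in> K ?S ?L" using ideal_diff[OF ideal_K h(1,2)] by simp
  have "X b * (X i * (X i + (X b + ?W))) - X i * (X b * (X b + ?W)) = X b * X i ^ 2"
    by (simp add: algebra_simps power2_eq_square)
  then have relbi: "X b * X i ^ 2 \<in> K ?S ?L"
    using ideal_diff[OF ideal_K ideal_mult[OF ideal_K reli, of "X b"] ideal_mult[OF ideal_K relb, of "X i"]]
    by simp
  \<comment> \<open>Once \<open>X b\<close> is replaced by \<open>- ?W\<close>, the coefficient at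
    \<open>j\<close> in \<open>T\<close> becomes \<open>c j - c b\<close>.\<close>
  let ?d = "\<lambda>j. c j - c b" let ?G = "linform ?d T"
  have G: "?G = linform c T - of_int (c b) * ?W"
    by (simp add: linform_def sum_subtractf left_diff_distrib sum_distrib_left)
  have "?f = of_int ?x * X i + (of_int (c b) * X b + linform c T)"
    using T(1) bi by (simp add: linform_def)
  then have "?f - (?G + of_int ?x * X i) = of_int (c b) * (X b + ?W)"
    by (simp add: G algebra_simps)
  then have "X b * (?f - (?G + of_int ?x * X i)) \<in> K ?S ?L"
    using ideal_mult[OF ideal_K relb, of "of_int (c b)"] by (simp add: mult.left_commute)
  then have "X b * (?f ^ N - (?G + of_int ?x * X i) ^ N) \<in> K ?S ?L" by (rule ideal_power_cong[OF ideal_K])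
  from ideal_diff[OF ideal_K ideal_mult[OF ideal_K f', of "X b"] this]
  have "X b * (?G + of_int ?x * X i) ^ N \<in> K ?S ?L" by (simp add: algebra_simps)
  moreover obtain q where "(?G + of_int ?x * X i) ^ N = ?G ^ N + of_nat N * ?G ^ (N - 1) * (of_int ?x * X i)
      + (of_int ?x * X i)\<^sup>2 * q"
    using power_expand2 by blast
  then have "X b * (?G + of_int ?x * X i) ^ N = X i ^ 1 * (of_int (int N * ?x) * (X b * ?G ^ (N - 1)))
      + X b * ?G ^ N + (of_int (?x ^ 2) * q) * (X b * X i ^ 2)"
    by (simp add: algebra_simps power2_eq_square)
  then have eq: "X i ^ 1 * (of_int (int N * ?x) * (X b * ?G ^ (N - 1))) + X b * ?G ^ N =
      X b * (?G + of_int ?x * X i) ^ N - (of_int (?x ^ 2) * q) * (X b * X i ^ 2)"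
    by (simp only: add_diff_cancel_right')
  ultimately have main: "X i ^ 1 * (of_int (int N * ?x) * (X b * ?G ^ (N - 1))) + X b * ?G ^ N \<in> K ?S ?L"
    unfolding eq by (intro ideal_diff[OF ideal_K] ideal_mult[OF ideal_K relbi])
  have Gi: "deg_less k 1 (?G ^ n)" if "k \<notin> T" for k n
    using that by (intro deg_less_power1 deg_less_linform)
  \<comment> \<open>The term linear in \<open>X i\<close> is extracted first, then the factor
    \<open>X b\<close>; the result \<open>?G ^ (N - 1)\<close> concerns only \<open>T\<close>, where
    no nonzero form has so low an order.\<close>
  have "of_int (int N * ?x) * (X b * ?G ^ (N - 1)) \<in> K (?S - {i}) ?L"
  proof (rule K_cut[OF S(1) _ main])
    have b: "deg_less i 1 (X b)" using bi by (intro deg_less_X1) simp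
    show "deg_less i 1 (X b * ?G ^ N)" by (intro deg_less_mult1[OF b] Gi bi)
    have "deg_less i 1 (X b * ?G ^ (N - 1))" by (intro deg_less_mult1[OF b] Gi bi)
    moreover have "deg_less i 1 (of_int (int N * ?x))" by (simp only: One_nat_def deg_less_of_int)
    ultimately show "deg_less i 1 (of_int (int N * ?x) * (X b * ?G ^ (N - 1)))" by (rule deg_less_mult1[rotated])
  qed (use S in simp_all)
  moreover have "?S - {i} = ?U" using bi by auto
  ultimately have main: "X b ^ 1 * ?G ^ (N - 1) + 0 \<in> K ?U ?L"
    using K_cancel_int[of "int N * ?x" "X b * ?G ^ (N - 1)" ?U ?L] x T(3) by simp
  have "?G ^ (N - 1) \<in> K (?U - {b}) ?L"
    by (rule K_cut[OF S(3) _ main Gi]) (use S bi in simp_all)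
  moreover have "?U - {b} = T" using bi by auto
  ultimately have "?G ^ (N - 1) \<in> K T ?L" by simp
  moreover have "K T ?L \<subseteq> K T (\<lambda>_. N)" by (rule K_mono[OF T(1)]) auto
  ultimately have "?d j = 0" using coinvariant_power_pred[OF T(1) _ _ j, of N ?d] T(2) by auto
  then show ?thesis by simp
qed

text \<open>Induction on \<open>i\<close> from \<open>N\<close>, with the smallest exponents
  \<open>L0\<close> that the assumptions permit. Killing the new variable gives the shape of the
  other coefficients. If the new coefficient were nonzero, \<open>linform_power_two_tail\<close>
  would make the first \<open>N\<close> coefficients equal, which contradicts
  \<open>c N = 2 * c 1\<close> unless they all vanish; a lone variable is excluded by
  \<open>single_power_notin_K\<close>.\<close>

lemma linform_power_tail:
  assumes N: "2 \<le> N" "N \<le> i" and L: "\<And>k. k \<in> {1..i} \<Longrightarrow> N \<le> L k" "\<And>k. k \<in> {N..i} \<Longrightarrow> Suc k \<le> L k"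
    and f: "linform c {1..i} ^ N \<in> K {1..i} L"
  shows "(\<forall>k\<in>{N<..i}. c k = 0) \<and> (c N = 0 \<or> (\<forall>j\<in>{1..<N}. c N = 2 * c j))"
proof -
  define L0 where "L0 k = (if k < N then N else Suc k)" for k
  have "linform c {1..i} ^ N \<in> K {1..i} L0 \<Longrightarrow> ?thesis"
    using N(2)
  proof (induction i rule: dec_induct)
    case base
    show ?case
    proof (cases "c N = 0")
      case False
      have "card {1..N} = N \<and> even N \<and> (\<forall>j\<in>{1..N} - {N}. c N = 2 * c j)"
        by (rule linform_power_one_large[OF _ _ N(1) _ _ _ False base]) (use N(1) in \<open>auto simp: L0_def\<close>)
      then show ?thesis by auto
    qed simp
  next
    case (step n)
    let ?i = "Suc n" and ?T = "{1..<N}"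
    note f = step.prems
    have S: "{1..?i} - {?i} = {1..n}" by auto
    have "linform c ({1..?i} - {?i}) ^ N \<in> K ({1..?i} - {?i}) L0"
    proof (rule K_kill[OF _ _ _ _ _ f])
      show "h (Suc 1) {1..?i} \<in> K {1..?i} L0"
        using step.hyps by (intro h_Suc_in_K) (auto simp: L0_def)
      show "h (Suc 1) ({1..?i} - {?i}) \<in> K {1..?i} L0"
        unfolding S using step.hyps by (intro h_Suc_in_K) (auto simp: L0_def)
    qed (use step.hyps in \<open>simp_all add: L0_def\<close>)
    then have IH: "\<forall>k\<in>{N<..n}. c k = 0" "c N = 0 \<or> (\<forall>j\<in>?T. c N = 2 * c j)"
      using step.IH unfolding S by blast+
    have "c ?i = 0"
    proof (rule ccontr)
      assume x: "c ?i \<noteq> 0"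
      have drop: "linform c {1..?i} ^ N \<in> K U L0"
        if U: "U \<subseteq> {1..?i}" "?i \<in> U" and zero: "\<And>k. k \<in> {1..?i} - U \<Longrightarrow> c k = 0"
          and initial: "\<And>k j. k \<in> {1..?i} - U \<Longrightarrow> j \<in> U \<Longrightarrow> j \<le> k \<or> j = ?i" for U
      proof (rule K_drop[OF _ U(1) f])
        fix k assume k: "k \<in> {1..?i} - U"
        have "linform c {1..?i} = linform c ({1..?i} - {k})"
          by (rule linform_superset) (use zero[OF k] in auto)
        then show "deg_less k 1 (linform c {1..?i} ^ N)"
          using deg_less_linform[of k "{1..?i} - {k}" c] by (intro deg_less_power1) simp
        have "{j \<in> {1..?i}. j \<le> k \<or> j \<in> U} \<subseteq> insert ?i {1..k}" using initial[OF k] by force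
        then have "card {j \<in> {1..?i}. j \<le> k \<or> j \<in> U} \<le> card (insert ?i {1..k})"
          by (rule card_mono[rotated]) simp
        also have "\<dots> \<le> Suc k" by (simp add: card_insert_if)
        finally have le: "card {j \<in> {1..?i}. j \<le> k \<or> j \<in> U} \<le> Suc k" .
        show "card {j \<in> {1..?i}. j \<le> k \<or> j \<in> U} \<le> L0 k"
          using le by (auto simp: L0_def)
      qed simp
      let ?S = "insert ?i (insert N ?T)"
      have "linform c {1..?i} ^ N \<in> K ?S L0"
        by (rule drop) (use IH(1) step.hyps N(1) in auto)
      moreover have "linform c {1..?i} = linform c ?S"
        by (rule linform_superset) (use IH(1) step.hyps N(1) in auto)
      ultimately have "linform c ?S ^ N \<in> K ?S L0" by simp
      then have eq: "c j = c N" if "j \<in> ?T" for j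
        using linform_power_two_tail[of ?T N N ?i L0 c j] that x step.hyps N(1) by (auto simp: L0_def)
      have "1 \<in> ?T" using N(1) by simp
      with IH(2) eq[OF this] have "c N = 0" by force
      then have zero: "c k = 0" if "k \<in> {1..n}" for k
        using eq[of k] IH(1) that by (cases "k < N"; cases "k = N") auto
      have "linform c {1..?i} = linform c {?i}"
        by (rule linform_superset) (use zero in auto)
      then have "(of_int (c ?i) * X ?i) ^ N \<in> K {?i} L0"
        using drop[of "{?i}"] zero by (auto simp: linform_def)
      then show False using single_power_notin_K[of "{?i}" ?i L0 N "c ?i"] x step.hyps by (simp add: L0_def)
    qed
    then show ?case using IH by (auto simp: le_Suc_eq)
  qed
  moreover have "K {1..i} L \<subseteq> K {1..i} L0" by (rule K_mono) (use L in \<open>auto simp: L0_def\<close>)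
  ultimately show ?thesis using f by blast
qed

text \<open>Variables after the last one in the form are dropped. For \<open>i \<le> N\<close>,
  \<open>linform_power_one_large\<close> applies to every index with exponent above \<open>N\<close>
  and nonzero coefficient; a second such index \<open>j\<close> would give both
  \<open>c i = 2 * c j\<close> and \<open>c j = 2 * c i\<close>. The case \<open>L N > N + 1\<close>
  is excluded by \<open>linform_power_two_large\<close>, and \<open>i > N\<close> by
  \<open>linform_power_tail\<close>.\<close>

lemma nilpotent_linform_cases:
  assumes N: "2 \<le> N" "N \<le> L 1" and L: "\<And>j k. 1 \<le> j \<Longrightarrow> j \<le> k \<Longrightarrow> k \<le> n \<Longrightarrow> L j \<le> L k"
    "\<And>k. k \<in> {1..n} \<Longrightarrow> k < L k"
    and i: "i \<in> {1..n}" "c i \<noteq> 0" "\<And>j. j \<in> {i<..n} \<Longrightarrow> c j = 0"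
    and f: "linform c {1..n} ^ N \<in> K {1..n} L"
  shows "L i = N \<or> (i = N \<and> even N \<and> L N = Suc N \<and> (\<forall>j\<in>{1..<N}. L j = N))"
proof (cases "L i = N")
  case False
  have ge: "N \<le> L k" if "k \<in> {1..n}" for k using L(1)[of 1 k] N(2) that by simp
  have "N \<le> L i" by (rule ge[OF i(1)])
  then have iL: "Suc N \<le> L i" using False by simp
  have lf: "linform c {1..n} = linform c {1..i}"
    by (rule linform_superset) (use i in auto)
  have "linform c {1..i} ^ N \<in> K {1..i} L"
  proof (rule K_drop)
    show "linform c {1..i} ^ N \<in> K {1..n} L" using f lf by simp
    fix k assume k: "k \<in> {1..n} - {1..i}"
    show "deg_less k 1 (linform c {1..i} ^ N)"
      using k by (intro deg_less_power1 deg_less_linform) auto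
    have "{j \<in> {1..n}. j \<le> k \<or> j \<in> {1..i}} \<subseteq> {1..k}" using k by auto
    then have "card {j \<in> {1..n}. j \<le> k \<or> j \<in> {1..i}} \<le> card {1..k}" by (rule card_mono[rotated]) simp
    then show "card {j \<in> {1..n}. j \<le> k \<or> j \<in> {1..i}} \<le> L k" using L(2)[of k] k by simp
  qed (use i in auto)
  note f = this
  have geS: "Suc k \<le> L k" if "k \<in> {1..n}" for k using L(2)[OF that] by simp
  show ?thesis
  proof (cases "i \<le> N")
    case True
    have A: "card {1..i} = N \<and> even N \<and> (\<forall>j\<in>{1..i} - {a}. c a = 2 * c j)"
      if "a \<in> {1..i}" "Suc N \<le> L a" "c a \<noteq> 0" for a
      by (rule linform_power_one_large[OF _ _ N(1) that(1) _ that(2,3) f]) (use True ge i(1) in auto)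
    have Ai: "i = N" "even N" "\<forall>j\<in>{1..i} - {i}. c i = 2 * c j"
      using A[of i] i iL by auto
    have "L j = N" if j: "j \<in> {1..<N}" for j
    proof (rule ccontr)
      assume "L j \<noteq> N"
      then have "Suc N \<le> L j" using ge[of j] j i(1) Ai(1) by auto
      moreover have "c i = 2 * c j" using Ai j by auto
      moreover from this have "c j \<noteq> 0" using i(2) by auto
      ultimately have "\<forall>k\<in>{1..i} - {j}. c j = 2 * c k" using A[of j] j Ai(1) by auto
      moreover have "i \<in> {1..i} - {j}" using i(1) j Ai(1) by auto
      ultimately have "c j = 2 * c i" by blast
      then show False using \<open>c i = 2 * c j\<close> i(2) by simp
    qed
    moreover have "L N = Suc N"
    proof (rule ccontr)
      assume "L N \<noteq> Suc N"
      then have two: "N + 2 \<le> L i" using iL Ai(1) by simp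
      have "1 \<in> {1..i} - {i}" using Ai(1) N(1) by simp
      then have c1: "c i = 2 * c 1" using Ai(3) by blast
      have "linform c {1..i} ^ N \<notin> K {1..i} L"
      proof (rule linform_power_two_large[where a = i and v = "c 1"])
        show "c 1 \<noteq> 0" using c1 i(2) by auto
        show "c j = c 1" if "j \<in> {1..i} - {i}" for j
          using bspec[OF Ai(3) that] c1 by simp
        show "N \<le> L k" if "k \<in> {1..i} - {i}" for k by (rule ge) (use that i(1) in auto)
      qed (use two Ai(1) N(1) i(2) in simp_all)
      then show False using f by blast
    qed
    ultimately show ?thesis using Ai by blast
  next
    case False
    then have "c i = 0" using linform_power_tail[of N i L c] N(1) ge geS i(1) f by auto
    then show ?thesis using i(2) by simp
  qed
qed simp

section \<open>Relations among images of the variables\<close>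

lemma subst_h_insert:
  "finite T \<Longrightarrow> a \<notin> T \<Longrightarrow>
    subst u (h (Suc m) (insert a T)) = subst u (h (Suc m) T) + u a * subst u (h m (insert a T))"
  by (simp add: h_insert)

lemma subst_h_cong:
  assumes "finite T" "\<And>j. j \<in> T \<Longrightarrow> u j = u' j" shows "subst u (h m T) = subst u' (h m T)"
proof (rule subst_cong)
  fix e j assume "e \<in> ks (h m T)" "j \<in> ks e"
  then have "j \<in> T" unfolding in_keys_iff[of e] lookup_h[OF assms(1)] by (auto split: if_splits)
  then show "u j = u' j" by (rule assms(2))
qed

text \<open>For each \<open>i\<close> the generator has the lowest degree; \<open>h_insert\<close>
  raises the degree by one, since monotonicity puts the polynomial in one variable less into
  \<open>Q\<close> as well.\<close>

lemma subst_h_initial_in: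
  assumes Q: "is_ideal Q" and mono: "\<And>j k. 1 \<le> j \<Longrightarrow> j \<le> k \<Longrightarrow> k \<le> n \<Longrightarrow> L j \<le> L k"
    and L: "\<And>k. k \<in> {1..n} \<Longrightarrow> k < L k"
    and gens: "\<And>i. i \<in> {1..n} \<Longrightarrow> subst u (h (L i - i + 1) {1..i}) \<in> Q"
    and i: "i \<in> {1..n}" and m: "L i < m + i"
  shows "subst u (h m {1..i}) \<in> Q"
  using i m
proof (induction i arbitrary: m)
  case (Suc i)
  note IH = Suc.IH
  have "L (Suc i) - Suc i + 1 \<le> m" using Suc.prems L[of "Suc i"] by simp
  then show ?case
  proof (induction m rule: dec_induct)
    case base
    show ?case by (rule gens[OF Suc.prems(1)])
  next
    case (step m)
    have "subst u (h (Suc m) {1..i}) \<in> Q"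
    proof (cases "i = 0")
      case True
      then show ?thesis using ideal_0[OF Q] by simp
    next
      case False
      then have "L i \<le> L (Suc i)" "i \<in> {1..n}" using mono[of i "Suc i"] Suc.prems(1) by auto
      then show ?thesis using IH step.hyps by auto
    qed
    moreover have "{1..Suc i} = insert (Suc i) {1..i}" by auto
    ultimately show ?case
      using step.IH subst_h_insert[of "{1..i}" "Suc i" u m] ideal_add[OF Q] ideal_mult[OF Q] by simp
  qed
qed simp

text \<open>The recursion is read backwards: elements are added to \<open>U\<close> until it fills
  \<open>{1..i}\<close>, and \<open>m + card U\<close> never decreases. Singletons \<open>U\<close>
  then give the vanishing of \<open>u j ^ L j\<close> modulo \<open>Q\<close>.\<close>

lemma subst_h_in:
  assumes Q: "is_ideal Q" and mono: "\<And>j k. 1 \<le> j \<Longrightarrow> j \<le> k \<Longrightarrow> k \<le> n \<Longrightarrow> L j \<le> L k"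
    and L: "\<And>k. k \<in> {1..n} \<Longrightarrow> k < L k"
    and gens: "\<And>i. i \<in> {1..n} \<Longrightarrow> subst u (h (L i - i + 1) {1..i}) \<in> Q"
    and i: "i \<in> {1..n}" and U: "U \<subseteq> {1..i}" "L i < m + card U"
  shows "subst u (h m U) \<in> Q"
  using U
proof (induction "card ({1..i} - U)" arbitrary: U m)
  case 0
  then have "U = {1..i}" by auto
  then show ?case using subst_h_initial_in[OF Q mono L gens i] "0.prems"(2) by simp
next
  case (Suc d)
  have fin: "finite U" using Suc.prems(1) finite_subset by blast
  have "{1..i} - U \<noteq> {}" using Suc.hyps(2) by (metis card.empty nat.distinct(1))
  then obtain a where a: "a \<in> {1..i}" "a \<notin> U" by blast
  have "card U \<le> i" using card_mono[OF _ Suc.prems(1)] by simp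
  then have "m \<noteq> 0" using Suc.prems(2) L[OF i] by auto
  then obtain m' where m': "m = Suc m'" using not0_implies_Suc by blast
  have "{1..i} - insert a U = ({1..i} - U) - {a}" by auto
  then have d: "d = card ({1..i} - insert a U)" using Suc.hyps(2) a by simp
  have "subst u (h (Suc m') (insert a U)) \<in> Q" "subst u (h m' (insert a U)) \<in> Q"
    using Suc.prems a fin m' by (auto intro!: Suc.hyps(1)[OF d])
  then have "subst u (h (Suc m') (insert a U)) - u a * subst u (h m' (insert a U)) \<in> Q"
    by (intro ideal_diff[OF Q] ideal_mult[OF Q])
  then show ?case using subst_h_insert[OF fin a(2), of u m'] by (simp add: m')
qed

text \<open>The sum over \<open>T\<close> is treated as a further variable, with index \<open>0\<close> and value minus the sum.\<close>

lemma sum_power_in: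
  assumes Q: "is_ideal Q" and T: "finite T" "Suc (card T) = N" "0 \<notin> T"
    and rel: "\<And>V m. V \<subseteq> T \<Longrightarrow> N < m + card V \<Longrightarrow> subst u (h m V) \<in> Q"
  shows "(\<Sum>j\<in>T. u j) ^ N \<in> Q"
proof -
  define w where "w = - (\<Sum>j\<in>T. u j)"
  define u' where "u' = u(0 := w)"
  have u'0: "u' 0 = w" by (simp add: u'_def)
  have u: "subst u' (h m V) = subst u (h m V)" if "V \<subseteq> T" for V m
    by (rule subst_h_cong) (use that T finite_subset in \<open>auto simp: u'_def\<close>)
  \<comment> \<open>The additional root makes the set larger by one, hence \<open>\<le>\<close> in
    place of \<open><\<close>; the condition \<open>1 \<le> m\<close> excludes \<open>h 0\<close>,
    which is \<open>1\<close>.\<close>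
  have "subst u' (h m (insert 0 V)) \<in> Q" if "V \<subseteq> T" "N \<le> m + card V" "1 \<le> m" for V m
    using that
  proof (induction "card (T - V)" arbitrary: V m)
    case 0
    then have V: "V = T" using T(1) by auto
    show ?case using "0.prems"(3) unfolding V
    proof (induction m rule: dec_induct)
      case base
      have "subst u' (h 1 (insert 0 T)) = 0"
        using subst_h_insert[OF T(1,3), of u' 0] u[of T 1] T(1)
        by (simp add: h_1 subst_sum u'0) (simp add: w_def)
      then show ?case by (simp only: ideal_0[OF Q])
    next
      case (step m)
      have "subst u' (h (Suc m) T) \<in> Q" using rel[of T "Suc m"] u[of T "Suc m"] T step.hyps by auto
      then show ?case
        using subst_h_insert[OF T(1,3), of u' m] step.IH ideal_add[OF Q] ideal_mult[OF Q] by simp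
    qed
  next
    case (Suc d)
    have fin: "finite V" using Suc.prems(1) T(1) finite_subset by blast
    have "T - V \<noteq> {}" using Suc.hyps(2) by (metis card.empty nat.distinct(1))
    then obtain a where a: "a \<in> T" "a \<notin> V" by blast
    have "card (insert a V) \<le> card T" using card_mono[OF T(1), of "insert a V"] a Suc.prems(1) by simp
    then have "card V < card T" using fin a by simp
    then have "2 \<le> m" using Suc.prems T(2) by simp
    then obtain m' where m': "m = Suc m'" "1 \<le> m'" by (cases m) auto
    have "T - insert a V = (T - V) - {a}" by auto
    then have d: "d = card (T - insert a V)" using Suc.hyps(2) a by simp
    have "subst u' (h (Suc m') (insert 0 (insert a V))) \<in> Q" "subst u' (h m' (insert 0 (insert a V))) \<in> Q"
      using Suc.prems a fin m' by (auto intro!: Suc.hyps(1)[OF d])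
    then have "subst u' (h (Suc m') (insert a (insert 0 V))) - u' a * subst u' (h m' (insert a (insert 0 V))) \<in> Q"
      unfolding insert_commute[of a 0] by (intro ideal_diff[OF Q] ideal_mult[OF Q])
    moreover have "a \<notin> insert 0 V" using a T(3) by (metis insertE)
    ultimately show ?case using subst_h_insert[of "insert 0 V" a u' m'] fin by (simp add: m')
  qed
  from this[of "{}" N] have "w ^ N \<in> Q" using T(2) by (simp add: h_singleton u'0)
  then have "(- 1) ^ N * w ^ N \<in> Q" by (rule ideal_mult[OF Q])
  then show ?thesis by (simp add: w_def power_mult_distrib[symmetric])
qed

text \<open>Completing the square: with \<open>W\<close> the sum over \<open>T\<close>, the square
  of \<open>2 * u a + W\<close> differs from that of \<open>W\<close> by
  \<open>4 * (u a * (u a + W))\<close>, and \<open>u a * (u a + W)\<close> is a difference of two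
  values of \<open>h 2\<close>. As \<open>N\<close> is even, the power is congruent to
  \<open>W ^ N\<close>.\<close>

lemma double_sum_power_in:
  assumes Q: "is_ideal Q" and T: "finite T" "Suc (card T) = N" "0 \<notin> T" "a \<notin> T" and N: "even N"
    and rel: "\<And>V m. V \<subseteq> T \<Longrightarrow> N < m + card V \<Longrightarrow> subst u (h m V) \<in> Q"
      "subst u (h 2 (insert a T)) \<in> Q"
  shows "(2 * u a + (\<Sum>j\<in>T. u j)) ^ N \<in> Q"
proof -
  let ?W = "\<Sum>j\<in>T. u j" and ?z = "2 * u a + (\<Sum>j\<in>T. u j)"
  have "subst u (h 2 T) \<in> Q" using rel(1)[of T 2] T by simp
  moreover have "subst u (h 2 (insert a T)) - subst u (h 2 T) = u a * (u a + ?W)"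
    using subst_h_insert[OF T(1,4), of u 1] subst_h_insert[OF T(1,4), of u 0] T(1)
    by (simp add: numeral_2_eq_2 h_1 subst_sum add.commute)
  ultimately have "u a * (u a + ?W) \<in> Q" using ideal_diff[OF Q rel(2)] by metis
  then have "4 * (u a * (u a + ?W)) \<in> Q" by (rule ideal_mult[OF Q])
  moreover have "4 * (u a * (u a + ?W)) = 1 * (?z\<^sup>2 - ?W\<^sup>2)"
    by (simp add: algebra_simps power2_eq_square)
  ultimately have "1 * (?z\<^sup>2 - ?W\<^sup>2) \<in> Q" by (simp only:)
  then have "1 * ((?z\<^sup>2) ^ (N div 2) - (?W\<^sup>2) ^ (N div 2)) \<in> Q"
    by (rule ideal_power_cong[OF Q])
  then have "?z ^ N - ?W ^ N \<in> Q" using N by (simp add: power_mult[symmetric])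
  moreover have "?W ^ N \<in> Q" by (rule sum_power_in[OF Q T(1-3) rel(1)])
  ultimately show ?thesis using ideal_cong[OF Q] by blast
qed

lemma subst_h_shift:
  assumes "\<And>j. j \<in> {1..k} \<Longrightarrow> u j = 0"
  shows "subst u (h m {1..i + k}) = subst (\<lambda>j. u (j + k)) (h m {1..i})"
proof (induction i arbitrary: m)
  case 0
  have "subst u (h (Suc m) {1..l}) = 0" if "l \<le> k" for l m
    using that
  proof (induction l)
    case (Suc l)
    have "{1..Suc l} = insert (Suc l) {1..l}" by auto
    then show ?case using subst_h_insert[of "{1..l}" "Suc l" u m] Suc assms by simp
  qed simp
  then show ?case by (cases m) simp_all
next
  case (Suc i)
  note IH = Suc.IH
  show ?case
  proof (induction m)
    case (Suc m)
    have "{1..Suc i + k} = insert (Suc i + k) {1..i + k}" "{1..Suc i} = insert (Suc i) {1..i}" by auto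
    then show ?case
      using subst_h_insert[of "{1..i + k}" "Suc i + k" u m]
        subst_h_insert[of "{1..i}" "Suc i" "\<lambda>j. u (j + k)" m] Suc IH by simp
  qed simp
qed

section \<open>Integer matrices\<close>

lemma odd_sum_mult:
  fixes x y :: "nat \<Rightarrow> int"
  shows "odd (\<Sum>l\<in>B. x l * y l) \<longleftrightarrow> odd (\<Sum>l\<in>B. if odd (x l) then y l else 0)"
proof -
  have "even (\<Sum>l\<in>B. x l * y l - (if odd (x l) then y l else 0))"
    by (rule dvd_sum) auto
  then have "even ((\<Sum>l\<in>B. x l * y l) - (\<Sum>l\<in>B. if odd (x l) then y l else 0))"
    by (simp only: sum_subtractf)
  then show ?thesis by (auto simp: even_diff even_add)
qed

text \<open>Reducing modulo \<open>2\<close>, a left inverse gives an injection between the power sets.\<close>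

lemma left_inverse_imp_le:
  fixes a b :: "nat \<Rightarrow> nat \<Rightarrow> int"
  assumes inv: "\<And>j j'. j \<in> {1..p} \<Longrightarrow> j' \<in> {1..p} \<Longrightarrow>
      (\<Sum>l\<in>{1..q}. a j l * b l j') = (if j = j' then 1 else 0)"
  shows "p \<le> q"
proof -
  \<comment> \<open>Subsets are vectors over the field with two elements; \<open>?F\<close>
    multiplies the indicator vector of \<open>A\<close> by the matrix \<open>a\<close>.\<close>
  let ?F = "\<lambda>A. {l\<in>{1..q}. odd (\<Sum>j\<in>A. a j l)}"
  have rec: "j' \<in> A \<longleftrightarrow> odd (\<Sum>l\<in>{1..q}. if l \<in> ?F A then b l j' else 0)"
    if A: "A \<subseteq> {1..p}" and j': "j' \<in> {1..p}" for A j'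
  proof -
    have fin: "finite A" using A finite_subset by blast
    have "(\<Sum>l\<in>{1..q}. (\<Sum>j\<in>A. a j l) * b l j') = (\<Sum>j\<in>A. \<Sum>l\<in>{1..q}. a j l * b l j')"
      unfolding sum_distrib_right by (rule sum.swap)
    also have "\<dots> = (\<Sum>j\<in>A. if j = j' then 1 else 0)"
      by (rule sum.cong) (use inv A j' in auto)
    also have "\<dots> = (if j' \<in> A then 1 else 0)" using fin by simp
    finally have "j' \<in> A \<longleftrightarrow> odd (\<Sum>l\<in>{1..q}. (\<Sum>j\<in>A. a j l) * b l j')" by simp
    also have "\<dots> \<longleftrightarrow> odd (\<Sum>l\<in>{1..q}. if odd (\<Sum>j\<in>A. a j l) then b l j' else 0)"
      by (rule odd_sum_mult)
    also have "(\<Sum>l\<in>{1..q}. if odd (\<Sum>j\<in>A. a j l) then b l j' else 0) =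
        (\<Sum>l\<in>{1..q}. if l \<in> ?F A then b l j' else 0)" by (rule sum.cong) auto
    finally show ?thesis .
  qed
  have "inj_on ?F (Pow {1..p})"
  proof (rule inj_onI)
    fix A A' assume A: "A \<in> Pow {1..p}" "A' \<in> Pow {1..p}" and eq: "?F A = ?F A'"
    have "j \<in> A \<longleftrightarrow> j \<in> A'" if "j \<in> {1..p}" for j
      using rec[of A j] rec[of A' j] A that unfolding eq by blast
    then show "A = A'" using A by blast
  qed
  then have "card (Pow {1..p}) \<le> card (Pow {1..q})"
    by (rule card_inj_on_le) auto
  then show ?thesis by (simp add: card_Pow)
qed

section \<open>Recovering the parts\<close>

text \<open>Functions in place of lists, so that passing to a tail is a shift of the index.\<close>

definition partition_fun :: "nat \<Rightarrow> (nat \<Rightarrow> nat) \<Rightarrow> bool" where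
  "partition_fun m L \<longleftrightarrow> (\<forall>j k. 1 \<le> j \<longrightarrow> j \<le> k \<longrightarrow> k \<le> m \<longrightarrow> L j \<le> L k) \<and> (\<forall>k\<in>{1..m}. k < L k)"

lemma partition_fun_mono: "partition_fun m L \<Longrightarrow> 1 \<le> j \<Longrightarrow> j \<le> k \<Longrightarrow> k \<le> m \<Longrightarrow> L j \<le> L k"
  and partition_fun_less: "partition_fun m L \<Longrightarrow> k \<in> {1..m} \<Longrightarrow> k < L k"
  by (auto simp: partition_fun_def)

text \<open>The rows of \<open>a\<close> are the images of the variables. The images of the
  generators are only asked to lie in \<open>K\<close>, which is the ideal that the statements on
  powers refer to.\<close>

definition maps_rel :: "nat \<Rightarrow> (nat \<Rightarrow> nat) \<Rightarrow> (nat \<Rightarrow> nat) \<Rightarrow> (nat \<Rightarrow> nat \<Rightarrow> int) \<Rightarrow> bool" where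
  "maps_rel m L M a \<longleftrightarrow>
    (\<forall>i\<in>{1..m}. subst (\<lambda>j. linform (a j) {1..m}) (h (L i - i + 1) {1..i}) \<in> K {1..m} M)"

definition inverse_on :: "nat \<Rightarrow> (nat \<Rightarrow> nat \<Rightarrow> int) \<Rightarrow> (nat \<Rightarrow> nat \<Rightarrow> int) \<Rightarrow> bool" where
  "inverse_on m a b \<longleftrightarrow>
    (\<forall>j\<in>{1..m}. \<forall>j'\<in>{1..m}. (\<Sum>l\<in>{1..m}. a j l * b l j') = (if j = j' then 1 else 0))"

text \<open>The exceptional case, in which \<open>2 X\<^sub>N + X\<^sub>1 + \<dots> + X\<^bsub>N-1\<^esub>\<close> is nilpotent of order \<open>N\<close> as well.\<close>

definition exceptional :: "nat \<Rightarrow> (nat \<Rightarrow> nat) \<Rightarrow> bool" where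
  "exceptional m L \<longleftrightarrow> even (L 1) \<and> L 1 \<le> m \<and> L (L 1) = Suc (L 1) \<and> (\<forall>j\<in>{1..<L 1}. L j = L 1)"

text \<open>In the exceptional case the block of parts equal to \<open>L 1\<close> has length
  \<open>L 1 - 1\<close>, and one further variable is counted.\<close>

definition head_len :: "nat \<Rightarrow> (nat \<Rightarrow> nat) \<Rightarrow> nat" where
  "head_len m L = (if exceptional m L then L 1 else card {j\<in>{1..m}. L j = L 1})"

lemma initial_block:
  assumes L: "partition_fun m L" and j: "j \<in> {1..m}"
  shows "j \<le> card {j\<in>{1..m}. L j = L 1} \<longleftrightarrow> L j = L 1"
proof
  assume le: "j \<le> card {j\<in>{1..m}. L j = L 1}"
  show "L j = L 1"
  proof (rule ccontr)
    assume "L j \<noteq> L 1"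
    then have "L 1 < L j" using partition_fun_mono[OF L, of 1 j] j by auto
    have "i \<in> {1..<j}" if i: "i \<in> {j\<in>{1..m}. L j = L 1}" for i
    proof (rule ccontr)
      assume "i \<notin> {1..<j}"
      then have "L j \<le> L i" using i j by (intro partition_fun_mono[OF L]) auto
      then show False using i \<open>L 1 < L j\<close> by simp
    qed
    then have "{j\<in>{1..m}. L j = L 1} \<subseteq> {1..<j}" by blast
    then have "card {j\<in>{1..m}. L j = L 1} \<le> card {1..<j}" by (rule card_mono[rotated]) simp
    then show False using le j by auto
  qed
next
  assume eq: "L j = L 1"
  have "L i = L 1" if "i \<in> {1..j}" for i
  proof (rule antisym)
    show "L i \<le> L 1" using partition_fun_mono[OF L, of i j] that j eq by simp
    show "L 1 \<le> L i" using that j by (intro partition_fun_mono[OF L]) auto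
  qed
  moreover have "{1..j} \<subseteq> {1..m}" using j by simp
  ultimately have "{1..j} \<subseteq> {j\<in>{1..m}. L j = L 1}" by blast
  then have "card {1..j} \<le> card {j\<in>{1..m}. L j = L 1}" by (rule card_mono[rotated]) simp
  then show "j \<le> card {j\<in>{1..m}. L j = L 1}" by simp
qed

lemma head_len_le: "head_len m L \<le> m"
proof -
  have "card {j\<in>{1..m}. L j = L 1} \<le> card {1..m}" by (rule card_mono) auto
  then have "card {j\<in>{1..m}. L j = L 1} \<le> m" by simp
  moreover have "L 1 \<le> m" if "exceptional m L" using that unfolding exceptional_def by blast
  ultimately show ?thesis unfolding head_len_def by presburger
qed

text \<open>The classification is applied to the last index with nonzero coefficient, which bounds
  all the others.\<close>

lemma nilpotent_linform:
  assumes L: "partition_fun m L" and N: "2 \<le> N" "N \<le> L 1"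
    and c: "k \<in> {1..m}" "c k \<noteq> 0" and f: "linform c {1..m} ^ N \<in> K {1..m} L"
  shows "N = L 1" and "k \<le> head_len m L"
proof -
  define i where "i = Max {k\<in>{1..m}. c k \<noteq> 0}"
  have "i \<in> {k\<in>{1..m}. c k \<noteq> 0}" unfolding i_def by (rule Max_in) (use c in auto)
  then have i: "i \<in> {1..m}" "c i \<noteq> 0" by auto
  have le: "j \<le> i" if "j \<in> {1..m}" "c j \<noteq> 0" for j
    unfolding i_def by (rule Max_ge) (use that in auto)
  have "L i = N \<or> (i = N \<and> even N \<and> L N = Suc N \<and> (\<forall>j\<in>{1..<N}. L j = N))"
  proof (rule nilpotent_linform_cases[OF N _ _ i _ f])
    show "c j = 0" if "j \<in> {i<..m}" for j
      using le[of j] that i(1) by (cases "c j = 0") simp_all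
  qed (rule partition_fun_mono[OF L] partition_fun_less[OF L], assumption+)+
  then have "N = L 1 \<and> i \<le> head_len m L"
  proof
    assume Li: "L i = N"
    then have 1: "N = L 1" using partition_fun_mono[OF L, of 1 i] i(1) N(2) by auto
    show ?thesis
    proof (cases "exceptional m L")
      case True
      have "i \<le> L 1"
      proof (rule ccontr)
        assume "\<not> i \<le> L 1"
        then have "L (L 1) \<le> L i" using partition_fun_mono[OF L, of "L 1" i] i(1) N by auto
        moreover have "L (L 1) = Suc (L 1)" using True unfolding exceptional_def by blast
        ultimately show False using Li 1 by linarith
      qed
      then show ?thesis using True 1 by (simp add: head_len_def)
    next
      case False
      then show ?thesis using initial_block[OF L i(1)] Li 1 by (simp add: head_len_def)
    qed
  next
    assume e: "i = N \<and> even N \<and> L N = Suc N \<and> (\<forall>j\<in>{1..<N}. L j = N)"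
    moreover have "1 \<in> {1..<N}" using N(1) by simp
    ultimately have 1: "L 1 = N" by blast
    moreover have "exceptional m L" unfolding exceptional_def 1 using e i(1) by simp
    ultimately show ?thesis using e by (simp add: head_len_def)
  qed
  then show "N = L 1" "k \<le> head_len m L" using le[OF c] by auto
qed

lemma maps_rel_h_in:
  assumes "maps_rel m L M a" "partition_fun m L" "i \<in> {1..m}" "U \<subseteq> {1..i}" "L i < d + card U"
  shows "subst (\<lambda>j. linform (a j) {1..m}) (h d U) \<in> K {1..m} M"
proof (rule subst_h_in[where n = m and L = L and i = i, OF ideal_K])
  show "subst (\<lambda>j. linform (a j) {1..m}) (h (L k - k + 1) {1..k}) \<in> K {1..m} M" if "k \<in> {1..m}" for k
    using assms(1) that unfolding maps_rel_def by blast
qed (use assms(2-5) in \<open>auto simp: partition_fun_def\<close>)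

lemma maps_rel_power:
  assumes "maps_rel m L M a" "partition_fun m L" "j \<in> {1..m}"
  shows "linform (a j) {1..m} ^ L j \<in> K {1..m} M"
  using maps_rel_h_in[OF assms, of "{j}" "L j"] assms(3) by (simp add: h_singleton)

lemma maps_rel_exceptional:
  assumes r: "maps_rel m L M a" and L: "partition_fun m L" and e: "exceptional m L" and m: "1 \<le> m"
  shows "linform (\<lambda>l. 2 * a (L 1) l + (\<Sum>j\<in>{1..<L 1}. a j l)) {1..m} ^ L 1 \<in> K {1..m} M"
proof -
  let ?N = "L 1" and ?u = "\<lambda>j. linform (a j) {1..m}"
  have N: "2 \<le> ?N" using partition_fun_less[OF L, of 1] m by simp
  have e': "even ?N" "?N \<le> m" "L ?N = Suc ?N" "\<And>j. j \<in> {1..<?N} \<Longrightarrow> L j = ?N"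
    using e unfolding exceptional_def by blast+
  have "(2 * ?u ?N + (\<Sum>j\<in>{1..<?N}. ?u j)) ^ ?N \<in> K {1..m} M"
  proof (rule double_sum_power_in[OF ideal_K])
    fix V d assume V: "V \<subseteq> {1..<?N}" "?N < d + card V"
    have "{1..<?N} = {1..?N - 1}" using N by auto
    then have "V \<subseteq> {1..?N - 1}" using V(1) by simp
    moreover have i: "?N - 1 \<in> {1..m}" "?N - 1 \<in> {1..<?N}" using N e'(2) by (auto intro: le_trans[of _ ?N])
    moreover have "L (?N - 1) < d + card V" unfolding e'(4)[OF i(2)] by (rule V(2))
    ultimately show "subst ?u (h d V) \<in> K {1..m} M" using maps_rel_h_in[OF r L] by blast
  next
    have "insert ?N {1..<?N} = {1..?N}" using N by auto
    then show "subst ?u (h 2 (insert ?N {1..<?N})) \<in> K {1..m} M"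
      using maps_rel_h_in[OF r L, of ?N "{1..?N}" 2] e'(2,3) N by auto
  qed (use N e'(1) in auto)
  moreover have "2 * ?u ?N + (\<Sum>j\<in>{1..<?N}. ?u j) =
      linform (\<lambda>l. 2 * a ?N l + (\<Sum>j\<in>{1..<?N}. a j l)) {1..m}"
  proof -
    have "(\<Sum>j\<in>{1..<?N}. ?u j) = (\<Sum>l\<in>{1..m}. \<Sum>j\<in>{1..<?N}. of_int (a j l) * X l)"
      unfolding linform_def by (rule sum.swap)
    then show ?thesis
      by (simp add: linform_def sum_distrib_left sum.distrib distrib_right sum_distrib_right mult.assoc)
  qed
  ultimately show ?thesis by simp
qed

lemma inverse_on_nonzero:
  assumes "inverse_on m a b" "j \<in> {1..m}"
  obtains l where "l \<in> {1..m}" "a j l \<noteq> 0"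
proof -
  have "(\<Sum>l\<in>{1..m}. a j l * b l j) \<noteq> 0" using assms by (simp add: inverse_on_def)
  then obtain l where "l \<in> {1..m}" "a j l * b l j \<noteq> 0" by (rule sum.not_neutral_contains_not_neutral)
  then show ?thesis using that by simp
qed

text \<open>The first row of \<open>a\<close> is a nonzero form whose power \<open>L 1\<close> lies
  in the ideal for \<open>M\<close>, and no nonzero form has an order below
  \<open>M 1\<close>.\<close>

lemma first_part_le:
  assumes L: "partition_fun m L" and M: "partition_fun m M" and m: "1 \<le> m"
    and r: "maps_rel m L M a" and inv: "inverse_on m a b"
  shows "M 1 \<le> L 1"
proof (rule ccontr)
  assume less: "\<not> M 1 \<le> L 1"
  obtain l where l: "l \<in> {1..m}" "a 1 l \<noteq> 0" using inverse_on_nonzero[OF inv, of 1] m by auto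
  have "2 \<le> L 1" using partition_fun_less[OF L, of 1] m by simp
  then have "L 1 = M 1"
    using nilpotent_linform(1)[OF M _ _ l maps_rel_power[OF r L]] less m by auto
  then show False using less by simp
qed

text \<open>If \<open>L j = L 1\<close>, then row \<open>j\<close> is a form with vanishing power
  \<open>L 1\<close>, and \<open>nilpotent_linform\<close> applies. Otherwise \<open>j = L 1\<close>
  in the exceptional case: twice row \<open>j\<close> plus the earlier rows is such a form, the
  earlier rows vanish at \<open>l\<close>, and hence so does row \<open>j\<close>.\<close>

lemma head_preserved:
  assumes L: "partition_fun m L" and M: "partition_fun m M" and m: "1 \<le> m"
    and r: "maps_rel m L M a" and eq: "L 1 = M 1"
    and j: "j \<in> {1..head_len m L}" and l: "l \<in> {head_len m M<..m}"
  shows "a j l = 0"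
proof (rule ccontr)
  assume nz: "a j l \<noteq> 0"
  have N: "2 \<le> L 1" using partition_fun_less[OF L, of 1] m by simp
  have l': "l \<in> {1..m}" using l by auto
  have jm: "j \<in> {1..m}" using j head_len_le[of m L] by auto
  have zero: "a i l = 0" if "i \<in> {1..m}" "L i = L 1" for i
  proof (rule ccontr)
    assume "a i l \<noteq> 0"
    then have "l \<le> head_len m M"
      using nilpotent_linform(2)[OF M N _ l'] maps_rel_power[OF r L that(1)] that(2) eq by auto
    then show False using l by simp
  qed
  then have Lj: "L j \<noteq> L 1" using nz jm by blast
  have e: "exceptional m L"
    using initial_block[OF L jm] Lj j by (auto simp: head_len_def split: if_splits)
  then have "j \<le> L 1" using j by (simp add: head_len_def)
  moreover have "\<not> j < L 1"
  proof
    assume "j < L 1"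
    then have "j \<in> {1..<L 1}" using j by simp
    then show False using e Lj unfolding exceptional_def by blast
  qed
  ultimately have jN: "j = L 1" by simp
  have "a i l = 0" if "i \<in> {1..<L 1}" for i
  proof (rule zero)
    show "L i = L 1" using e that unfolding exceptional_def by blast
    show "i \<in> {1..m}" using that jm jN by simp
  qed
  then have "2 * a (L 1) l + (\<Sum>i\<in>{1..<L 1}. a i l) \<noteq> 0" using nz jN by simp
  then have "l \<le> head_len m M"
    using nilpotent_linform(2)[OF M N _ l' _ maps_rel_exceptional[OF r L e m]] eq by auto
  then show False using l by simp
qed

text \<open>By \<open>head_preserved\<close> the head rows of \<open>a\<close> have no entries
  outside the head of \<open>M\<close>, so the product of the head blocks of \<open>a\<close> and
  \<open>b\<close> is still an identity matrix.\<close>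

lemma head_len_mono:
  assumes L: "partition_fun m L" and M: "partition_fun m M" and m: "1 \<le> m"
    and r: "maps_rel m L M a" and inv: "inverse_on m a b" and eq: "L 1 = M 1"
  shows "head_len m L \<le> head_len m M"
proof (rule left_inverse_imp_le)
  fix j j' assume j: "j \<in> {1..head_len m L}" "j' \<in> {1..head_len m L}"
  have "(\<Sum>l\<in>{1..head_len m M}. a j l * b l j') = (\<Sum>l\<in>{1..m}. a j l * b l j')"
    by (rule sum.mono_neutral_left)
      (use head_len_le[of m M] head_preserved[OF L M m r eq j(1)] in auto)
  also have "\<dots> = (if j = j' then 1 else 0)"
    using inv j head_len_le[of m L] unfolding inverse_on_def by auto
  finally show "(\<Sum>l\<in>{1..head_len m M}. a j l * b l j') = (if j = j' then 1 else 0)" .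
qed

text \<open>An ordinary block of length \<open>r\<close> has \<open>r < L r = L 1\<close>, whereas
  the exceptional head has length \<open>L 1\<close>; so the first part and the head length tell the
  two cases apart.\<close>

lemma head_determines:
  assumes L: "partition_fun m L" and M: "partition_fun m M" and m: "1 \<le> m"
    and eq: "L 1 = M 1" "head_len m L = head_len m M" and j: "j \<in> {1..head_len m L}"
  shows "L j = M j"
proof -
  have *: "head_len m L' < L' 1" if "partition_fun m L'" "\<not> exceptional m L'" for L'
  proof -
    let ?r = "card {j\<in>{1..m}. L' j = L' 1}"
    have "?r \<le> m" using head_len_le[of m L'] that(2) by (simp add: head_len_def)
    moreover have "1 \<le> ?r" using initial_block[OF that(1), of 1] m by simp
    ultimately have "L' ?r = L' 1" "?r < L' ?r"
      using initial_block[OF that(1), of ?r] partition_fun_less[OF that(1), of ?r] by auto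
    then show ?thesis using that(2) by (simp add: head_len_def)
  qed
  have iff: "exceptional m L \<longleftrightarrow> exceptional m M"
    using *[OF L] *[OF M] eq by (metis head_len_def less_irrefl)
  have jm: "j \<in> {1..m}" using j head_len_le[of m L] by auto
  show ?thesis
  proof (cases "exceptional m L")
    case True
    then have "j \<in> {1..<L 1} \<or> j = L 1" using j by (auto simp: head_len_def)
    then show ?thesis
    proof
      assume j': "j \<in> {1..<L 1}"
      then have "L j = L 1" "M j = M 1" using True iff eq(1) unfolding exceptional_def by (blast, metis)
      then show ?thesis using eq(1) by simp
    next
      assume j': "j = L 1"
      have "L (L 1) = Suc (L 1)" "M (M 1) = Suc (M 1)" using True iff unfolding exceptional_def by blast+
      then show ?thesis using eq(1) j' by simp
    qed
  next
    case False
    then show ?thesis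
      using initial_block[OF L jm] initial_block[OF M jm] iff eq j by (simp add: head_len_def)
  qed
qed

lemma tail_induction_step:
  assumes L: "partition_fun m L" and M: "partition_fun m M" and m: "1 \<le> m"
    and r: "maps_rel m L M a" "maps_rel m M L b" and inv: "inverse_on m a b" "inverse_on m b a"
  obtains k where "k \<in> {1..m}" "\<And>j. j \<in> {1..k} \<Longrightarrow> L j = M j"
    "\<And>j l. j \<in> {1..k} \<Longrightarrow> l \<in> {k<..m} \<Longrightarrow> a j l = 0 \<and> b j l = 0"
proof -
  have eq: "L 1 = M 1"
    using first_part_le[OF L M m r(1) inv(1)] first_part_le[OF M L m r(2) inv(2)] by simp
  have heq: "head_len m L = head_len m M"
    using head_len_mono[OF L M m r(1) inv(1) eq] head_len_mono[OF M L m r(2) inv(2) eq[symmetric]] by simp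
  have "1 \<le> card {j\<in>{1..m}. L j = L 1}" using initial_block[OF L, of 1] m by simp
  moreover have "1 \<le> L 1" using partition_fun_less[OF L, of 1] m by simp
  ultimately have "1 \<le> head_len m L" by (simp add: head_len_def)
  then show thesis
    using that[of "head_len m L"] head_len_le[of m L] head_determines[OF L M m eq heq]
      head_preserved[OF L M m r(1) eq] head_preserved[OF M L m r(2) eq[symmetric]] heq by auto
qed

section \<open>Induction over the tails of the partitions\<close>

lemma sum_shift: "(\<Sum>l\<in>{1..m}. f (l + k)) = (\<Sum>l\<in>{k<..m + k}. f l)" for f :: "nat \<Rightarrow> 'a::comm_monoid_add"
  by (rule sum.reindex_bij_witness[where i = "\<lambda>l. l - k" and j = "\<lambda>l. l + k"]) auto

text \<open>The first \<open>k\<close> variables of the target are set to zero and the others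
  renumbered, for all \<open>k\<close> at once and with the original matrix. The induction then only
  has to raise \<open>k\<close>.\<close>

definition maps_rel_tails :: "nat \<Rightarrow> (nat \<Rightarrow> nat) \<Rightarrow> (nat \<Rightarrow> nat) \<Rightarrow> (nat \<Rightarrow> nat \<Rightarrow> int) \<Rightarrow> bool" where
  "maps_rel_tails n L M a \<longleftrightarrow> (\<forall>k\<le>n. \<forall>i\<in>{1..n}.
    subst (\<lambda>j. linform (\<lambda>l. a j (l + k)) {1..n - k}) (h (L i - i + 1) {1..i})
      \<in> K {1..n - k} (\<lambda>i. M (i + k) - k))"

text \<open>The first \<open>k\<close> rows of \<open>a\<close> vanish after the renumbering, so the
  relation with index \<open>i + k\<close> becomes the one with index \<open>i\<close> of the tail;
  its degree is the same, as both the part and the index drop by \<open>k\<close>.\<close>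

lemma maps_rel_tail:
  assumes "maps_rel_tails n L M a" "k \<le> n" "\<And>j l. j \<in> {1..k} \<Longrightarrow> l \<in> {k<..n} \<Longrightarrow> a j l = 0"
  shows "maps_rel (n - k) (\<lambda>i. L (i + k) - k) (\<lambda>i. M (i + k) - k) (\<lambda>j l. a (j + k) (l + k))"
  unfolding maps_rel_def
proof
  fix i assume i: "i \<in> {1..n - k}"
  let ?u = "\<lambda>j. linform (\<lambda>l. a j (l + k)) {1..n - k}"
  have "?u j = 0" if "j \<in> {1..k}" for j
    unfolding linform_def by (rule sum.neutral) (use assms(2) assms(3)[OF that] in auto)
  then have "subst ?u (h d {1..i + k}) = subst (\<lambda>j. ?u (j + k)) (h d {1..i})" for d
    by (rule subst_h_shift)
  moreover have "subst ?u (h (L (i + k) - (i + k) + 1) {1..i + k}) \<in> K {1..n - k} (\<lambda>i. M (i + k) - k)"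
    using assms(1,2) i unfolding maps_rel_tails_def by auto
  moreover have "L (i + k) - (i + k) + 1 = L (i + k) - k - i + 1" by simp
  ultimately show "subst (\<lambda>j. ?u (j + k)) (h (L (i + k) - k - i + 1) {1..i}) \<in> K {1..n - k} (\<lambda>i. M (i + k) - k)"
    by simp
qed

lemma partition_fun_tail: "partition_fun n L \<Longrightarrow> partition_fun (n - k) (\<lambda>i. L (i + k) - k)"
  unfolding partition_fun_def by (auto intro!: diff_le_mono simp: less_diff_conv)

text \<open>The columns of \<open>b\<close> beyond \<open>k\<close> have no entries in the first
  \<open>k\<close> rows, so the omitted summands are zero.\<close>

lemma inverse_on_tail:
  assumes "inverse_on n a b" "k \<le> n" "\<And>j l. j \<in> {1..k} \<Longrightarrow> l \<in> {k<..n} \<Longrightarrow> b j l = 0"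
  shows "inverse_on (n - k) (\<lambda>j l. a (j + k) (l + k)) (\<lambda>j l. b (j + k) (l + k))"
  unfolding inverse_on_def
proof (intro ballI)
  fix j j' assume j: "j \<in> {1..n - k}" "j' \<in> {1..n - k}"
  have "(\<Sum>l\<in>{1..n - k}. a (j + k) (l + k) * b (l + k) (j' + k)) =
      (\<Sum>l\<in>{k<..n - k + k}. a (j + k) l * b l (j' + k))" by (rule sum_shift)
  also have "\<dots> = (\<Sum>l\<in>{1..n}. a (j + k) l * b l (j' + k))"
    by (rule sum.mono_neutral_left) (use j assms(2,3) in auto)
  also have "\<dots> = (if j = j' then 1 else 0)" using assms(1) j unfolding inverse_on_def by auto
  finally show "(\<Sum>l\<in>{1..n - k}. a (j + k) (l + k) * b (l + k) (j' + k)) = (if j = j' then 1 else 0)" .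
qed

lemma parts_eq:
  assumes L: "partition_fun n L" and M: "partition_fun n M"
    and rel: "maps_rel_tails n L M a" "maps_rel_tails n M L b"
    and inv: "inverse_on n a b" "inverse_on n b a" and j: "j \<in> {1..n}"
  shows "L j = M j"
proof -
  have "\<forall>j\<in>{1..n}. L j = M j"
    if "k \<le> n" "\<And>j. j \<in> {1..k} \<Longrightarrow> L j = M j"
      "\<And>j l. j \<in> {1..k} \<Longrightarrow> l \<in> {k<..n} \<Longrightarrow> a j l = 0"
      "\<And>j l. j \<in> {1..k} \<Longrightarrow> l \<in> {k<..n} \<Longrightarrow> b j l = 0" for k
    using that
  proof (induction "n - k" arbitrary: k rule: less_induct)
    case less
    show ?case
    proof (cases "k = n")
      case True
      then show ?thesis using less.prems(2) by blast
    next
      case False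
      then have m: "1 \<le> n - k" using less.prems(1) by simp
      obtain k' where k': "k' \<in> {1..n - k}"
        and eq: "\<And>j. j \<in> {1..k'} \<Longrightarrow> L (j + k) - k = M (j + k) - k"
        and zero: "\<And>j l. j \<in> {1..k'} \<Longrightarrow> l \<in> {k'<..n - k} \<Longrightarrow> a (j + k) (l + k) = 0 \<and> b (j + k) (l + k) = 0"
        using tail_induction_step[OF partition_fun_tail[OF L] partition_fun_tail[OF M] m
            maps_rel_tail[OF rel(1) less.prems(1,3)] maps_rel_tail[OF rel(2) less.prems(1,4)]
            inverse_on_tail[OF inv(1) less.prems(1,4)] inverse_on_tail[OF inv(2) less.prems(1,3)]]
        by blast
      show ?thesis
      proof (rule less.hyps[of "k + k'"])
        show "n - (k + k') < n - k" "k + k' \<le> n" using k' by auto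
        note this(2)
        fix j assume j: "j \<in> {1..k + k'}"
        \<comment> \<open>The subtraction in \<open>eq\<close> is truncated; these bounds allow the
          common \<open>- k\<close> to be cancelled.\<close>
        have LM: "k < L j" "k < M j" if "k < j"
        proof -
          have "j \<in> {1..n}" using j \<open>k + k' \<le> n\<close> by auto
          then show "k < L j" "k < M j"
            using partition_fun_less[OF L, of j] partition_fun_less[OF M, of j] that by auto
        qed
        show "L j = M j"
        proof (cases "j \<le> k")
          case True
          then show ?thesis using less.prems(2) j by simp
        next
          case False
          then have j': "j - k \<in> {1..k'}" "j - k + k = j" using j by auto
          have "L j - k = M j - k" using eq[OF j'(1)] unfolding j'(2) .
          then show ?thesis using LM False by linarith
        qed
        fix l assume l: "l \<in> {k + k'<..n}"
        have "a j l = 0 \<and> b j l = 0"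
        proof (cases "j \<le> k")
          case True
          then show ?thesis using less.prems(3)[of j l] less.prems(4)[of j l] j l by simp
        next
          case False
          then have "j - k \<in> {1..k'}" "j - k + k = j" using j by auto
          moreover have "l - k \<in> {k'<..n - k}" "l - k + k = l"
            using l by (auto simp: less_diff_conv intro: diff_le_mono)
          ultimately show ?thesis using zero[of "j - k" "l - k"] by simp
        qed
        then show "a j l = 0" "b j l = 0" by simp_all
      qed
    qed
  qed
  from this[of 0] show ?thesis using j by auto
qed

section \<open>From graded isomorphisms to matrices\<close>

text \<open>An induction principle: every element of the carrier is an integral combination of
  products of the variables.\<close>

lemma carrier_poly_ring_subset:
  assumes "p \<in> carrier (poly_ring n)" and "1 \<in> A" "\<And>x y. x \<in> A \<Longrightarrow> y \<in> A \<Longrightarrow> x + y \<in> A"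
    "\<And>x y. x \<in> A \<Longrightarrow> y \<in> A \<Longrightarrow> x * y \<in> A" "\<And>x. x \<in> A \<Longrightarrow> - x \<in> A"
    "\<And>j. j \<in> {1..n} \<Longrightarrow> X j \<in> A"
  shows "p \<in> A"
proof -
  have zero: "0 \<in> A" using assms(3)[OF assms(2) assms(5)[OF assms(2)]] by simp
  have ofnat: "of_nat m \<in> A" for m
    by (induction m) (simp_all add: zero assms(2,3))
  have ofint: "of_int c \<in> A" for c
    by (cases c rule: int_cases2) (simp_all add: ofnat assms(5))
  have pow: "x ^ m \<in> A" if "x \<in> A" for x m
    using that by (induction m) (simp_all add: assms(2,4))
  have prod: "(\<Prod>j\<in>T. x j) \<in> A" if "\<And>j. j \<in> T \<Longrightarrow> x j \<in> A" for x and T :: "nat set"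
    using that by (induction T rule: infinite_finite_induct) (simp_all add: assms(2,4))
  have sum: "(\<Sum>e\<in>T. x e) \<in> A" if "\<And>e. e \<in> T \<Longrightarrow> x e \<in> A" for x and T :: "monomial set"
    using that by (induction T rule: infinite_finite_induct) (simp_all add: zero assms(3))
  have "p = (\<Sum>e\<in>ks p. of_int (lk p e) * mon X e)"
    using subst_X_id[of p] by (simp add: subst_def lin_ext_def)
  also have "\<dots> \<in> A"
  proof (intro sum assms(4) ofint)
    fix e assume "e \<in> ks p"
    then have "ks e \<subseteq> {1..n}" using assms(1) by (simp add: poly_ring_def)
    then show "mon X e \<in> A" unfolding mon_def by (intro prod pow assms(6)) blast
  qed
  finally show ?thesis .
qed

lemma X_in_homogeneous: "j \<in> {1..n} \<Longrightarrow> X j \<in> homogeneous n 1"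
  by (simp add: homogeneous_def poly_ring_def X_def)

lemma homogeneous_carrier: "p \<in> homogeneous n d \<Longrightarrow> p \<in> carrier (poly_ring n)"
  by (simp add: homogeneous_def)

lemma poly_ring_simps:
  "zero (poly_ring n) = 0" "one (poly_ring n) = 1" "add (poly_ring n) = (+)" "monoid.mult (poly_ring n) = (*)"
  by (simp_all add: poly_ring_def)

lemma uminus_carrier: "p \<in> carrier (poly_ring n) \<Longrightarrow> - p \<in> carrier (poly_ring n)"
  by (simp add: poly_ring_def)

lemma subst_carrier:
  assumes "p \<in> carrier (poly_ring n)" "\<And>j. j \<in> {1..n} \<Longrightarrow> u j \<in> carrier (poly_ring n')"
  shows "subst u p \<in> carrier (poly_ring n')"
proof -
  interpret R': cring "poly_ring n'" by (rule cring_poly_ring)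
  have "p \<in> {p. subst u p \<in> carrier (poly_ring n')}"
  proof (rule carrier_poly_ring_subset[OF assms(1)])
    show "x + y \<in> {p. subst u p \<in> carrier (poly_ring n')}"
      if "x \<in> {p. subst u p \<in> carrier (poly_ring n')}" "y \<in> {p. subst u p \<in> carrier (poly_ring n')}" for x y
      using R'.add.m_closed[of "subst u x" "subst u y"] that by (simp add: poly_ring_simps)
    show "x * y \<in> {p. subst u p \<in> carrier (poly_ring n')}"
      if "x \<in> {p. subst u p \<in> carrier (poly_ring n')}" "y \<in> {p. subst u p \<in> carrier (poly_ring n')}" for x y
      using R'.m_closed[of "subst u x" "subst u y"] that by (simp add: poly_ring_simps)
    show "1 \<in> {p. subst u p \<in> carrier (poly_ring n')}"
      using R'.one_closed by (simp add: poly_ring_simps)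
  qed (use assms(2) in \<open>auto intro: uminus_carrier\<close>)
  then show ?thesis by simp
qed

lemma ring_hom_eq_on_poly_ring:
  assumes S: "ring S" and \<phi>: "\<phi> \<in> ring_hom (poly_ring n) S" and \<psi>: "\<psi> \<in> ring_hom (poly_ring n) S"
    and eq: "\<And>j. j \<in> {1..n} \<Longrightarrow> \<phi> (X j) = \<psi> (X j)" and p: "p \<in> carrier (poly_ring n)"
  shows "\<phi> p = \<psi> p"
proof -
  interpret R: cring "poly_ring n" by (rule cring_poly_ring)
  interpret S: ring S by (rule S)
  let ?A = "{p \<in> carrier (poly_ring n). \<phi> p = \<psi> p}"
  have "p \<in> ?A"
  proof (rule carrier_poly_ring_subset[OF p])
    show "1 \<in> ?A" using R.one_closed ring_hom_one[OF \<phi>] ring_hom_one[OF \<psi>] by (simp add: poly_ring_simps)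
    show "x + y \<in> ?A" if "x \<in> ?A" "y \<in> ?A" for x y
      using that R.add.m_closed[of x y] ring_hom_add[OF \<phi>, of x y] ring_hom_add[OF \<psi>, of x y]
      by (simp add: poly_ring_simps)
    show "x * y \<in> ?A" if "x \<in> ?A" "y \<in> ?A" for x y
      using that R.m_closed[of x y] ring_hom_mult[OF \<phi>, of x y] ring_hom_mult[OF \<psi>, of x y]
      by (simp add: poly_ring_simps)
    show "- x \<in> ?A" if x: "x \<in> ?A" for x
    proof -
      have c: "x \<in> carrier (poly_ring n)" "- x \<in> carrier (poly_ring n)" using x uminus_carrier by auto
      have neg: "\<chi> (- x) = \<ominus>\<^bsub>S\<^esub> \<chi> x" if \<chi>: "\<chi> \<in> ring_hom (poly_ring n) S" for \<chi>
      proof -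
        have "\<chi> (- x) \<oplus>\<^bsub>S\<^esub> \<chi> x = \<chi> (zero (poly_ring n))"
          using ring_hom_add[OF \<chi> c(2,1)] by (simp add: poly_ring_simps)
        also have "\<dots> = \<zero>\<^bsub>S\<^esub>" by (rule ring_hom_zero[OF \<chi> R.ring_axioms S])
        finally show ?thesis
          using S.minus_equality[of "\<chi> (- x)" "\<chi> x"] ring_hom_closed[OF \<chi>] c by auto
      qed
      show ?thesis using neg[OF \<phi>] neg[OF \<psi>] x c by simp
    qed
    show "X j \<in> ?A" if "j \<in> {1..n}" for j
      using eq[OF that] homogeneous_carrier[OF X_in_homogeneous[OF that]] by simp
  qed
  then show ?thesis by simp
qed

lemma single_1_eq_iff: "sgl l 1 = (sgl j 1 :: monomial) \<longleftrightarrow> l = j"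
proof
  assume "sgl l 1 = (sgl j 1 :: monomial)"
  then have "ks (sgl l 1 :: monomial) = ks (sgl j 1 :: monomial)" by (simp only:)
  then show "l = j" by simp
qed simp

lemma lookup_linform_sum: "lk (linform c {1..n}) e = (\<Sum>l\<in>{1..n}. if e = sgl l 1 then c l else 0)"
  unfolding linform_def lookup_sum lookup_of_int_mult
  by (rule sum.cong) (simp_all add: X_def lookup_single when_def eq_commute[of e])

lemma lookup_linform: "lk (linform c {1..n}) (sgl j 1) = (if j \<in> {1..n} then c j else 0)"
  unfolding lookup_linform_sum single_1_eq_iff by (simp add: sum.delta)

lemma homogeneous_1_linform:
  assumes "p \<in> homogeneous n 1" shows "p = linform (\<lambda>l. lk p (sgl l 1)) {1..n}"
proof (rule poly_mapping_eqI)
  fix e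
  show "lk p e = lk (linform (\<lambda>l. lk p (sgl l 1)) {1..n}) e"
  proof (cases "e \<in> ks p")
    case True
    then have e: "ks e \<subseteq> {1..n}" "mdeg e = 1" using assms by (simp_all add: homogeneous_def poly_ring_def)
    then have "ks e \<noteq> {}" by (auto simp: mdeg_def)
    then obtain l where l: "l \<in> ks e" by blast
    then have "1 \<le> lk e l" by (simp add: in_keys_iff)
    then obtain e' where e': "e = sgl l 1 + e'" using monomial_split by blast
    then have "mdeg e' = 0" using e(2) mdeg_single[of l 1] mdeg_add[of "sgl l 1" e'] by simp
    then have "e = sgl l 1" using e' by (simp add: mdeg_eq_0_iff)
    moreover have "l \<in> {1..n}" using e(1) l by blast
    ultimately show ?thesis by (simp only: lookup_linform if_True)
  next
    case False
    then have "lk p e = 0" by (simp add: in_keys_iff)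
    then have "(\<Sum>l\<in>{1..n}. if e = sgl l 1 then lk p (sgl l 1) else 0) = 0"
      by (intro sum.neutral ballI) (auto simp del: One_nat_def)
    then show ?thesis unfolding lookup_linform_sum \<open>lk p e = 0\<close> by (rule sym)
  qed
qed

lemma linform_homogeneous: "linform c {1..n} \<in> homogeneous n 1"
proof -
  have "\<exists>l\<in>{1..n}. e = sgl l 1" if "e \<in> ks (linform c {1..n})" for e
  proof -
    have "(\<Sum>l\<in>{1..n}. if e = sgl l 1 then c l else 0) \<noteq> 0"
      using that unfolding in_keys_iff lookup_linform_sum .
    then obtain l where "l \<in> {1..n}" "(if e = sgl l 1 then c l else 0) \<noteq> 0"
      by (rule sum.not_neutral_contains_not_neutral)
    then show ?thesis by (auto split: if_splits)
  qed
  then show ?thesis unfolding homogeneous_def poly_ring_def by fastforce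
qed

lemma subst_linform: "subst u (linform c S) = (\<Sum>l\<in>S. of_int (c l) * u l)"
  by (simp add: linform_def subst_sum)

lemma subst_linform_linform:
  "subst (\<lambda>l. linform (b l) T) (linform c S) = linform (\<lambda>j. \<Sum>l\<in>S. c l * b l j) T"
proof -
  have "subst (\<lambda>l. linform (b l) T) (linform c S) = (\<Sum>l\<in>S. \<Sum>j\<in>T. of_int (c l * b l j) * X j)"
    unfolding subst_linform by (simp add: linform_def sum_distrib_left mult.assoc)
  also have "\<dots> = (\<Sum>j\<in>T. \<Sum>l\<in>S. of_int (c l * b l j) * X j)" by (rule sum.swap)
  finally show ?thesis by (simp add: linform_def sum_distrib_right)
qed

lemma a_inv_poly_ring: "p \<in> carrier (poly_ring n) \<Longrightarrow> \<ominus>\<^bsub>poly_ring n\<^esub> p = - p"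
proof -
  assume p: "p \<in> carrier (poly_ring n)"
  interpret R: cring "poly_ring n" by (rule cring_poly_ring)
  show ?thesis using R.minus_equality[of "- p" p] p uminus_carrier[OF p] by (simp add: poly_ring_simps)
qed

lemma ideal_Int_carrier:
  assumes Q: "is_ideal Q" shows "ideal (Q \<inter> carrier (poly_ring n)) (poly_ring n)"
proof -
  interpret R: cring "poly_ring n" by (rule cring_poly_ring)
  show ?thesis
  proof (rule idealI[OF R.ring_axioms])
    show "subgroup (Q \<inter> carrier (poly_ring n)) (add_monoid (poly_ring n))"
    proof (rule R.add.subgroupI)
      show "Q \<inter> carrier (poly_ring n) \<noteq> {}"
        using ideal_0[OF Q] R.zero_closed by (auto simp: poly_ring_simps)
      show "\<ominus>\<^bsub>poly_ring n\<^esub> a \<in> Q \<inter> carrier (poly_ring n)" if "a \<in> Q \<inter> carrier (poly_ring n)" for a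
        using that a_inv_poly_ring uminus_carrier ideal_uminus[OF Q] by auto
      show "a \<oplus>\<^bsub>poly_ring n\<^esub> b \<in> Q \<inter> carrier (poly_ring n)"
        if "a \<in> Q \<inter> carrier (poly_ring n)" "b \<in> Q \<inter> carrier (poly_ring n)" for a b
        using that R.add.m_closed[of a b] ideal_add[OF Q] by (auto simp: poly_ring_simps)
    qed auto
    show "x \<otimes>\<^bsub>poly_ring n\<^esub> a \<in> Q \<inter> carrier (poly_ring n)" "a \<otimes>\<^bsub>poly_ring n\<^esub> x \<in> Q \<inter> carrier (poly_ring n)"
      if "a \<in> Q \<inter> carrier (poly_ring n)" "x \<in> carrier (poly_ring n)" for a x
      using that R.m_closed[of x a] R.m_closed[of a x] ideal_mult[OF Q] ideal_mult'[OF Q]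
      by (auto simp: poly_ring_simps)
  qed
qed

section \<open>The ideal of a partition\<close>

lemma h_carrier: "i \<le> n \<Longrightarrow> h m {1..i} \<in> carrier (poly_ring n)"
  using complete_hom_homogeneous[of i n m] by (simp add: complete_hom_eq homogeneous_def)

lemma part_ideal_subset:
  assumes Q: "is_ideal Q" and gens: "\<And>i. i \<in> {1..length lam} \<Longrightarrow> h (part lam i - i + 1) {1..i} \<in> Q"
  shows "part_ideal lam \<subseteq> Q"
proof -
  interpret R: cring "poly_ring (length lam)" by (rule cring_poly_ring)
  have "part_ideal lam \<subseteq> Q \<inter> carrier (poly_ring (length lam))"
    unfolding part_ideal_def complete_hom_eq
    by (rule R.genideal_minimal[OF ideal_Int_carrier[OF Q]]) (use gens in \<open>auto simp del: One_nat_def intro: h_carrier\<close>)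
  then show ?thesis by blast
qed

lemma gen_in_part_ideal:
  assumes "i \<in> {1..length lam}" shows "h (part lam i - i + 1) {1..i} \<in> part_ideal lam"
proof -
  interpret R: cring "poly_ring (length lam)" by (rule cring_poly_ring)
  have "{h (part lam i - i + 1) {1..i} |i. i \<in> {1..length lam}} \<subseteq> part_ideal lam"
    unfolding part_ideal_def complete_hom_eq by (rule R.genideal_self) (auto simp del: One_nat_def intro: h_carrier)
  then show ?thesis using assms by blast
qed

lemma part_ideal_carrier: "p \<in> part_ideal lam \<Longrightarrow> p \<in> carrier (poly_ring (length lam))"
  using ideal.Icarr[OF ideal_part_ideal] .

lemma partition_fun_part: "indecomposable lam \<Longrightarrow> partition_fun (length lam) (part lam)"
  unfolding indecomposable_iff partition_fun_def
  using sorted_nth_mono[of lam] by (auto simp: Defs.part_def)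

text \<open>Indecomposability makes every generator have degree at least \<open>2\<close>. So linear
  forms embed into the quotient, and identities between matrices can be read off there.\<close>

lemma part_ideal_mdeg:
  assumes "indecomposable lam" "p \<in> part_ideal lam" "e \<in> ks p" shows "2 \<le> mdeg e"
proof -
  let ?Q = "{p :: int_mpoly. \<forall>e\<in>ks p. 2 \<le> mdeg e}"
  have "is_ideal ?Q" unfolding is_ideal_def
  proof (intro conjI ballI allI)
    fix p q assume "p \<in> ?Q" "q \<in> ?Q"
    then show "p + q \<in> ?Q" using keys_add[of p q] by blast
  next
    fix p r assume p: "p \<in> ?Q"
    show "r * p \<in> ?Q"
    proof (rule CollectI, rule ballI)
      fix e assume "e \<in> ks (r * p)"
      then obtain x y where "e = x + y" "y \<in> ks p" using keys_mult[of r p] by blast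
      then show "2 \<le> mdeg e" using p by (auto simp: mdeg_add intro: trans_le_add2)
    qed
  qed simp
  moreover have "h (part lam i - i + 1) {1..i} \<in> ?Q" if "i \<in> {1..length lam}" for i
  proof (rule CollectI, rule ballI)
    fix e assume "e \<in> ks (h (part lam i - i + 1) {1..i})"
    then have "mdeg e = part lam i - i + 1"
      unfolding in_keys_iff lookup_h[OF finite_atLeastAtMost] by (simp split: if_splits)
    then show "2 \<le> mdeg e" using partition_fun_less[OF partition_fun_part[OF assms(1)] that] by simp
  qed
  ultimately have "part_ideal lam \<subseteq> ?Q" by (rule part_ideal_subset)
  then show ?thesis using assms(2,3) by blast
qed

definition shift_var :: "nat \<Rightarrow> nat \<Rightarrow> int_mpoly" where
  "shift_var k l = (if l \<le> k then 0 else X (l - k))"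

lemma subst_shift_var_linform:
  assumes "k \<le> n"
  shows "subst (shift_var k) (linform c {1..n}) = linform (\<lambda>l. c (l + k)) {1..n - k}"
proof -
  have "subst (shift_var k) (linform c {1..n}) = (\<Sum>l\<in>{k<..n - k + k}. of_int (c l) * X (l - k))"
    unfolding subst_linform
    by (rule sum.mono_neutral_cong_right) (use assms in \<open>auto simp: shift_var_def\<close>)
  also have "\<dots> = (\<Sum>l\<in>{1..n - k}. of_int (c (l + k)) * X (l + k - k))" by (rule sum_shift[symmetric])
  finally show ?thesis by (simp add: linform_def)
qed

text \<open>Setting \<open>k\<close> variables to zero keeps the degree and removes \<open>k\<close>
  variables, which matches exponents lowered by \<open>k\<close>. For \<open>i \<le> k\<close> a
  polynomial of positive degree is evaluated at zero.\<close>

lemma subst_shift_var_gen: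
  assumes M: "partition_fun n M" and k: "k \<le> n" and i: "i \<in> {1..n}"
  shows "subst (shift_var k) (h (M i - i + 1) {1..i}) \<in> K {1..n - k} (\<lambda>i. M (i + k) - k)"
proof (cases "i \<le> k")
  case True
  have "subst (shift_var k) (h (M i - i + 1) {1..0 + i}) =
      subst (\<lambda>j. shift_var k (j + i)) (h (M i - i + 1) {1..0})"
    by (rule subst_h_shift) (use True in \<open>simp add: shift_var_def\<close>)
  then show ?thesis using ideal_0[OF ideal_K] by simp
next
  case False
  define i' where "i' = i - k"
  have i': "i = i' + k" "i' \<in> {1..n - k}" using False i by (auto simp: i'_def)
  have "subst (shift_var k) (h (M i - i + 1) {1..i' + k}) =
      subst (\<lambda>j. shift_var k (j + k)) (h (M i - i + 1) {1..i'})"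
    by (rule subst_h_shift) (simp add: shift_var_def)
  also have "\<dots> = subst X (h (M i - i + 1) {1..i'})"
    by (rule subst_h_cong) (auto simp: shift_var_def)
  finally have "subst (shift_var k) (h (M i - i + 1) {1..i}) = h (Suc (M i - i)) {1..i'}"
    by (simp add: i'(1) subst_X_id)
  moreover have "h (Suc (M i - i)) {1..i'} \<in> K {1..n - k} (\<lambda>i. M (i + k) - k)"
  proof (rule h_Suc_in_K)
    fix j assume j: "j \<in> {1..i'}"
    have "M (j + k) \<le> M i" using j i' i by (intro partition_fun_mono[OF M]) auto
    then show "M (j + k) - k \<le> M i - i + card {1..i'}"
      using partition_fun_less[OF M i] i'(1) by simp
  qed (use i'(2) in auto)
  ultimately show ?thesis by simp
qed

section \<open>Graded homomorphisms as integer matrices\<close>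

abbreviation cls :: "nat list \<Rightarrow> int_mpoly \<Rightarrow> int_mpoly set" where
  "cls lam p \<equiv> part_ideal lam +>\<^bsub>poly_ring (length lam)\<^esub> p"

lemma cls_hom: "cls lam \<in> ring_hom (poly_ring (length lam)) (part_ring lam)"
  unfolding part_ring_def by (rule ideal.rcos_ring_hom[OF ideal_part_ideal])

lemma cls_eq_zero_iff:
  assumes "p \<in> carrier (poly_ring (length lam))"
  shows "cls lam p = \<zero>\<^bsub>part_ring lam\<^esub> \<longleftrightarrow> p \<in> part_ideal lam"
proof -
  interpret R: cring "poly_ring (length lam)" by (rule cring_poly_ring)
  have "\<zero>\<^bsub>part_ring lam\<^esub> = part_ideal lam" by (simp add: part_ring_def FactRing_def)
  then show ?thesis
    using ideal.rcos_const_imp_mem[OF ideal_part_ideal assms] R.a_rcos_zero[OF ideal_part_ideal] by auto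
qed

lemma cls_eq_imp_diff:
  assumes "p \<in> carrier (poly_ring (length lam))" "q \<in> carrier (poly_ring (length lam))" "cls lam p = cls lam q"
  shows "p - q \<in> part_ideal lam"
proof -
  interpret R: cring "poly_ring (length lam)" by (rule cring_poly_ring)
  interpret S: cring "part_ring lam" by (rule cring_part_ring)
  have d: "p - q \<in> carrier (poly_ring (length lam))"
    using R.add.m_closed[OF assms(1) uminus_carrier[OF assms(2)]] by (simp add: poly_ring_simps)
  have "cls lam (p - q) \<oplus>\<^bsub>part_ring lam\<^esub> cls lam q = cls lam p"
    using ring_hom_add[OF cls_hom d assms(2)] by (simp add: poly_ring_simps)
  then have "cls lam (p - q) \<oplus>\<^bsub>part_ring lam\<^esub> cls lam q = \<zero>\<^bsub>part_ring lam\<^esub> \<oplus>\<^bsub>part_ring lam\<^esub> cls lam q"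
    using ring_hom_closed[OF cls_hom assms(2)] assms(3) by simp
  then have "cls lam (p - q) = \<zero>\<^bsub>part_ring lam\<^esub>"
    using ring_hom_closed[OF cls_hom] d assms(2) by (subst (asm) S.add.right_cancel) auto
  then show ?thesis using cls_eq_zero_iff[OF d] by simp
qed

lemma graded_hom_matrix:
  assumes "f ` part_ring_grade lam 1 = part_ring_grade mu 1"
  shows "\<exists>a. \<forall>j\<in>{1..length lam}. f (cls lam (X j)) = cls mu (linform (a j) {1..length mu})"
proof -
  have "\<exists>c. f (cls lam (X j)) = cls mu (linform c {1..length mu})" if "j \<in> {1..length lam}" for j
  proof -
    have "cls lam (X j) \<in> part_ring_grade lam 1"
      unfolding part_ring_grade_def by (rule imageI[OF X_in_homogeneous[OF that]])
    then have "f (cls lam (X j)) \<in> part_ring_grade mu 1" using assms by blast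
    then obtain p where "p \<in> homogeneous (length mu) 1" "f (cls lam (X j)) = cls mu p"
      unfolding part_ring_grade_def by blast
    then show ?thesis using homogeneous_1_linform by metis
  qed
  then show ?thesis by metis
qed

lemma hom_cls:
  assumes f: "f \<in> ring_hom (part_ring lam) (part_ring mu)"
    and a: "\<And>j. j \<in> {1..length lam} \<Longrightarrow> f (cls lam (X j)) = cls mu (linform (a j) {1..length mu})"
    and p: "p \<in> carrier (poly_ring (length lam))"
  shows "f (cls lam p) = cls mu (subst (\<lambda>j. linform (a j) {1..length mu}) p)"
proof -
  let ?u = "\<lambda>j. linform (a j) {1..length mu}"
  have u: "?u j \<in> carrier (poly_ring (length mu))" for j
    by (rule homogeneous_carrier[OF linform_homogeneous])
  have "subst ?u \<in> ring_hom (poly_ring (length lam)) (poly_ring (length mu))"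
    by (rule ring_hom_memI) (simp_all add: poly_ring_simps subst_carrier[OF _ u] del: One_nat_def)
  then have h1: "cls mu \<circ> subst ?u \<in> ring_hom (poly_ring (length lam)) (part_ring mu)"
    using cls_hom by (rule ring_hom_trans)
  have h2: "f \<circ> cls lam \<in> ring_hom (poly_ring (length lam)) (part_ring mu)"
    using cls_hom f by (rule ring_hom_trans)
  have "(f \<circ> cls lam) (X j) = (cls mu \<circ> subst ?u) (X j)" if "j \<in> {1..length lam}" for j
    using a[OF that] by (simp only: comp_apply subst_X)
  from ring_hom_eq_on_poly_ring[OF cring.axioms(1)[OF cring_part_ring] h2 h1 this p]
  show ?thesis by (simp only: comp_apply)
qed

lemma subst_part_ideal:
  assumes f: "f \<in> ring_hom (part_ring lam) (part_ring mu)"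
    and a: "\<And>j. j \<in> {1..length lam} \<Longrightarrow> f (cls lam (X j)) = cls mu (linform (a j) {1..length mu})"
    and p: "p \<in> part_ideal lam"
  shows "subst (\<lambda>j. linform (a j) {1..length mu}) p \<in> part_ideal mu"
proof -
  have c: "p \<in> carrier (poly_ring (length lam))" by (rule part_ideal_carrier[OF p])
  let ?p = "subst (\<lambda>j. linform (a j) {1..length mu}) p"
  have "cls mu ?p = f (cls lam p)" by (rule hom_cls[OF f a c, symmetric])
  also have "f (cls lam p) = \<zero>\<^bsub>part_ring mu\<^esub>"
    using ring_hom_zero[OF f cring.axioms(1)[OF cring_part_ring] cring.axioms(1)[OF cring_part_ring]]
      cls_eq_zero_iff[OF c] p by simp
  finally have zero: "cls mu ?p = \<zero>\<^bsub>part_ring mu\<^esub>" .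
  have "?p \<in> carrier (poly_ring (length mu))"
    by (rule subst_carrier[OF c homogeneous_carrier[OF linform_homogeneous]])
  then show ?thesis using zero by (rule cls_eq_zero_iff[THEN iffD1])
qed

text \<open>The polynomials sent into \<open>K\<close> by the renumbering form an ideal containing
  the generators for \<open>mu\<close>, hence all of \<open>part_ideal mu\<close>, and this contains
  the images of the generators for \<open>lam\<close>.\<close>

lemma hom_maps_rel_tails:
  assumes f: "f \<in> ring_hom (part_ring lam) (part_ring mu)"
    and a: "\<And>j. j \<in> {1..length lam} \<Longrightarrow> f (cls lam (X j)) = cls mu (linform (a j) {1..length mu})"
    and mu: "indecomposable mu" and n: "length lam = length mu"
  shows "maps_rel_tails (length mu) (part lam) (part mu) a"
  unfolding maps_rel_tails_def
proof (intro allI impI ballI)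
  fix k i assume k: "k \<le> length mu" and i: "i \<in> {1..length mu}"
  let ?K = "K {1..length mu - k} (\<lambda>i. part mu (i + k) - k)"
  have "is_ideal {p. subst (shift_var k) p \<in> ?K}"
    unfolding is_ideal_def using ideal_0[OF ideal_K] ideal_add[OF ideal_K] ideal_mult[OF ideal_K] by simp
  then have sub: "part_ideal mu \<subseteq> {p. subst (shift_var k) p \<in> ?K}"
    by (rule part_ideal_subset) (use subst_shift_var_gen[OF partition_fun_part[OF mu] k] in simp)
  have "subst (\<lambda>j. linform (a j) {1..length mu}) (h (part lam i - i + 1) {1..i}) \<in> part_ideal mu"
    by (rule subst_part_ideal[OF f a gen_in_part_ideal]) (use i n in auto)
  then have "subst (shift_var k) (subst (\<lambda>j. linform (a j) {1..length mu}) (h (part lam i - i + 1) {1..i})) \<in> ?K"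
    using sub by blast
  then show "subst (\<lambda>j. linform (\<lambda>l. a j (l + k)) {1..length mu - k}) (h (part lam i - i + 1) {1..i}) \<in> ?K"
    unfolding subst_subst subst_shift_var_linform[OF k] .
qed

text \<open>Since \<open>g\<close> undoes \<open>f\<close>, the linear form given by row
  \<open>j\<close> of the product and \<open>X j\<close> agree modulo \<open>part_ideal lam\<close>,
  which contains no linear terms.\<close>

lemma matrix_left_inverse:
  assumes lam: "indecomposable lam"
    and f: "f \<in> ring_hom (part_ring lam) (part_ring mu)"
    and a: "\<And>j. j \<in> {1..length lam} \<Longrightarrow> f (cls lam (X j)) = cls mu (linform (a j) {1..length mu})"
    and g: "g \<in> ring_hom (part_ring mu) (part_ring lam)"
    and b: "\<And>j. j \<in> {1..length mu} \<Longrightarrow> g (cls mu (X j)) = cls lam (linform (b j) {1..length lam})"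
    and gf: "\<And>x. x \<in> carrier (part_ring lam) \<Longrightarrow> g (f x) = x"
    and j: "j \<in> {1..length lam}" "j' \<in> {1..length lam}"
  shows "(\<Sum>l\<in>{1..length mu}. a j l * b l j') = (if j = j' then 1 else 0)"
proof -
  let ?c = "\<lambda>j'. \<Sum>l\<in>{1..length mu}. a j l * b l j'"
  have X: "X j \<in> carrier (poly_ring (length lam))" by (rule homogeneous_carrier[OF X_in_homogeneous[OF j(1)]])
  have "cls lam (X j) = g (f (cls lam (X j)))" using gf ring_hom_closed[OF cls_hom X] by simp
  also have "\<dots> = g (cls mu (linform (a j) {1..length mu}))" by (simp only: a[OF j(1)])
  also have "\<dots> = cls lam (subst (\<lambda>l. linform (b l) {1..length lam}) (linform (a j) {1..length mu}))"
    by (rule hom_cls[OF g b homogeneous_carrier[OF linform_homogeneous]])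
  also have "\<dots> = cls lam (linform ?c {1..length lam})" by (simp only: subst_linform_linform)
  finally have "linform ?c {1..length lam} - X j \<in> part_ideal lam"
    using X homogeneous_carrier[OF linform_homogeneous] by (intro cls_eq_imp_diff) auto
  then have "sgl j' 1 \<notin> ks (linform ?c {1..length lam} - X j)"
    using part_ideal_mdeg[OF lam, of _ "sgl j' 1"] by force
  then have "lk (linform ?c {1..length lam}) (sgl j' 1) = lk (X j) (sgl j' 1)"
    by (simp only: in_keys_iff lookup_minus not_not right_minus_eq)
  then show ?thesis
    using j unfolding lookup_linform by (simp only: if_True X_def lookup_single when_def single_1_eq_iff)
qed

theorem theorem6p1:
  fixes lam mu :: "nat list"
  assumes "indecomposable lam" and "indecomposable mu" and "lam \<noteq> mu"
  shows "\<not> graded_isomorphic (part_ring lam) (part_ring_grade lam)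
                             (part_ring mu) (part_ring_grade mu)"
proof
  assume "graded_isomorphic (part_ring lam) (part_ring_grade lam) (part_ring mu) (part_ring_grade mu)"
  then obtain f where f: "f \<in> ring_iso (part_ring lam) (part_ring mu)"
    and grade: "f ` part_ring_grade lam 1 = part_ring_grade mu 1"
    unfolding graded_isomorphic_def graded_ring_iso_def by blast
  define g where "g = inv_into (carrier (part_ring lam)) f"
  have hom: "f \<in> ring_hom (part_ring lam) (part_ring mu)"
    and bij: "bij_betw f (carrier (part_ring lam)) (carrier (part_ring mu))"
    using f by (simp_all add: ring_iso_def)
  have "g \<in> ring_iso (part_ring mu) (part_ring lam)"
    unfolding g_def by (rule ring_iso_set_sym[OF cring.axioms(1)[OF cring_part_ring] f])
  then have g: "g \<in> ring_hom (part_ring mu) (part_ring lam)" by (simp add: ring_iso_def)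
  have gf: "g (f x) = x" if "x \<in> carrier (part_ring lam)" for x
    unfolding g_def using bij_betw_inv_into_left[OF bij that] .
  have fg: "f (g y) = y" if "y \<in> carrier (part_ring mu)" for y
    unfolding g_def using bij_betw_inv_into_right[OF bij that] .
  have sub: "part_ring_grade lam 1 \<subseteq> carrier (part_ring lam)"
    unfolding part_ring_grade_def using ring_hom_closed[OF cls_hom] homogeneous_carrier by blast
  have "g ` part_ring_grade mu 1 = part_ring_grade lam 1"
  proof -
    have "g (f x) = x" if "x \<in> part_ring_grade lam 1" for x using gf sub that by blast
    then show ?thesis unfolding grade[symmetric] image_image by simp
  qed
  from graded_hom_matrix[OF this]
  obtain b where "\<forall>j\<in>{1..length mu}. g (cls mu (X j)) = cls lam (linform (b j) {1..length lam})" ..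
  note b = bspec[OF this]
  from graded_hom_matrix[OF grade]
  obtain a where "\<forall>j\<in>{1..length lam}. f (cls lam (X j)) = cls mu (linform (a j) {1..length mu})" ..
  note a = bspec[OF this]
  note ab = matrix_left_inverse[OF assms(1) hom a g b gf]
    and ba = matrix_left_inverse[OF assms(2) g b hom a fg]
  \<comment> \<open>The matrices may still be rectangular here; both products are identity matrices,
    which bounds each length by the other.\<close>
  have "length lam \<le> length mu" by (rule left_inverse_imp_le[where a = a and b = b]) (rule ab)
  moreover have "length mu \<le> length lam" by (rule left_inverse_imp_le[where a = b and b = a]) (rule ba)
  ultimately have n: "length lam = length mu" by (rule antisym)
  have rel: "maps_rel_tails (length mu) (part lam) (part mu) a" "maps_rel_tails (length lam) (part mu) (part lam) b"
    by (rule hom_maps_rel_tails[OF hom a assms(2) n], assumption)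
      (rule hom_maps_rel_tails[OF g b assms(1) n[symmetric]], assumption)
  have "part lam j = part mu j" if "j \<in> {1..length mu}" for j
  proof (rule parts_eq[OF _ _ _ _ _ _ that])
    show "partition_fun (length mu) (part lam)" using partition_fun_part[OF assms(1)] n by simp
    show "inverse_on (length mu) a b" "inverse_on (length mu) b a"
      using ab ba n by (simp_all add: inverse_on_def)
  qed (use rel n partition_fun_part[OF assms(2)] in simp_all)
  note parts = this
  have "lam ! i = mu ! i" if "i < length lam" for i
    using parts[of "Suc i"] that n by (simp add: Defs.part_def)
  with n have "lam = mu" by (rule nth_equalityI)
  then show False using assms(3) by blast
qed

end
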